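(* Let $X$ be a projective variety over a non-Archimedean field $\mathfrak{K}$ and $L$ an ample line bundle on $X$ such that continuity of envelopes holds for $(X,L)$. Let $\phi_0,\phi_1$ be any two psh metrics on $L$. Then either there exists no psh segment between $\phi_0$ and $\phi_1$, or there exists a unique maximal psh segment $t\mapsto\phi_t$ between $\phi_0$ and $\phi_1$.
   Context: **Setting.** $\mathfrak{K}$ is a field complete with respect to a non-Archimedean absolute value (possibly trivial). $X$ is a projective $\mathfrak{K}$-variety (a geometrically integral projective $\mathfrak{K}$-scheme), $L$ is an ample line bundle, $X^{\mathrm{an}}$ is the Berkovich analytification. Tensor powers are written additively: $kL=L^{\otimes k}$, $H^0(kL)=H^0(X,kL)$. **Metrics.** Fix a continuous reference metric $\phi_{\mathrm{ref}}$ on $L$; for $s\in H^0(kL)$ write $|s|=|s|_{k\phi_{\mathrm{ref}}}:X^{\mathrm{an}}\to\mathbb{R}_{\ge0}$. A (possibly singular) metric $\phi$ on $L$ is identified with a function $X^{\mathrm{an}}\to\mathbb{R}\cup\{-\infty\}$ (namely $\phi-\phi_{\mathrm{ref}}$). It is continuous if this function is finite-valued and continuous. **Fubini-Study and psh metrics.** A Fubini-Study metric is one of the form $k^{-1}\max_i(\log|s_i|+\lambda_i)$ with $k\ge1$, $(s_i)$ a finite basepoint-free collection of sections of $H^0(kL)$, and $\lambda_i\in\mathbb{R}$. A metric is psh, written $\phi\in\mathrm{PSH}(L)$, if it is the pointwise limit of a decreasing net of Fubini-Study metrics and is not identically $-\infty$. Continuity of envelopes holds for $(X,L)$ if for every continuous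 metric $\phi$ on $L$ the envelope $P(\phi)=\sup\{\psi\in\mathrm{PSH}(L):\psi\le\phi\}$ is continuous. **Psh segments.** A Fubini-Study segment is a map $[0,1]\ni t\mapsto k^{-1}\max_i(\log|s_i|+(1-t)\lambda_i+t\lambda_i')$ with $(s_i)$ a finite basepoint-free collection of sections of some $H^0(kL)$, $k\ge 1$, and $\lambda_i,\lambda'_i\in\mathbb{R}$. A psh segment is a map $[0,1]\to\mathrm{PSH}(L)$ which is the pointwise limit of a decreasing net of Fubini-Study segments. It is a psh segment between (or joining) $\phi_0$ and $\phi_1$ if its values at $t=0,1$ are $\phi_0,\phi_1$. A psh segment $t\mapsto\phi_t$ between $\phi_0$ and $\phi_1$ is maximal if $\psi_t\le\phi_t$ for all $t\in[0,1]$ and every psh segment $t\mapsto\psi_t$ with $\psi_0\le\phi_0$, $\psi_1\le\phi_1$. *)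

theory Defs
  imports
    "HOL-Analysis.Analysis"
    "HOL-Algebra.QuotRing"
    "HOL-Algebra.Algebraic_Closure_Type"
    "HOL-Library.Poly_Mapping"
begin

section \<open>Non-Archimedean fields\<close>

definition na_absolute_value :: "('a, 'b) ring_scheme \<Rightarrow> ('a \<Rightarrow> real) \<Rightarrow> bool" where
  "na_absolute_value R w \<longleftrightarrow>
     (\<forall>x\<in>carrier R. 0 \<le> w x \<and> (w x = 0 \<longleftrightarrow> x = \<zero>\<^bsub>R\<^esub>)) \<and>
     (\<forall>x\<in>carrier R. \<forall>y\<in>carrier R.
        w (x \<otimes>\<^bsub>R\<^esub> y) = w x * w y \<and> w (x \<oplus>\<^bsub>R\<^esub> y) \<le> max (w x) (w y))"

definition complete_na_field :: "('k::field \<Rightarrow> real) \<Rightarrow> bool" where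
  "complete_na_field v \<longleftrightarrow>
     na_absolute_value ring_of_type_algebra v \<and>
     (\<forall>u :: nat \<Rightarrow> 'k.
        (\<forall>e>0. \<exists>N. \<forall>m\<ge>N. \<forall>n\<ge>N. v (u m - u n) < e) \<longrightarrow>
        (\<exists>l. (\<lambda>n. v (u n - l)) \<longlonglongrightarrow> 0))"

section \<open>Projective schemes\<close>

text \<open>The type \<open>('n, 'k) mpol\<close> is the polynomial ring over \<open>'k\<close> in the variables indexed by the
  finite type \<open>'n\<close>, i.e. the homogeneous coordinate ring of projective space of dimension
  \<open>CARD('n) - 1\<close>. A homogeneous ideal \<open>I\<close> of it stands for the closed subscheme
  \<open>X = Proj ('k[x] / I)\<close> of that projective space, with all of its scheme-theoretic points:
  a point is a homogeneous prime ideal of \<open>'k[x]\<close> containing \<open>I\<close> but not the irrelevant ideal.\<close>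

type_synonym ('n, 'k) mpol = "('n \<Rightarrow>\<^sub>0 nat) \<Rightarrow>\<^sub>0 'k"
type_synonym ('n, 'k) point = "('n, 'k) mpol set"
type_synonym ('n, 'k) germ = "(('n, 'k) mpol \<times> ('n, 'k) mpol) set"
type_synonym ('n, 'k) sect = "('n, 'k) point \<Rightarrow> ('n, 'k) germ"

definition forms :: "nat \<Rightarrow> ('n::finite, 'k::field) mpol set" where
  "forms d = {p. \<forall>m\<in>Poly_Mapping.keys p. (\<Sum>i\<in>UNIV. Poly_Mapping.lookup m i) = d}"

definition homogeneous_ideal :: "('n::finite, 'k::field) mpol set \<Rightarrow> bool" where
  "homogeneous_ideal I \<longleftrightarrow>
     ideal I ring_of_type_algebra \<and> I = Idl\<^bsub>ring_of_type_algebra\<^esub> (I \<inter> (\<Union>d. forms d))"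

definition Proj :: "('n::finite, 'k::field) mpol set \<Rightarrow> ('n, 'k) point set" where
  "Proj I = {P. primeideal P ring_of_type_algebra \<and> homogeneous_ideal P \<and> I \<subseteq> P \<and>
                \<not> (\<Union>d\<in>{1..}. forms d) \<subseteq> P}"

definition zariski :: "('n::finite, 'k::field) mpol set \<Rightarrow> ('n, 'k) point topology" where
  "zariski I = topology_generated_by {{P \<in> Proj I. f \<notin> P} | f. f \<in> (\<Union>d. forms d)}"

text \<open>The local ring of \<open>X\<close> at \<open>P\<close> is the degree \<open>0\<close> part of the localisation of \<open>'k[x] / I\<close> at the
  homogeneous elements outside \<open>P\<close>. Its elements are represented by equivalence classes of pairs
  (numerator, denominator) of polynomials; \<open>fraction I P a f\<close> is the class of \<open>a / f\<close>.\<close>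

definition frac_pairs :: "('n::finite, 'k::field) point \<Rightarrow> (('n, 'k) mpol \<times> ('n, 'k) mpol) set" where
  "frac_pairs P = {(a, f). f \<notin> P \<and> (\<exists>d. a \<in> forms d \<and> f \<in> forms d)}"

definition fraction :: "('n::finite, 'k::field) mpol set \<Rightarrow> ('n, 'k) point \<Rightarrow>
    ('n, 'k) mpol \<Rightarrow> ('n, 'k) mpol \<Rightarrow> ('n, 'k) germ" where
  "fraction I P a f =
     {(b, g) \<in> frac_pairs P. \<exists>h\<in>(\<Union>d. forms d). h \<notin> P \<and> h * (a * g - b * f) \<in> I}"

definition local_ring :: "('n::finite, 'k::field) mpol set \<Rightarrow> ('n, 'k) point \<Rightarrow> ('n, 'k) germ ring" where
  "local_ring I P =
     \<lparr>carrier = {fraction I P a f | a f. (a, f) \<in> frac_pairs P},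
      mult = (\<lambda>A B. \<Union>(a, f)\<in>A. \<Union>(b, g)\<in>B. fraction I P (a * b) (f * g)),
      one = fraction I P 1 1,
      zero = fraction I P 0 1,
      add = (\<lambda>A B. \<Union>(a, f)\<in>A. \<Union>(b, g)\<in>B. fraction I P (a * g + b * f) (f * g))\<rparr>"

definition max_ideal :: "('n::finite, 'k::field) mpol set \<Rightarrow> ('n, 'k) point \<Rightarrow> ('n, 'k) germ set" where
  "max_ideal I P = {fraction I P a f | a f. (a, f) \<in> frac_pairs P \<and> a \<in> P}"

definition residue_field ::
    "('n::finite, 'k::field) mpol set \<Rightarrow> ('n, 'k) point \<Rightarrow> ('n, 'k) germ set ring" where
  "residue_field I P = local_ring I P Quot max_ideal I P"

definition residue_class :: "('n::finite, 'k::field) mpol set \<Rightarrow> ('n, 'k) point \<Rightarrow>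
    ('n, 'k) germ \<Rightarrow> ('n, 'k) germ set" where
  "residue_class I P A = max_ideal I P +>\<^bsub>local_ring I P\<^esub> A"

text \<open>The structure sheaf: functions with values in the local rings that are locally given by a
  single fraction of forms of the same degree.\<close>

definition regular_functions ::
    "('n::finite, 'k::field) mpol set \<Rightarrow> ('n, 'k) point set \<Rightarrow> ('n, 'k) sect ring" where
  "regular_functions I U =
     \<lparr>carrier = {s \<in> extensional U. \<forall>P\<in>U. \<exists>V a f. openin (zariski I) V \<and> P \<in> V \<and> V \<subseteq> U \<and>
                  (\<forall>Q\<in>V. (a, f) \<in> frac_pairs Q \<and> s Q = fraction I Q a f)},
      mult = (\<lambda>s t. \<lambda>P\<in>U. s P \<otimes>\<^bsub>local_ring I P\<^esub> t P),
      one = (\<lambda>P\<in>U. \<one>\<^bsub>local_ring I P\<^esub>),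
      zero = (\<lambda>P\<in>U. \<zero>\<^bsub>local_ring I P\<^esub>),
      add = (\<lambda>s t. \<lambda>P\<in>U. s P \<oplus>\<^bsub>local_ring I P\<^esub> t P)\<rparr>"

definition integral_scheme :: "('n::finite, 'k::field) mpol set \<Rightarrow> bool" where
  "integral_scheme I \<longleftrightarrow> Proj I \<noteq> {} \<and>
     (\<forall>U. openin (zariski I) U \<and> U \<noteq> {} \<longrightarrow> domain (regular_functions I U))"

text \<open>The base change of \<open>Proj ('k[x] / I)\<close> to the algebraic closure is cut out by the extension
  of the ideal \<open>I\<close>.\<close>

definition base_change_ideal ::
    "('n::finite, 'k::field) mpol set \<Rightarrow> ('n, 'k alg_closure) mpol set" where
  "base_change_ideal I = Idl\<^bsub>ring_of_type_algebra\<^esub> (Poly_Mapping.map to_ac ` I)"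

definition projective_variety :: "('n::finite, 'k::field) mpol set \<Rightarrow> bool" where
  "projective_variety I \<longleftrightarrow> homogeneous_ideal I \<and> integral_scheme (base_change_ideal I)"

section \<open>Affine open subsets\<close>

definition Spec_top :: "('a, 'b) ring_scheme \<Rightarrow> 'a set topology" where
  "Spec_top A = topology_generated_by {{q. primeideal q A \<and> f \<notin> q} | f. f \<in> carrier A}"

text \<open>An open subscheme \<open>U\<close> is affine iff its canonical morphism to the spectrum of
  \<open>A = \<O>(U)\<close> is an isomorphism of locally ringed spaces: it is a homeomorphism, and for each
  \<open>P \<in> U\<close> the map of \<open>A\<close> to the local ring at \<open>P\<close> is the localisation at the prime ideal of
  those functions that vanish at \<open>P\<close>.\<close>

definition affine_open :: "('n::finite, 'k::field) mpol set \<Rightarrow> ('n, 'k) point set \<Rightarrow> bool" where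
  "affine_open I U \<longleftrightarrow> openin (zariski I) U \<and>
     (let A = regular_functions I U in
        homeomorphic_map (subtopology (zariski I) U) (Spec_top A)
          (\<lambda>P. {f \<in> carrier A. f P \<in> max_ideal I P}) \<and>
        (\<forall>P\<in>U.
           (\<forall>c\<in>carrier (local_ring I P). \<exists>f\<in>carrier A. \<exists>g\<in>carrier A.
              g P \<notin> max_ideal I P \<and> c \<otimes>\<^bsub>local_ring I P\<^esub> g P = f P) \<and>
           (\<forall>f\<in>carrier A. f P = \<zero>\<^bsub>local_ring I P\<^esub> \<longrightarrow>
              (\<exists>g\<in>carrier A. g P \<notin> max_ideal I P \<and> g \<otimes>\<^bsub>A\<^esub> f = \<zero>\<^bsub>A\<^esub>))))"

section \<open>Line bundles\<close>

text \<open>A line bundle \<open>L\<close> is given by an open cover \<open>(U i)\<close> with local frames \<open>(e i)\<close> and transition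
  functions \<open>trans L i j\<close>, normalised so that \<open>e j = trans L i j * e i\<close> on \<open>U i \<inter> U j\<close>.
  The transition functions of the \<open>k\<close>-th tensor power \<open>kL\<close> are then the \<open>k\<close>-th powers, and a global
  section of \<open>kL\<close> is the family \<open>(s i)\<close> of its coordinates with respect to the frames \<open>(e i)\<^sup>k\<close>.\<close>

record ('i, 'p, 's) cocycle =
  index :: "'i set"
  chart :: "'i \<Rightarrow> 'p set"
  trans :: "'i \<Rightarrow> 'i \<Rightarrow> 's"

type_synonym ('i, 'n, 'k) line_bundle = "('i, ('n, 'k) point, ('n, 'k) sect) cocycle"

definition line_bundle :: "('n::finite, 'k::field) mpol set \<Rightarrow> ('i, 'n, 'k) line_bundle \<Rightarrow> bool" where
  "line_bundle I L \<longleftrightarrow>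
     (\<forall>i\<in>index L. openin (zariski I) (chart L i)) \<and>
     (\<Union>i\<in>index L. chart L i) = Proj I \<and>
     (\<forall>i\<in>index L. \<forall>j\<in>index L.
        trans L i j \<in> Units (regular_functions I (chart L i \<inter> chart L j))) \<and>
     (\<forall>i\<in>index L. trans L i i = \<one>\<^bsub>regular_functions I (chart L i)\<^esub>) \<and>
     (\<forall>i\<in>index L. \<forall>j\<in>index L. \<forall>l\<in>index L. \<forall>P\<in>chart L i \<inter> chart L j \<inter> chart L l.
        trans L i j P \<otimes>\<^bsub>local_ring I P\<^esub> trans L j l P = trans L i l P)"

definition H0 :: "('n::finite, 'k::field) mpol set \<Rightarrow> ('i, 'n, 'k) line_bundle \<Rightarrow> nat \<Rightarrow>
    ('i \<Rightarrow> ('n, 'k) sect) set" where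
  "H0 I L k = {s \<in> (\<Pi>\<^sub>E i\<in>index L. carrier (regular_functions I (chart L i))).
     \<forall>i\<in>index L. \<forall>j\<in>index L. \<forall>P\<in>chart L i \<inter> chart L j.
       s i P = (trans L i j P [^]\<^bsub>local_ring I P\<^esub> k) \<otimes>\<^bsub>local_ring I P\<^esub> s j P}"

definition nonvanishing_locus :: "('n::finite, 'k::field) mpol set \<Rightarrow> ('i, 'n, 'k) line_bundle \<Rightarrow>
    ('i \<Rightarrow> ('n, 'k) sect) \<Rightarrow> ('n, 'k) point set" where
  "nonvanishing_locus I L s = {P. \<exists>i\<in>index L. P \<in> chart L i \<and> s i P \<notin> max_ideal I P}"

text \<open>Ampleness as in the Stacks project, or condition (a') of EGA II, 4.5.2; quasi-compactness is automatic
  for a projective scheme.\<close>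

definition ample :: "('n::finite, 'k::field) mpol set \<Rightarrow> ('i, 'n, 'k) line_bundle \<Rightarrow> bool" where
  "ample I L \<longleftrightarrow>
     (\<forall>P\<in>Proj I. \<exists>k\<ge>1. \<exists>s\<in>H0 I L k.
        P \<in> nonvanishing_locus I L s \<and> affine_open I (nonvanishing_locus I L s))"

definition basepoint_free :: "('n::finite, 'k::field) mpol set \<Rightarrow> ('i, 'n, 'k) line_bundle \<Rightarrow> nat \<Rightarrow>
    (nat \<Rightarrow> 'i \<Rightarrow> ('n, 'k) sect) \<Rightarrow> bool" where
  "basepoint_free I L m s \<longleftrightarrow> Proj I \<subseteq> (\<Union>j<m. nonvanishing_locus I L (s j))"

section \<open>Berkovich analytification\<close>

text \<open>A point of the analytification is a scheme point \<open>P\<close> together with an absolute value on the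
  residue field at \<open>P\<close> that extends the one of the ground field.\<close>

type_synonym ('n, 'k) an_point = "('n, 'k) point \<times> (('n, 'k) germ set \<Rightarrow> real)"

definition analytification ::
    "('k::field \<Rightarrow> real) \<Rightarrow> ('n::finite, 'k) mpol set \<Rightarrow> ('n, 'k) an_point set" where
  "analytification v I = {(P, w). P \<in> Proj I \<and>
     w \<in> extensional (carrier (residue_field I P)) \<and>
     na_absolute_value (residue_field I P) w \<and>
     (\<forall>c. w (residue_class I P (fraction I P (Poly_Mapping.single 0 c) 1)) = v c)}"

definition abs_at :: "('n::finite, 'k::field) mpol set \<Rightarrow> ('n, 'k) sect \<Rightarrow> ('n, 'k) an_point \<Rightarrow> real" where
  "abs_at I f x = snd x (residue_class I (fst x) (f (fst x)))"

definition an_top ::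
    "('k::field \<Rightarrow> real) \<Rightarrow> ('n::finite, 'k) mpol set \<Rightarrow> ('n, 'k) an_point topology" where
  "an_top v I = topology_generated_by
     ({{x \<in> analytification v I. fst x \<in> U} | U. openin (zariski I) U} \<union>
      {{x \<in> analytification v I. fst x \<in> U \<and> abs_at I f x \<in> W} | U f W.
         openin (zariski I) U \<and> f \<in> carrier (regular_functions I U) \<and> open W})"

section \<open>Metrics\<close>

text \<open>The reference metric is given by the norms \<open>h i\<close> of the local frames \<open>e i\<close>;
  in additive notation, the metric is \<open>- ln (h i)\<close> on the chart \<open>i\<close>.\<close>

definition continuous_reference_metric :: "('k::field \<Rightarrow> real) \<Rightarrow> ('n::finite, 'k) mpol set \<Rightarrow>
    ('i, 'n, 'k) line_bundle \<Rightarrow> ('i \<Rightarrow> ('n, 'k) an_point \<Rightarrow> real) \<Rightarrow> bool" where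
  "continuous_reference_metric v I L h \<longleftrightarrow>
     (\<forall>i\<in>index L. continuous_map
        (subtopology (an_top v I) {x \<in> analytification v I. fst x \<in> chart L i})
        (top_of_set {0<..}) (h i)) \<and>
     (\<forall>i\<in>index L. \<forall>j\<in>index L. \<forall>x\<in>analytification v I.
        fst x \<in> chart L i \<inter> chart L j \<longrightarrow> h j x = abs_at I (trans L i j) x * h i x)"

text \<open>The value \<open>|s|(x)\<close> for a section \<open>s\<close> of \<open>kL\<close>; it does not depend on the chosen chart.\<close>

definition section_norm :: "('n::finite, 'k::field) mpol set \<Rightarrow> ('i, 'n, 'k) line_bundle \<Rightarrow>
    ('i \<Rightarrow> ('n, 'k) an_point \<Rightarrow> real) \<Rightarrow> nat \<Rightarrow> ('i \<Rightarrow> ('n, 'k) sect) \<Rightarrow> ('n, 'k) an_point \<Rightarrow> real" where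
  "section_norm I L h k s x =
     (let i = (SOME i. i \<in> index L \<and> fst x \<in> chart L i) in abs_at I (s i) x * h i x ^ k)"

definition log_ereal :: "real \<Rightarrow> ereal" where
  "log_ereal r = (if r = 0 then -\<infinity> else ereal (ln r))"

text \<open>From now on a metric \<open>\<phi>\<close> is identified with the function \<open>\<phi> - \<phi>\<^sub>r\<^sub>e\<^sub>f\<close> on the analytification,
  extended by \<open>undefined\<close> outside of it so that equality of metrics is equality of functions.\<close>

definition continuous_metric :: "('k::field \<Rightarrow> real) \<Rightarrow> ('n::finite, 'k) mpol set \<Rightarrow>
    (('n, 'k) an_point \<Rightarrow> ereal) \<Rightarrow> bool" where
  "continuous_metric v I \<phi> \<longleftrightarrow> \<phi> \<in> extensional (analytification v I) \<and>
     (\<forall>x\<in>analytification v I. \<bar>\<phi> x\<bar> \<noteq> \<infinity>) \<and> continuous_map (an_top v I) euclidean \<phi>"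

definition FS :: "('k::field \<Rightarrow> real) \<Rightarrow> ('n::finite, 'k) mpol set \<Rightarrow> ('i, 'n, 'k) line_bundle \<Rightarrow>
    ('i \<Rightarrow> ('n, 'k) an_point \<Rightarrow> real) \<Rightarrow> nat \<Rightarrow> nat \<Rightarrow> (nat \<Rightarrow> 'i \<Rightarrow> ('n, 'k) sect) \<Rightarrow>
    (nat \<Rightarrow> real) \<Rightarrow> ('n, 'k) an_point \<Rightarrow> ereal" where
  "FS v I L h k m s a = (\<lambda>x\<in>analytification v I.
     ereal (1 / real k) * (MAX j\<in>{..<m}. log_ereal (section_norm I L h k (s j) x) + ereal (a j)))"

definition FS_metrics :: "('k::field \<Rightarrow> real) \<Rightarrow> ('n::finite, 'k) mpol set \<Rightarrow>
    ('i, 'n, 'k) line_bundle \<Rightarrow> ('i \<Rightarrow> ('n, 'k) an_point \<Rightarrow> real) \<Rightarrow> (('n, 'k) an_point \<Rightarrow> ereal) set" where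
  "FS_metrics v I L h = {FS v I L h k m s a | k m s a.
     k \<ge> 1 \<and> (\<forall>j<m. s j \<in> H0 I L k) \<and> basepoint_free I L m s}"

definition FS_segments :: "('k::field \<Rightarrow> real) \<Rightarrow> ('n::finite, 'k) mpol set \<Rightarrow>
    ('i, 'n, 'k) line_bundle \<Rightarrow> ('i \<Rightarrow> ('n, 'k) an_point \<Rightarrow> real) \<Rightarrow>
    (real \<Rightarrow> ('n, 'k) an_point \<Rightarrow> ereal) set" where
  "FS_segments v I L h =
     {(\<lambda>t\<in>{0..1}. FS v I L h k m s (\<lambda>j. (1 - t) * a j + t * b j)) | k m s a b.
        k \<ge> 1 \<and> (\<forall>j<m. s j \<in> H0 I L k) \<and> basepoint_free I L m s}"

subsection \<open>Decreasing nets\<close>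

definition directed_preorder :: "'j set \<Rightarrow> ('j \<Rightarrow> 'j \<Rightarrow> bool) \<Rightarrow> bool" where
  "directed_preorder A prec \<longleftrightarrow> A \<noteq> {} \<and> (\<forall>i\<in>A. prec i i) \<and>
     (\<forall>i\<in>A. \<forall>j\<in>A. \<forall>l\<in>A. prec i j \<longrightarrow> prec j l \<longrightarrow> prec i l) \<and>
     (\<forall>i\<in>A. \<forall>j\<in>A. \<exists>l\<in>A. prec i l \<and> prec j l)"

text \<open>The filter along which a net converges.\<close>

definition net_filter :: "'j set \<Rightarrow> ('j \<Rightarrow> 'j \<Rightarrow> bool) \<Rightarrow> 'j filter" where
  "net_filter A prec = (INF i\<in>A. principal {j\<in>A. prec i j})"

text \<open>\<open>\<phi>\<close> is the pointwise limit on \<open>D\<close> of a decreasing net of elements of \<open>F\<close>. Taking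
  the index set inside the type of the functions themselves is no restriction: a decreasing net can
  be reindexed by the set of its members, ordered by \<open>\<ge>\<close>, without changing its pointwise limit.\<close>

definition decreasing_net_limit ::
    "'p set \<Rightarrow> ('p \<Rightarrow> ereal) set \<Rightarrow> ('p \<Rightarrow> ereal) \<Rightarrow> bool" where
  "decreasing_net_limit D F \<phi> \<longleftrightarrow>
     (\<exists>(A :: ('p \<Rightarrow> ereal) set) prec \<psi>. directed_preorder A prec \<and> (\<forall>i\<in>A. \<psi> i \<in> F) \<and>
        (\<forall>i\<in>A. \<forall>j\<in>A. prec i j \<longrightarrow> (\<forall>p\<in>D. \<psi> j p \<le> \<psi> i p)) \<and>
        (\<forall>p\<in>D. ((\<lambda>i. \<psi> i p) \<longlongrightarrow> \<phi> p) (net_filter A prec)))"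

subsection \<open>Psh metrics, envelopes and psh segments\<close>

definition PSH :: "('k::field \<Rightarrow> real) \<Rightarrow> ('n::finite, 'k) mpol set \<Rightarrow> ('i, 'n, 'k) line_bundle \<Rightarrow>
    ('i \<Rightarrow> ('n, 'k) an_point \<Rightarrow> real) \<Rightarrow> (('n, 'k) an_point \<Rightarrow> ereal) set" where
  "PSH v I L h = {\<phi> \<in> extensional (analytification v I).
     decreasing_net_limit (analytification v I) (FS_metrics v I L h) \<phi> \<and>
     (\<exists>x\<in>analytification v I. \<phi> x \<noteq> -\<infinity>)}"

definition metric_le :: "('k::field \<Rightarrow> real) \<Rightarrow> ('n::finite, 'k) mpol set \<Rightarrow>
    (('n, 'k) an_point \<Rightarrow> ereal) \<Rightarrow> (('n, 'k) an_point \<Rightarrow> ereal) \<Rightarrow> bool" where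
  "metric_le v I \<psi> \<phi> \<longleftrightarrow> (\<forall>x\<in>analytification v I. \<psi> x \<le> \<phi> x)"

definition envelope :: "('k::field \<Rightarrow> real) \<Rightarrow> ('n::finite, 'k) mpol set \<Rightarrow> ('i, 'n, 'k) line_bundle \<Rightarrow>
    ('i \<Rightarrow> ('n, 'k) an_point \<Rightarrow> real) \<Rightarrow> (('n, 'k) an_point \<Rightarrow> ereal) \<Rightarrow> ('n, 'k) an_point \<Rightarrow> ereal" where
  "envelope v I L h \<phi> =
     (\<lambda>x\<in>analytification v I. SUP \<psi>\<in>{\<psi> \<in> PSH v I L h. metric_le v I \<psi> \<phi>}. \<psi> x)"

definition continuity_of_envelopes :: "('k::field \<Rightarrow> real) \<Rightarrow> ('n::finite, 'k) mpol set \<Rightarrow>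
    ('i, 'n, 'k) line_bundle \<Rightarrow> ('i \<Rightarrow> ('n, 'k) an_point \<Rightarrow> real) \<Rightarrow> bool" where
  "continuity_of_envelopes v I L h \<longleftrightarrow>
     (\<forall>\<phi>. continuous_metric v I \<phi> \<longrightarrow> continuous_metric v I (envelope v I L h \<phi>))"

definition psh_segment :: "('k::field \<Rightarrow> real) \<Rightarrow> ('n::finite, 'k) mpol set \<Rightarrow>
    ('i, 'n, 'k) line_bundle \<Rightarrow> ('i \<Rightarrow> ('n, 'k) an_point \<Rightarrow> real) \<Rightarrow>
    (real \<Rightarrow> ('n, 'k) an_point \<Rightarrow> ereal) \<Rightarrow> bool" where
  "psh_segment v I L h \<phi> \<longleftrightarrow> \<phi> \<in> {0..1} \<rightarrow>\<^sub>E PSH v I L h \<and>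
     decreasing_net_limit ({0..1} \<times> analytification v I)
       ((\<lambda>\<psi> (t, x). \<psi> t x) ` FS_segments v I L h) (\<lambda>(t, x). \<phi> t x)"

definition psh_segment_between :: "('k::field \<Rightarrow> real) \<Rightarrow> ('n::finite, 'k) mpol set \<Rightarrow>
    ('i, 'n, 'k) line_bundle \<Rightarrow> ('i \<Rightarrow> ('n, 'k) an_point \<Rightarrow> real) \<Rightarrow>
    (('n, 'k) an_point \<Rightarrow> ereal) \<Rightarrow> (('n, 'k) an_point \<Rightarrow> ereal) \<Rightarrow>
    (real \<Rightarrow> ('n, 'k) an_point \<Rightarrow> ereal) \<Rightarrow> bool" where
  "psh_segment_between v I L h \<phi>0 \<phi>1 \<phi> \<longleftrightarrow> psh_segment v I L h \<phi> \<and> \<phi> 0 = \<phi>0 \<and> \<phi> 1 = \<phi>1"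

definition maximal_psh_segment_between :: "('k::field \<Rightarrow> real) \<Rightarrow> ('n::finite, 'k) mpol set \<Rightarrow>
    ('i, 'n, 'k) line_bundle \<Rightarrow> ('i \<Rightarrow> ('n, 'k) an_point \<Rightarrow> real) \<Rightarrow>
    (('n, 'k) an_point \<Rightarrow> ereal) \<Rightarrow> (('n, 'k) an_point \<Rightarrow> ereal) \<Rightarrow>
    (real \<Rightarrow> ('n, 'k) an_point \<Rightarrow> ereal) \<Rightarrow> bool" where
  "maximal_psh_segment_between v I L h \<phi>0 \<phi>1 \<phi> \<longleftrightarrow> psh_segment_between v I L h \<phi>0 \<phi>1 \<phi> \<and>
     (\<forall>\<psi>. psh_segment v I L h \<psi> \<and> metric_le v I (\<psi> 0) \<phi>0 \<and> metric_le v I (\<psi> 1) \<phi>1 \<longrightarrow>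
        (\<forall>t\<in>{0..1}. metric_le v I (\<psi> t) (\<phi> t)))"

end

(*
  Writing a Fubini-Study segment with endpoints below f0 and f1 as the maximum of its affine pieces
  t |-> u + t m, the endpoint conditions say u <= min f0 (f1 - m), hence u <= P(min f0 (f1 - m)),
  where P is the envelope. For continuous f0 and f1, slopes larger than sup |f0 - f1| may be clipped,
  and continuity of P together with Dini's theorem on the compact analytification makes
  P(min f0 (f1 - m)) a uniform limit of Fubini-Study metrics from below. So up to any e > 0, finitely
  many slopes give one admissible Fubini-Study segment that dominates all others. Letting f0 and f1
  decrease to phi0 and phi1, the Fubini-Study segments that strictly dominate all admissible ones for
  some (f0, f1) are directed downwards; their infimum is the maximal psh segment. It joins phi0 to
  phi1 as soon as some psh segment does.

  Compactness of the analytification: its points with |x_j| <= |x_i| for all j are the multiplicative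
  seminorms on forms with |x_i| = 1, a closed subset of a product of compact intervals.
*)
theory Submission
  imports Defs
begin

section \<open>Decreasing nets on compact spaces\<close>

text \<open>A psh segment must be a decreasing limit of Fubini-Study segments, so a pointwise
  supremum of competitors is not visibly one; the maximal segment is therefore built from above. The
  sandwich needs room: the supremum of the admissible Fubini-Study segments for a pair (f0, f1) is
  in general not Fubini-Study, but a positive gap \<epsilon> lets an admissible near-maximal
  segment, shifted up, fit under two given dominating ones. This is why domination is strict.
  Finitely many slopes suffice because beyond sup |f0 - f1| one of the two endpoint conditions
  implies the other, and an excess of slope can be traded for a larger constant. A second obstacle:
  a single affine piece need not be a Fubini-Study metric, since one section may vanish somewhere
  and the piece is -\<infinity> there. Pieces are compared with envelopes only after taking the
  maximum with a very negative Fubini-Study metric. For a competing psh segment, Dini's theorem is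
  applied to the slices t = 0 and t = 1; the times in between follow from monotonicity of the
  net.\<close>

lemma eventually_net_filter:
  assumes "directed_preorder A prec"
  shows "eventually P (net_filter A prec) \<longleftrightarrow> (\<exists>i\<in>A. \<forall>j\<in>A. prec i j \<longrightarrow> P j)"
proof -
  have "\<exists>x\<in>A. principal {j \<in> A. prec x j} \<le> inf (principal {j \<in> A. prec a j}) (principal {j \<in> A. prec b j})"
    if ab: "a \<in> A" "b \<in> A" for a b
  proof -
    obtain l where l: "l \<in> A" "prec a l" "prec b l"
      using assms ab unfolding directed_preorder_def by blast
    have "\<forall>j\<in>A. prec l j \<longrightarrow> prec a j \<and> prec b j"
      using assms ab l unfolding directed_preorder_def by blast
    then show ?thesis using l by (intro bexI[of _ l]) auto
  qed
  moreover have "A \<noteq> {}" using assms unfolding directed_preorder_def by blast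
  ultimately show ?thesis
    unfolding net_filter_def by (subst eventually_INF_base) (auto simp: eventually_principal)
qed

lemma decreasing_net_lower_bound:
  fixes \<psi> :: "'j \<Rightarrow> 'p \<Rightarrow> ereal"
  assumes "directed_preorder A prec" "\<And>i j. i \<in> A \<Longrightarrow> j \<in> A \<Longrightarrow> prec i j \<Longrightarrow> \<psi> j p \<le> \<psi> i p"
    and "((\<lambda>i. \<psi> i p) \<longlongrightarrow> l) (net_filter A prec)" "i \<in> A"
  shows "l \<le> \<psi> i p"
proof (rule tendsto_upperbound[OF assms(3)])
  show "\<forall>\<^sub>F j in net_filter A prec. \<psi> j p \<le> \<psi> i p"
    unfolding eventually_net_filter[OF assms(1)] using assms(2,4) by blast
  show "net_filter A prec \<noteq> bot"
    unfolding trivial_limit_def eventually_net_filter[OF assms(1)]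
    using assms(1) unfolding directed_preorder_def by blast
qed

lemma decreasing_net_less:
  fixes \<psi> :: "'j \<Rightarrow> 'p \<Rightarrow> ereal"
  assumes "directed_preorder A prec"
    and "((\<lambda>i. \<psi> i p) \<longlongrightarrow> l) (net_filter A prec)" "l < c"
  shows "\<exists>i\<in>A. \<psi> i p < c"
proof -
  have "\<forall>\<^sub>F i in net_filter A prec. \<psi> i p < c"
    using order_tendstoD(2)[OF assms(2,3)] .
  then show ?thesis
    unfolding eventually_net_filter[OF assms(1)]
    using assms(1) unfolding directed_preorder_def by blast
qed

text \<open>\<open>G\<close> indexes itself: with pointwise \<ge> on \<open>D\<close> as preorder,
  the identity is a decreasing net that converges to the infimum. Every decreasing limit produced
  below is obtained in this way.\<close>

lemma decreasing_net_limit_INF: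
  assumes "G \<subseteq> F" "G \<noteq> {}"
    and dir: "\<And>g1 g2. g1 \<in> G \<Longrightarrow> g2 \<in> G \<Longrightarrow> \<exists>g\<in>G. \<forall>p\<in>D. g p \<le> g1 p \<and> g p \<le> g2 p"
    and \<phi>: "\<And>p. p \<in> D \<Longrightarrow> \<phi> p = (INF g\<in>G. g p)"
  shows "decreasing_net_limit D F \<phi>"
proof -
  define prec where "prec = (\<lambda>g g'. \<forall>p\<in>D. g' p \<le> (g p :: ereal))"
  have dp: "directed_preorder G prec"
    unfolding directed_preorder_def
  proof (intro conjI ballI impI)
    show "prec i l" if "prec i j" "prec j l" for i j l
      using that order_trans unfolding prec_def by blast
    show "\<exists>l\<in>G. prec g1 l \<and> prec g2 l" if "g1 \<in> G" "g2 \<in> G" for g1 g2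
      using dir[OF that] unfolding prec_def by blast
    show "prec i i" for i unfolding prec_def by simp
  qed (rule assms(2))
  have "((\<lambda>g. g p) \<longlongrightarrow> \<phi> p) (net_filter G prec)" if p: "p \<in> D" for p
  proof (rule order_tendstoI)
    fix a assume "a < \<phi> p"
    then have "\<forall>g\<in>G. a < g p" unfolding \<phi>[OF p] by (intro ballI) (erule less_le_trans, rule INF_lower)
    then show "\<forall>\<^sub>F g in net_filter G prec. a < g p"
      unfolding eventually_net_filter[OF dp] using assms(2) by blast
  next
    fix a assume "\<phi> p < a"
    then obtain g where "g \<in> G" "g p < a" unfolding \<phi>[OF p] INF_less_iff by (elim bexE) (rule that)
    then show "\<forall>\<^sub>F g in net_filter G prec. g p < a"
      unfolding eventually_net_filter[OF dp] using p
      by (intro bexI[of _ g] ballI impI) (auto simp: prec_def elim: le_less_trans[rotated])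
  qed
  then show ?thesis
    unfolding decreasing_net_limit_def
    using dp assms(1)
    by (intro exI[of _ G] exI[of _ prec] exI[of _ "\<lambda>g. g"]) (auto simp: prec_def)
qed

text \<open>Directedness collapses a finite subcover to a single member. Both uniform estimates
  below, \<open>dini\<close> and \<open>env_approx\<close>, come from this.\<close>

lemma directed_open_cover:
  assumes "compact_space T" "A \<noteq> {}" "\<And>i. i \<in> A \<Longrightarrow> openin T (U i)"
    and dir: "\<And>i j. i \<in> A \<Longrightarrow> j \<in> A \<Longrightarrow> \<exists>k\<in>A. U i \<union> U j \<subseteq> U k"
    and cov: "\<And>x. x \<in> topspace T \<Longrightarrow> \<exists>i\<in>A. x \<in> U i"
  shows "\<exists>i\<in>A. topspace T \<subseteq> U i"
proof -
  have "\<exists>\<F>. finite \<F> \<and> \<F> \<subseteq> U ` A \<and> topspace T \<subseteq> \<Union>\<F>"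
  proof (rule assms(1)[unfolded compact_space_alt, rule_format], intro conjI ballI)
    show "openin T V" if "V \<in> U ` A" for V using that assms(3) by blast
    show "topspace T \<subseteq> \<Union> (U ` A)" using cov by blast
  qed
  then obtain J where J: "finite J" "J \<subseteq> A" "topspace T \<subseteq> (\<Union>i\<in>J. U i)"
    by (metis finite_subset_image)
  have "\<exists>k\<in>A. (\<Union>i\<in>J. U i) \<subseteq> U k" using J(1,2)
  proof (induction J)
    case empty then show ?case using assms(2) by auto
  next
    case (insert j J)
    then obtain k where "k \<in> A" "(\<Union>i\<in>J. U i) \<subseteq> U k" by auto
    moreover obtain k' where "k' \<in> A" "U j \<union> U k \<subseteq> U k'" using dir insert(4) \<open>k \<in> A\<close> by blast
    ultimately show ?case by (intro bexI[of _ k']) auto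
  qed
  then show ?thesis using J(3) by blast
qed

text \<open>The target is \<open>ereal\<close>, as for continuous metrics, because envelopes are
  suprema in \<open>ereal\<close>; \<open>finite_continuousE\<close> recovers a real function where
  arithmetic is wanted.\<close>

definition finite_continuous :: "'p topology \<Rightarrow> ('p \<Rightarrow> ereal) \<Rightarrow> bool" where
  "finite_continuous T f \<longleftrightarrow> continuous_map T euclidean f \<and> (\<forall>x\<in>topspace T. \<bar>f x\<bar> \<noteq> \<infinity>)"

lemma finite_continuous_real:
  assumes "continuous_map T euclideanreal r" "\<And>x. x \<in> topspace T \<Longrightarrow> f x = ereal (r x)"
  shows "finite_continuous T f"
proof -
  have "continuous_map T euclidean (ereal \<circ> r)"
    by (rule continuous_map_compose[OF assms(1)]) (simp add: continuous_on_ereal)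
  then have "continuous_map T euclidean f"
    by (rule continuous_map_eq) (use assms(2) in auto)
  then show ?thesis unfolding finite_continuous_def using assms(2) by simp
qed

lemma finite_continuousE:
  assumes "finite_continuous T f"
  obtains r where "continuous_map T euclideanreal r" "\<And>x. x \<in> topspace T \<Longrightarrow> f x = ereal (r x)"
proof
  have 1: "continuous_map (top_of_set (- {\<infinity>, -\<infinity>})) euclideanreal real_of_ereal"
    using continuous_on_real by (simp add: Compl_eq_Diff_UNIV)
  have "continuous_map T (top_of_set (- {\<infinity>, -\<infinity>})) f"
    using assms unfolding finite_continuous_def by (auto simp: continuous_map_in_subtopology)
  from continuous_map_compose[OF this 1]
  show "continuous_map T euclideanreal (real_of_ereal \<circ> f)" .
  show "f x = ereal ((real_of_ereal \<circ> f) x)" if "x \<in> topspace T" for x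
    using assms that unfolding finite_continuous_def by (auto simp: ereal_real)
qed

lemma openin_less_ereal:
  fixes f g :: "'p \<Rightarrow> ereal"
  assumes f: "continuous_map T euclidean f" and g: "continuous_map T euclidean g"
  shows "openin T {x \<in> topspace T. f x < g x}"
proof -
  have "{x \<in> topspace T. f x < g x} =
    (\<Union>c. {x \<in> topspace T. f x \<in> {..<c}} \<inter> {x \<in> topspace T. g x \<in> {c<..}})"
    using dense by fastforce
  moreover have "openin T \<dots>"
  proof (intro openin_Union, safe)
    show "openin T ({x \<in> topspace T. f x \<in> {..<c}} \<inter> {x \<in> topspace T. g x \<in> {c<..}})" for c
      by (intro openin_Int openin_continuous_map_preimage[OF f] openin_continuous_map_preimage[OF g])
         (simp_all add: open_openin[symmetric])
  qed
  ultimately show ?thesis by simp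
qed

text \<open>In the applications \<open>\<phi>\<close> is merely upper semicontinuous and may be
  -\<infinity>, so uniform convergence is out of reach. What survives is one-sided: the open sets
  where \<psi> i < g grow along the net and cover the space, so one of them is everything.\<close>

lemma dini:
  fixes \<psi> :: "'j \<Rightarrow> 'p \<Rightarrow> ereal"
  assumes T: "compact_space T" and A: "directed_preorder A prec"
    and dec: "\<And>i j x. i \<in> A \<Longrightarrow> j \<in> A \<Longrightarrow> prec i j \<Longrightarrow> x \<in> topspace T \<Longrightarrow> \<psi> j x \<le> \<psi> i x"
    and lim: "\<And>x. x \<in> topspace T \<Longrightarrow> ((\<lambda>i. \<psi> i x) \<longlongrightarrow> \<phi> x) (net_filter A prec)"
    and \<psi>: "\<And>i. i \<in> A \<Longrightarrow> finite_continuous T (\<psi> i)"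
    and g: "finite_continuous T g" and less: "\<And>x. x \<in> topspace T \<Longrightarrow> \<phi> x < g x"
  shows "\<exists>i\<in>A. \<forall>x\<in>topspace T. \<psi> i x < g x"
proof -
  have "\<exists>i\<in>A. topspace T \<subseteq> {x \<in> topspace T. \<psi> i x < g x}"
  proof (rule directed_open_cover[OF T])
    show "A \<noteq> {}" using A unfolding directed_preorder_def by blast
    show "openin T {x \<in> topspace T. \<psi> i x < g x}" if "i \<in> A" for i
      using \<psi>[OF that] g by (intro openin_less_ereal) (auto simp: finite_continuous_def)
    show "\<exists>i\<in>A. x \<in> {x \<in> topspace T. \<psi> i x < g x}" if "x \<in> topspace T" for x
      using decreasing_net_less[OF A, of \<psi> x, OF lim[OF that] less[OF that]] that by auto
    fix i j assume ij: "i \<in> A" "j \<in> A"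
    then obtain k where "k \<in> A" "prec i k" "prec j k"
      using A unfolding directed_preorder_def by blast
    then show "\<exists>k\<in>A. {x \<in> topspace T. \<psi> i x < g x} \<union> {x \<in> topspace T. \<psi> j x < g x}
                 \<subseteq> {x \<in> topspace T. \<psi> k x < g x}"
      using dec[OF ij(1), of k] dec[OF ij(2), of k] order_le_less_trans
      by (intro bexI[of _ k]) blast+
  qed
  then show ?thesis by blast
qed

lemma finite_continuous_bounded:
  assumes "compact_space T" "finite_continuous T g"
  obtains C where "C > 0" "\<And>x. x \<in> topspace T \<Longrightarrow> \<bar>g x\<bar> \<le> ereal C"
proof -
  obtain r where r: "continuous_map T euclideanreal r" "\<And>x. x \<in> topspace T \<Longrightarrow> g x = ereal (r x)"
    using finite_continuousE[OF assms(2)] by blast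
  have "compact (r ` topspace T)"
    using image_compactin[OF _ r(1)] assms(1) unfolding compact_space_def by auto
  then obtain C where "\<forall>y\<in>r ` topspace T. norm y \<le> C"
    using compact_imp_bounded bounded_iff by metis
  then have "\<bar>g x\<bar> \<le> ereal (max 1 C)" if "x \<in> topspace T" for x
    using r(2) that by (auto simp: le_max_iff_disj)
  then show thesis using that[of "max 1 C"] by simp
qed

section \<open>Maximal segments in an abstract setting\<close>

text \<open>The features of Fubini-Study metrics \<open>F\<close> and Fubini-Study segments
  \<open>S\<close> on which the argument rests. \<open>S_piece\<close> extracts the affine piece
  \<open>u\<close> + t \<mu> that attains the maximum at a given (t, x). Since \<open>u\<close> may
  take the value -\<infinity> and lie outside \<open>F\<close>, its positivity is recorded through
  maxima with members of \<open>F\<close>.\<close>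

locale segment_setting =
  fixes T :: "'p topology" and F :: "('p \<Rightarrow> ereal) set" and S :: "(real \<Rightarrow> 'p \<Rightarrow> ereal) set"
  assumes compact: "compact_space T"
    and F_ext: "f \<in> F \<Longrightarrow> f \<in> extensional (topspace T)"
    and F_cont: "f \<in> F \<Longrightarrow> finite_continuous T f"
    and F_max: "f \<in> F \<Longrightarrow> g \<in> F \<Longrightarrow> (\<lambda>x\<in>topspace T. max (f x) (g x)) \<in> F"
    and F_shift: "f \<in> F \<Longrightarrow> (\<lambda>x\<in>topspace T. f x + ereal c) \<in> F"
    and S_slice: "G \<in> S \<Longrightarrow> t \<in> {0..1} \<Longrightarrow> G t \<in> F"
    and S_affine: "f \<in> F \<Longrightarrow> (\<lambda>t\<in>{0..1}. \<lambda>x\<in>topspace T. f x + ereal (t * \<mu>)) \<in> S"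
    and S_max: "G \<in> S \<Longrightarrow> H \<in> S \<Longrightarrow> (\<lambda>t\<in>{0..1}. \<lambda>x\<in>topspace T. max (G t x) (H t x)) \<in> S"
    and S_shift: "G \<in> S \<Longrightarrow> (\<lambda>t\<in>{0..1}. \<lambda>x\<in>topspace T. G t x + ereal c) \<in> S"
    and S_piece: "G \<in> S \<Longrightarrow> t \<in> {0..1} \<Longrightarrow> x \<in> topspace T \<Longrightarrow>
      \<exists>u \<mu>. G t x = u x + ereal (t * \<mu>) \<and>
        (\<forall>s\<in>{0..1}. \<forall>y\<in>topspace T. u y + ereal (s * \<mu>) \<le> G s y) \<and>
        (\<forall>f\<in>F. \<forall>c. (\<lambda>y\<in>topspace T. max (u y + ereal c) (f y)) \<in> F)"
begin

section \<open>Psh functions, their envelopes and approximation of envelopes from below\<close>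

definition psh where
  "psh = {\<phi> \<in> extensional (topspace T). decreasing_net_limit (topspace T) F \<phi> \<and>
            (\<exists>x\<in>topspace T. \<phi> x \<noteq> -\<infinity>)}"

definition env where
  "env \<phi> = (\<lambda>x\<in>topspace T. SUP \<psi>\<in>{\<psi> \<in> psh. \<forall>x\<in>topspace T. \<psi> x \<le> \<phi> x}. \<psi> x)"

definition pseg where
  "pseg \<phi> \<longleftrightarrow> \<phi> \<in> {0..1} \<rightarrow>\<^sub>E psh \<and>
     decreasing_net_limit ({0..1} \<times> topspace T) ((\<lambda>\<psi> (t, x). \<psi> t x) ` S) (\<lambda>(t, x). \<phi> t x)"

definition adm where
  "adm f0 f1 G \<longleftrightarrow> (\<forall>x\<in>topspace T. G 0 x \<le> f0 x \<and> G 1 x \<le> (f1 x :: ereal))"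

lemma F_subset_psh:
  assumes "f \<in> F" "topspace T \<noteq> {}"
  shows "f \<in> psh"
proof -
  have "decreasing_net_limit (topspace T) F f"
    by (rule decreasing_net_limit_INF[of "{f}"]) (use assms in auto)
  moreover obtain x where x: "x \<in> topspace T" using assms(2) by blast
  then have "f x \<noteq> -\<infinity>" using F_cont[OF assms(1)] unfolding finite_continuous_def by auto
  ultimately show ?thesis
    using F_ext[OF assms(1)] x unfolding psh_def by blast
qed

lemma F_le_env:
  assumes "f \<in> F" "\<And>x. x \<in> topspace T \<Longrightarrow> f x \<le> m x" "x \<in> topspace T"
  shows "f x \<le> env m x"
proof -
  have "f \<in> psh" using F_subset_psh assms by blast
  then show ?thesis unfolding env_def using assms by (auto intro!: SUP_upper)
qed

lemma F_real:
  assumes "f \<in> F" "x \<in> topspace T"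
  obtains r where "f x = ereal r"
  using F_cont[OF assms(1)] assms(2) unfolding finite_continuous_def
  by (cases "f x") auto

text \<open>\<open>u\<close> itself may fail to be psh, for instance when it comes from a section
  with zeros. The maximum of \<open>u\<close> with a member of \<open>F\<close> lying below
  \<open>m\<close> is in \<open>F\<close>, still below \<open>m\<close>, and therefore competes in
  the envelope.\<close>

lemma piece_le_env:
  assumes u: "\<And>f. f \<in> F \<Longrightarrow> (\<lambda>y\<in>topspace T. max (u y) (f y)) \<in> F"
    and m: "finite_continuous T m" and um: "\<And>x. x \<in> topspace T \<Longrightarrow> u x \<le> m x"
    and x: "x \<in> topspace T" and f: "f \<in> F"
  shows "u x \<le> env m x"
proof -
  obtain C where C: "\<And>x. x \<in> topspace T \<Longrightarrow> \<bar>m x\<bar> \<le> ereal C"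
    using finite_continuous_bounded[OF compact m] by metis
  obtain C' where C': "\<And>x. x \<in> topspace T \<Longrightarrow> \<bar>f x\<bar> \<le> ereal C'"
    using finite_continuous_bounded[OF compact F_cont[OF f]] by metis
  \<comment> \<open>From f \<le> C' the shifted function is at most -C, which is a lower bound of
    m.\<close>
  define f' where "f' = (\<lambda>x\<in>topspace T. f x + ereal (- C - C'))"
  have f': "f' \<in> F" unfolding f'_def by (rule F_shift[OF f])
  have f'm: "f' y \<le> m y" if "y \<in> topspace T" for y
    using C[OF that] C'[OF that] that unfolding f'_def
    by (cases "f y"; cases "m y") auto
  have "u x \<le> (\<lambda>y\<in>topspace T. max (u y) (f' y)) x" using x by simp
  also have "\<dots> \<le> env m x"
    by (rule F_le_env[OF u[OF f'] _ x]) (use um f'm in auto)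
  finally show ?thesis .
qed

text \<open>Dini's theorem for the net that defines \<open>\<psi>\<close>: one member already lies
  below \<open>g\<close>, and every member lies above the limit.\<close>

lemma psh_dini:
  assumes "\<psi> \<in> psh" "finite_continuous T g" "\<And>x. x \<in> topspace T \<Longrightarrow> \<psi> x < g x"
  shows "\<exists>f\<in>F. \<forall>x\<in>topspace T. \<psi> x \<le> f x \<and> f x < g x"
proof -
  have "decreasing_net_limit (topspace T) F \<psi>" using assms(1) unfolding psh_def by blast
  then obtain A :: "('p \<Rightarrow> ereal) set" and prec \<eta>
    where n: "directed_preorder A prec" "\<forall>i\<in>A. \<eta> i \<in> F"
        "\<forall>i\<in>A. \<forall>j\<in>A. prec i j \<longrightarrow> (\<forall>p\<in>topspace T. \<eta> j p \<le> \<eta> i p)"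
        "\<forall>p\<in>topspace T. ((\<lambda>i. \<eta> i p) \<longlongrightarrow> \<psi> p) (net_filter A prec)"
    unfolding decreasing_net_limit_def by (elim exE conjE) (rule that)
  have "\<exists>i\<in>A. \<forall>x\<in>topspace T. \<eta> i x < g x"
    by (rule dini[OF compact n(1)]) (use n assms F_cont in auto)
  then obtain i where i: "i \<in> A" "\<forall>x\<in>topspace T. \<eta> i x < g x" by blast
  have "\<psi> x \<le> \<eta> i x" if "x \<in> topspace T" for x
    by (rule decreasing_net_lower_bound[OF n(1)]) (use n i that in auto)
  then show ?thesis using i n(2) by blast
qed

lemma finite_continuous_shift:
  assumes "finite_continuous T g"
  shows "finite_continuous T (\<lambda>x\<in>topspace T. g x + ereal c)"
proof -
  obtain r where r: "continuous_map T euclideanreal r" "\<And>x. x \<in> topspace T \<Longrightarrow> g x = ereal (r x)"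
    using finite_continuousE[OF assms] by blast
  show ?thesis
    by (rule finite_continuous_real[of _ "\<lambda>x. r x + c"]) (use r in \<open>auto intro!: continuous_intros\<close>)
qed

text \<open>The members of \<open>F\<close> below \<open>m\<close> are directed upwards by
  \<open>F_max\<close>. At each point one of them comes within \<delta> of the envelope, and
  continuity of \<open>env m\<close> makes this an open condition, so compactness yields one member
  that works everywhere.\<close>

lemma env_approx:
  assumes m: "finite_continuous T m" and em: "finite_continuous T (env m)" and \<delta>: "\<delta> > 0"
    and ne: "F \<noteq> {}"
  shows "\<exists>f\<in>F. \<forall>x\<in>topspace T. f x \<le> m x \<and> env m x < f x + ereal \<delta>"
proof -
  define H where "H = {f \<in> F. \<forall>x\<in>topspace T. f x \<le> m x}"
  have "\<exists>f\<in>H. topspace T \<subseteq> {x \<in> topspace T. env m x < (\<lambda>x\<in>topspace T. f x + ereal \<delta>) x}"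
  proof (rule directed_open_cover[OF compact])
    obtain f where f: "f \<in> F" using ne by blast
    obtain C where C: "\<And>x. x \<in> topspace T \<Longrightarrow> \<bar>m x\<bar> \<le> ereal C"
      using finite_continuous_bounded[OF compact m] by metis
    obtain C' where C': "\<And>x. x \<in> topspace T \<Longrightarrow> \<bar>f x\<bar> \<le> ereal C'"
      using finite_continuous_bounded[OF compact F_cont[OF f]] by metis
    have "(\<lambda>x\<in>topspace T. f x + ereal (- C - C')) \<in> H"
    proof -
      have "f y + ereal (- C - C') \<le> m y" if "y \<in> topspace T" for y
        using C[OF that] C'[OF that] by (cases "f y"; cases "m y") auto
      then show ?thesis unfolding H_def using F_shift[OF f] by auto
    qed
    then show "H \<noteq> {}" by blast
    show "openin T {x \<in> topspace T. env m x < (\<lambda>x\<in>topspace T. f x + ereal \<delta>) x}" if "f \<in> H" for f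
    proof (rule openin_less_ereal)
      have "f \<in> F" using that unfolding H_def by blast
      then show "continuous_map T euclidean (\<lambda>x\<in>topspace T. f x + ereal \<delta>)"
        using finite_continuous_shift[OF F_cont] unfolding finite_continuous_def by blast
    qed (use em in \<open>simp add: finite_continuous_def\<close>)
    show "\<exists>k\<in>H. {x \<in> topspace T. env m x < (\<lambda>x\<in>topspace T. i x + ereal \<delta>) x} \<union>
                  {x \<in> topspace T. env m x < (\<lambda>x\<in>topspace T. j x + ereal \<delta>) x}
                \<subseteq> {x \<in> topspace T. env m x < (\<lambda>x\<in>topspace T. k x + ereal \<delta>) x}"
      if "i \<in> H" "j \<in> H" for i j
    proof (intro bexI[of _ "\<lambda>x\<in>topspace T. max (i x) (j x)"])
      show "(\<lambda>x\<in>topspace T. max (i x) (j x)) \<in> H" using that F_max unfolding H_def by auto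
    qed (auto elim!: order_less_le_trans intro!: add_right_mono)
    fix x assume x: "x \<in> topspace T"
    obtain e where e: "env m x = ereal e"
      using em x unfolding finite_continuous_def by (cases "env m x") auto
    have "ereal (e - \<delta>/2) < env m x" using e \<delta> by simp
    then have "\<exists>\<psi>\<in>{\<psi> \<in> psh. \<forall>x\<in>topspace T. \<psi> x \<le> m x}. ereal (e - \<delta>/2) < \<psi> x"
      unfolding env_def using x by (simp add: less_SUP_iff)
    then obtain \<psi> where \<psi>: "\<psi> \<in> psh" "\<And>x. x \<in> topspace T \<Longrightarrow> \<psi> x \<le> m x" "ereal (e - \<delta>/2) < \<psi> x"
      by blast
    \<comment> \<open>A psh competitor need not lie in \<open>F\<close>. Raising the ceiling from m
      to m + \<delta>/2 creates the strict inequality that allows \<open>\<psi>\<close> to be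
      replaced by a member of \<open>F\<close>.\<close>
    have "\<exists>f\<in>F. \<forall>x\<in>topspace T. \<psi> x \<le> f x \<and> f x < (\<lambda>x\<in>topspace T. m x + ereal (\<delta>/2)) x"
    proof (rule psh_dini[OF \<psi>(1) finite_continuous_shift[OF m]])
      fix y assume y: "y \<in> topspace T"
      then obtain r where "m y = ereal r"
        using m unfolding finite_continuous_def by (cases "m y") auto
      then have "m y < m y + ereal (\<delta>/2)" using \<delta> by simp
      then show "\<psi> y < (\<lambda>x\<in>topspace T. m x + ereal (\<delta>/2)) y" using \<psi>(2)[OF y] y by auto
    qed
    then obtain f where f: "f \<in> F" "\<And>x. x \<in> topspace T \<Longrightarrow> \<psi> x \<le> f x"
       "\<And>x. x \<in> topspace T \<Longrightarrow> f x < m x + ereal (\<delta>/2)"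
      by auto
    \<comment> \<open>Shifting back below m costs \<delta>/2; the other \<delta>/2 was lost in
      choosing \<open>\<psi>\<close>.\<close>
    define f' where "f' = (\<lambda>x\<in>topspace T. f x + ereal (- \<delta>/2))"
    have "f' y \<le> m y" if y: "y \<in> topspace T" for y
    proof -
      obtain r where "f y = ereal r" using F_real[OF f(1) y] by blast
      moreover obtain q where "m y = ereal q"
        using m y unfolding finite_continuous_def by (cases "m y") auto
      ultimately show ?thesis using f(3)[OF y] y unfolding f'_def by auto
    qed
    then have "f' \<in> H" unfolding H_def f'_def using F_shift[OF f(1)] by blast
    moreover have "env m x < f' x + ereal \<delta>"
    proof -
      obtain r where r: "f x = ereal r" using F_real[OF f(1) x] by blast
      then have "e - \<delta>/2 < r" using f(2)[OF x] \<psi>(3) by (metis less_ereal.simps(1) order_less_le_trans)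
      then show ?thesis unfolding f'_def e using x r by simp
    qed
    ultimately show "\<exists>f\<in>H. x \<in> {x \<in> topspace T. env m x < (\<lambda>x\<in>topspace T. f x + ereal \<delta>) x}"
      using x by auto
  qed
  then obtain f where "f \<in> H" "topspace T \<subseteq> {x \<in> topspace T. env m x < (\<lambda>x\<in>topspace T. f x + ereal \<delta>) x}"
    by blast
  then show ?thesis unfolding H_def by (intro bexI[of _ f]) auto
qed

text \<open>Besides dominating the \<open>G i\<close>, the maximum is attained by one of them at
  each (t, x). Attainment is what transfers the endpoint bounds from the pieces to \<open>H\<close>,
  making \<open>H\<close> admissible.\<close>

lemma finite_max_S:
  fixes n :: nat
  assumes "\<And>i. i \<le> n \<Longrightarrow> G i \<in> S"
  shows "\<exists>H\<in>S. \<forall>t\<in>{0..1}. \<forall>x\<in>topspace T. (\<forall>i\<le>n. G i t x \<le> H t x) \<and> (\<exists>i\<le>n. H t x = G i t x)"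
  using assms
proof (induction n)
  case 0
  then show ?case by (intro bexI[of _ "G 0"]) auto
next
  case (Suc n)
  then obtain H where H: "H \<in> S" "\<forall>t\<in>{0..1}. \<forall>x\<in>topspace T. (\<forall>i\<le>n. G i t x \<le> H t x) \<and> (\<exists>i\<le>n. H t x = G i t x)"
    by (metis le_SucI)
  define H' where "H' = (\<lambda>t\<in>{0..1}. \<lambda>x\<in>topspace T. max (H t x) (G (Suc n) t x))"
  have "H' \<in> S" unfolding H'_def by (rule S_max) (use H Suc in auto)
  moreover have "(\<forall>i\<le>Suc n. G i t x \<le> H' t x) \<and> (\<exists>i\<le>Suc n. H' t x = G i t x)"
    if tx: "t \<in> {0..1}" "x \<in> topspace T" for t x
  proof -
    have e: "H' t x = max (H t x) (G (Suc n) t x)" using tx unfolding H'_def by simp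
    have h: "\<forall>i\<le>n. G i t x \<le> H t x" "\<exists>i\<le>n. H t x = G i t x" using H(2) tx by blast+
    have "G i t x \<le> H' t x" if "i \<le> Suc n" for i
      using h(1) that unfolding e by (cases "i = Suc n") (auto simp: le_max_iff_disj)
    moreover have "\<exists>i\<le>Suc n. H' t x = G i t x"
      using h(2) unfolding e max_def by (metis le_Suc_eq)
    ultimately show ?thesis by blast
  qed
  ultimately show ?case by blast
qed

text \<open>The extremal pieces are envelopes with slope \<mu>; they need not lie in
  \<open>F\<close>, and there is a continuum of them. Replacing each envelope by a member of
  \<open>F\<close> within \<delta>, and the slopes by a grid of mesh \<delta>, costs 2 \<delta> =
  \<epsilon> in total.\<close>

lemma maximal_approx:
  assumes f0: "f0 \<in> F" and f1: "f1 \<in> F" and \<epsilon>: "\<epsilon> > 0"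
    and env: "\<And>m. m \<in> extensional (topspace T) \<Longrightarrow> finite_continuous T m \<Longrightarrow> finite_continuous T (env m)"
  shows "\<exists>G\<in>S. adm f0 f1 G \<and>
     (\<forall>G'\<in>S. adm f0 f1 G' \<longrightarrow> (\<forall>t\<in>{0..1}. \<forall>x\<in>topspace T. G' t x \<le> G t x + ereal \<epsilon>))"
proof -
  obtain r0 where r0: "continuous_map T euclideanreal r0" "\<And>x. x \<in> topspace T \<Longrightarrow> f0 x = ereal (r0 x)"
    using finite_continuousE[OF F_cont[OF f0]] by blast
  obtain r1 where r1: "continuous_map T euclideanreal r1" "\<And>x. x \<in> topspace T \<Longrightarrow> f1 x = ereal (r1 x)"
    using finite_continuousE[OF F_cont[OF f1]] by blast
  obtain C0 where C0: "C0 > 0" "\<And>x. x \<in> topspace T \<Longrightarrow> \<bar>f0 x\<bar> \<le> ereal C0"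
    using finite_continuous_bounded[OF compact F_cont[OF f0]] by metis
  obtain C1 where C1: "C1 > 0" "\<And>x. x \<in> topspace T \<Longrightarrow> \<bar>f1 x\<bar> \<le> ereal C1"
    using finite_continuous_bounded[OF compact F_cont[OF f1]] by metis
  define C where "C = C0 + C1"
  have C_pos: "C > 0" using C0 C1 unfolding C_def by simp
  have C: "\<bar>r0 x - r1 x\<bar> \<le> C" if x: "x \<in> topspace T" for x
  proof -
    have "\<bar>r0 x\<bar> \<le> C0" "\<bar>r1 x\<bar> \<le> C1"
      using C0(2)[OF x] C1(2)[OF x] r0(2)[OF x] r1(2)[OF x] by simp_all
    then show ?thesis unfolding C_def by linarith
  qed
  define m where "m = (\<lambda>\<mu>. \<lambda>x\<in>topspace T. ereal (min (r0 x) (r1 x - \<mu>)))"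
  have m: "finite_continuous T (m \<mu>)" for \<mu>
    by (rule finite_continuous_real[of _ "\<lambda>x. min (r0 x) (r1 x - \<mu>)"])
       (use r0 r1 in \<open>auto simp: m_def intro!: continuous_intros\<close>)
  define \<delta> where "\<delta> = \<epsilon> / 2"
  have \<delta>: "\<delta> > 0" using \<epsilon> unfolding \<delta>_def by simp
  have "\<exists>f\<in>F. \<forall>x\<in>topspace T. f x \<le> m \<mu> x \<and> env (m \<mu>) x < f x + ereal \<delta>" for \<mu>
    by (rule env_approx[OF m env[OF _ m] \<delta>]) (use f0 in \<open>auto simp: m_def\<close>)
  then obtain g where g: "\<And>\<mu>. g \<mu> \<in> F" "\<And>\<mu> x. x \<in> topspace T \<Longrightarrow> g \<mu> x \<le> m \<mu> x"
      "\<And>\<mu> x. x \<in> topspace T \<Longrightarrow> env (m \<mu>) x < g \<mu> x + ereal \<delta>"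
    by metis
  \<comment> \<open>A grid of mesh \<delta> starting at -C; it reaches C by index \<open>n\<close>,
    because n \<delta> \<ge> 2 C.\<close>
  define \<nu> where "\<nu> = (\<lambda>i. - C + real i * \<delta>)"
  define n where "n = nat \<lceil>2 * C / \<delta>\<rceil>"
  have \<nu>: "\<exists>i\<le>n. \<nu> i \<le> \<mu> \<and> \<mu> \<le> \<nu> i + \<delta>" if "\<mu> \<in> {-C..C}" for \<mu>
  proof (intro exI[of _ "nat \<lfloor>(\<mu> + C) / \<delta>\<rfloor>"] conjI)
    have nn: "0 \<le> (\<mu> + C) / \<delta>" using that \<delta> by auto
    have "(\<mu> + C) / \<delta> \<le> 2 * C / \<delta>" using that \<delta> by (intro divide_right_mono) auto
    then show "nat \<lfloor>(\<mu> + C) / \<delta>\<rfloor> \<le> n" unfolding n_def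
      by (intro nat_mono order_trans[OF floor_mono floor_le_ceiling])
    have e: "real (nat \<lfloor>(\<mu> + C) / \<delta>\<rfloor>) = of_int \<lfloor>(\<mu> + C) / \<delta>\<rfloor>" using nn by simp
    have "of_int \<lfloor>(\<mu> + C) / \<delta>\<rfloor> * \<delta> \<le> (\<mu> + C) / \<delta> * \<delta>"
      using \<delta> by (intro mult_right_mono) auto
    then show "\<nu> (nat \<lfloor>(\<mu> + C) / \<delta>\<rfloor>) \<le> \<mu>" unfolding \<nu>_def e using \<delta> by simp
    have "(\<mu> + C) / \<delta> * \<delta> \<le> (of_int \<lfloor>(\<mu> + C) / \<delta>\<rfloor> + 1) * \<delta>"
      using \<delta> by (intro mult_right_mono) linarith+
    then show "\<mu> \<le> \<nu> (nat \<lfloor>(\<mu> + C) / \<delta>\<rfloor>) + \<delta>" unfolding \<nu>_def e using \<delta> by (simp add: algebra_simps)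
  qed
  define Gs where "Gs = (\<lambda>i. \<lambda>t\<in>{0..1}. \<lambda>x\<in>topspace T. g (\<nu> i) x + ereal (t * \<nu> i))"
  have "\<exists>H\<in>S. \<forall>t\<in>{0..1}. \<forall>x\<in>topspace T. (\<forall>i\<le>n. Gs i t x \<le> H t x) \<and> (\<exists>i\<le>n. H t x = Gs i t x)"
    unfolding Gs_def by (rule finite_max_S, rule S_affine, rule g(1))
  then obtain H where H: "H \<in> S"
      "\<And>t x i. t \<in> {0..1} \<Longrightarrow> x \<in> topspace T \<Longrightarrow> i \<le> n \<Longrightarrow> Gs i t x \<le> H t x"
      "\<And>t x. t \<in> {0..1} \<Longrightarrow> x \<in> topspace T \<Longrightarrow> \<exists>i\<le>n. H t x = Gs i t x"
    by blast
  have "adm f0 f1 H"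
    unfolding adm_def
  proof (intro ballI conjI)
    fix x assume x: "x \<in> topspace T"
    have gm: "g \<mu> x \<le> ereal (min (r0 x) (r1 x - \<mu>))" for \<mu>
      using g(2)[OF x, of \<mu>] x unfolding m_def by simp
    obtain i where "H 0 x = Gs i 0 x" using H(3)[of 0, OF _ x] by auto
    then show "H 0 x \<le> f0 x" using gm[of "\<nu> i"] x r0(2)[OF x]
      by (cases "g (\<nu> i) x") (auto simp: Gs_def)
    obtain i where "H 1 x = Gs i 1 x" using H(3)[of 1, OF _ x] by auto
    then show "H 1 x \<le> f1 x" using gm[of "\<nu> i"] x r1(2)[OF x]
      by (cases "g (\<nu> i) x") (auto simp: Gs_def)
  qed
  moreover have "G t x \<le> H t x + ereal \<epsilon>" if G: "G \<in> S" "adm f0 f1 G" and t: "t \<in> {0..1}" and x: "x \<in> topspace T" for G t x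
  proof -
    obtain u \<mu> where u: "G t x = u x + ereal (t * \<mu>)"
        "\<And>s y. s \<in> {0..1} \<Longrightarrow> y \<in> topspace T \<Longrightarrow> u y + ereal (s * \<mu>) \<le> G s y"
        "\<And>f c. f \<in> F \<Longrightarrow> (\<lambda>y\<in>topspace T. max (u y + ereal c) (f y)) \<in> F"
      using S_piece[OF G(1) t x] by blast
    have ub: "u y \<le> ereal (min (r0 y) (r1 y - \<mu>))" if y: "y \<in> topspace T" for y
    proof -
      have "u y + ereal (0 * \<mu>) \<le> f0 y" "u y + ereal (1 * \<mu>) \<le> f1 y"
        using order_trans[OF u(2)[of 0, OF _ y], of "f0 y"] order_trans[OF u(2)[of 1, OF _ y], of "f1 y"]
          G(2) y unfolding adm_def by simp_all
      then show ?thesis unfolding r0(2)[OF y] r1(2)[OF y] by (cases "u y") auto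
    qed
    \<comment> \<open>Clipping of the slope. If \<mu> > C, then r1 - \<mu> \<le> r0, so the minimum
      is r1 - \<mu>; the slope drops to C and the constant rises by \<mu> - C, which gains at every
      t \<le> 1. If \<mu> < -C, the minimum is r0, and raising the slope to -C leaves it
      unchanged.\<close>
    have "\<exists>c. \<exists>\<mu>'\<in>{-C..C}. t * \<mu> \<le> c + t * \<mu>' \<and>
        (\<forall>y\<in>topspace T. min (r0 y) (r1 y - \<mu>) + c \<le> min (r0 y) (r1 y - \<mu>'))"
    proof -
      consider "\<mu> \<in> {-C..C}" | "\<mu> > C" | "\<mu> < -C" by fastforce
      then show ?thesis
      proof cases
        case 1 then show ?thesis by (intro exI[of _ 0] bexI[of _ \<mu>]) auto
      next
        case 2
        have "t * (\<mu> - C) \<le> \<mu> - C" using 2 t by (intro mult_left_le_one_le) auto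
        then have "t * \<mu> \<le> (\<mu> - C) + t * C" by (simp add: algebra_simps)
        moreover have "min (r0 y) (r1 y - \<mu>) + (\<mu> - C) \<le> min (r0 y) (r1 y - C)"
          if "y \<in> topspace T" for y
          using C[OF that] 2 by linarith
        ultimately show ?thesis using C_pos by (intro exI[of _ "\<mu> - C"] bexI[of _ C]) auto
      next
        case 3
        have "t * \<mu> \<le> t * (-C)" using 3 t by (intro mult_left_mono) auto
        moreover have "min (r0 y) (r1 y - \<mu>) + 0 \<le> min (r0 y) (r1 y - (-C))"
          if "y \<in> topspace T" for y
          using C[OF that] 3 by linarith
        ultimately show ?thesis using C_pos by (intro exI[of _ 0] bexI[of _ "-C"]) auto
      qed
    qed
    then obtain c \<mu>' where c: "\<mu>' \<in> {-C..C}" "t * \<mu> \<le> c + t * \<mu>'"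
       "\<And>y. y \<in> topspace T \<Longrightarrow> min (r0 y) (r1 y - \<mu>) + c \<le> min (r0 y) (r1 y - \<mu>')" by blast
    \<comment> \<open>The grid slope is taken below \<mu>': this only weakens the bound r1 - \<mu>',
      so the piece remains a competitor for \<open>m (\<nu> i)\<close>. The loss in slope is at most
      \<delta>, hence at most t \<delta> at time t.\<close>
    obtain i where i: "i \<le> n" "\<nu> i \<le> \<mu>'" "\<mu>' \<le> \<nu> i + \<delta>" using \<nu>[OF c(1)] by blast
    have "u x + ereal c \<le> env (m (\<nu> i)) x"
    proof (rule piece_le_env[OF _ m _ x f0])
      fix y assume y: "y \<in> topspace T"
      have "u y + ereal c \<le> ereal (min (r0 y) (r1 y - \<mu>) + c)"
        using ub[OF y] by (cases "u y") auto
      also have "\<dots> \<le> m (\<nu> i) y" using c(3)[OF y] i(2) y unfolding m_def by auto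
      finally show "u y + ereal c \<le> m (\<nu> i) y" .
    qed (use u(3) in auto)
    also have "\<dots> < g (\<nu> i) x + ereal \<delta>" using g(3)[OF x] .
    finally have 1: "u x + ereal c < g (\<nu> i) x + ereal \<delta>" .
    have 2: "g (\<nu> i) x + ereal (t * \<nu> i) \<le> H t x"
      using H(2)[OF t x i(1)] t x unfolding Gs_def by simp
    obtain q where q: "g (\<nu> i) x = ereal q" using F_real[OF g(1) x] by blast
    have "t * \<mu>' \<le> t * (\<nu> i + \<delta>)" using i(3) t by (intro mult_left_mono) auto
    also have "\<dots> \<le> t * \<nu> i + \<delta>" using t \<delta> by (simp add: algebra_simps mult_left_le_one_le)
    finally have 3: "t * \<mu>' \<le> t * \<nu> i + \<delta>" .
    \<comment> \<open>One \<delta> comes from approximating the envelope and one from the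
      grid.\<close>
    have "u x + ereal (t * \<mu>) \<le> ereal (q + t * \<nu> i) + ereal \<epsilon>"
      using 1 3 c(2) unfolding q \<delta>_def by (cases "u x") auto
    also have "\<dots> \<le> H t x + ereal \<epsilon>" using 2 unfolding q by (intro add_right_mono) simp
    finally show ?thesis unfolding u(1) .
  qed
  ultimately show ?thesis using H(1) by blast
qed

text \<open>A sufficiently late member of the net that defines \<open>\<psi>\<close> exceeds
  \<open>f0\<close> and \<open>f1\<close> by less than \<epsilon> at the two ends and dominates
  \<open>\<psi>\<close> at all times. Shifted down by \<epsilon> it becomes admissible and stays
  within \<epsilon> of dominating \<open>\<psi>\<close>.\<close>

lemma pseg_endpoints_approx:
  assumes \<psi>: "pseg \<psi>" and f: "f0 \<in> F" "f1 \<in> F"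
    and le: "\<And>x. x \<in> topspace T \<Longrightarrow> \<psi> 0 x \<le> f0 x" "\<And>x. x \<in> topspace T \<Longrightarrow> \<psi> 1 x \<le> f1 x"
    and \<epsilon>: "\<epsilon> > 0"
  shows "\<exists>G\<in>S. adm f0 f1 G \<and> (\<forall>t\<in>{0..1}. \<forall>x\<in>topspace T. \<psi> t x \<le> G t x + ereal \<epsilon>)"
proof -
  let ?D = "{0..1::real} \<times> topspace T"
  have "decreasing_net_limit ?D ((\<lambda>\<psi> (t, x). \<psi> t x) ` S) (\<lambda>(t, x). \<psi> t x)"
    using \<psi> unfolding pseg_def by (rule conjunct2)
  then obtain A :: "(real \<times> 'p \<Rightarrow> ereal) set" and prec \<eta> where
    n': "directed_preorder A prec" "\<forall>i\<in>A. \<eta> i \<in> (\<lambda>\<psi> (t, x). \<psi> t x) ` S"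
     "\<forall>i\<in>A. \<forall>j\<in>A. prec i j \<longrightarrow> (\<forall>p\<in>?D. \<eta> j p \<le> \<eta> i p)"
     "\<forall>p\<in>?D. ((\<lambda>i. \<eta> i p) \<longlongrightarrow> (case p of (t, x) \<Rightarrow> \<psi> t x)) (net_filter A prec)"
    unfolding decreasing_net_limit_def by (elim exE conjE) (rule that)
  note n = n'(1) n'(2)[rule_format] n'(3)[rule_format] n'(4)[rule_format]
  \<comment> \<open>At a fixed t the net consists of members of \<open>F\<close> on the compact
    space, where \<open>dini\<close> applies. Only the endpoints are needed, and a common later
    index serves both.\<close>
  have slice: "\<exists>i\<in>A. \<forall>x\<in>topspace T. \<eta> i (t, x) < (\<lambda>x\<in>topspace T. f x + ereal \<epsilon>) x"
    if t: "t \<in> {0..1}" and f: "f \<in> F" and le: "\<And>x. x \<in> topspace T \<Longrightarrow> \<psi> t x \<le> f x" for t f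
  proof (rule dini[OF compact n(1), where \<phi> = "\<psi> t" and \<psi> = "\<lambda>i x. \<eta> i (t, x)"])
    show "finite_continuous T (\<lambda>x. \<eta> i (t, x))" if i: "i \<in> A" for i
    proof -
      obtain G where "G \<in> S" "\<eta> i = (\<lambda>(t, x). G t x)" using n(2)[OF i] by blast
      then show ?thesis using F_cont[OF S_slice[OF _ t]] by simp
    qed
    show "finite_continuous T (\<lambda>x\<in>topspace T. f x + ereal \<epsilon>)"
      by (rule finite_continuous_shift[OF F_cont[OF f]])
    show "((\<lambda>i. \<eta> i (t, x)) \<longlongrightarrow> \<psi> t x) (net_filter A prec)" if "x \<in> topspace T" for x
      using n(4)[of "(t, x)"] t that by simp
    show "\<psi> t x < (\<lambda>x\<in>topspace T. f x + ereal \<epsilon>) x" if x: "x \<in> topspace T" for x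
    proof -
      obtain r where "f x = ereal r" using F_real[OF f x] by blast
      then have "f x < f x + ereal \<epsilon>" using \<epsilon> by simp
      then show ?thesis using le[OF x] x by simp
    qed
  qed (use n t in auto)
  obtain i where i: "i \<in> A" "\<And>x. x \<in> topspace T \<Longrightarrow> \<eta> i (0, x) < f0 x + ereal \<epsilon>"
    using slice[of 0 f0] f le by auto
  obtain j where j: "j \<in> A" "\<And>x. x \<in> topspace T \<Longrightarrow> \<eta> j (1, x) < f1 x + ereal \<epsilon>"
    using slice[of 1 f1] f le by auto
  obtain k where k: "k \<in> A" "prec i k" "prec j k"
    using n(1) i(1) j(1) unfolding directed_preorder_def by blast
  obtain G where G: "G \<in> S" "\<eta> k = (\<lambda>(t, x). G t x)" using n(2)[OF k(1)] by blast
  define G' where "G' = (\<lambda>t\<in>{0..1}. \<lambda>x\<in>topspace T. G t x + ereal (-\<epsilon>))"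
  have sub: "a + ereal (-\<epsilon>) \<le> b" if "a \<le> b + ereal \<epsilon>" for a b
    using that by (cases a; cases b) auto
  have "adm f0 f1 G'"
    unfolding adm_def
  proof (intro ballI conjI)
    fix x assume x: "x \<in> topspace T"
    have "\<eta> k (0, x) \<le> f0 x + ereal \<epsilon>"
      using n(3)[OF i(1) k(1,2), of "(0, x)"] i(2)[OF x] x by auto
    then show "G' 0 x \<le> f0 x" using x sub unfolding G'_def G(2) by simp
    have "\<eta> k (1, x) \<le> f1 x + ereal \<epsilon>"
      using n(3)[OF j(1) k(1,3), of "(1, x)"] j(2)[OF x] x by auto
    then show "G' 1 x \<le> f1 x" using x sub unfolding G'_def G(2) by simp
  qed
  moreover have "\<psi> t x \<le> G' t x + ereal \<epsilon>" if tx: "t \<in> {0..1}" "x \<in> topspace T" for t x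
  proof -
    have "(case (t, x) of (t, x) \<Rightarrow> \<psi> t x) \<le> \<eta> k (t, x)"
      by (rule decreasing_net_lower_bound[OF n(1) _ n(4) k(1)]) (use n(3) tx in auto)
    then have "\<psi> t x \<le> G t x" using G(2) by simp
    moreover obtain r where "G t x = ereal r" using F_real[OF S_slice[OF G(1) tx(1)] tx(2)] .
    ultimately show ?thesis using tx unfolding G'_def by simp
  qed
  ultimately show ?thesis using S_shift[OF G(1), of "-\<epsilon>"] unfolding G'_def by blast
qed

text \<open>The segment \<open>\<xi>\<close> bounds the infimum \<open>\<Phi>\<close> from below.
  This keeps every \<open>\<Phi> t\<close> from being identically -\<infinity>, and at the endpoints
  it supplies the inequality opposite to the one that \<open>\<Phi>\<close> satisfies by
  construction.\<close>

theorem unique_maximal_segment: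
  assumes env: "\<And>m. m \<in> extensional (topspace T) \<Longrightarrow> finite_continuous T m \<Longrightarrow> finite_continuous T (env m)"
    and \<phi>0: "\<phi>0 \<in> psh" and \<phi>1: "\<phi>1 \<in> psh"
    and \<xi>: "pseg \<xi>" "\<xi> 0 = \<phi>0" "\<xi> 1 = \<phi>1"
  shows "\<exists>!\<phi>. (pseg \<phi> \<and> \<phi> 0 = \<phi>0 \<and> \<phi> 1 = \<phi>1) \<and>
    (\<forall>\<psi>. pseg \<psi> \<and> (\<forall>x\<in>topspace T. \<psi> 0 x \<le> \<phi>0 x) \<and> (\<forall>x\<in>topspace T. \<psi> 1 x \<le> \<phi>1 x) \<longrightarrow>
        (\<forall>t\<in>{0..1}. \<forall>x\<in>topspace T. \<psi> t x \<le> \<phi> t x))"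
proof -
  let ?X = "topspace T"
  have "decreasing_net_limit ?X F \<phi>0" using \<phi>0 unfolding psh_def by blast
  then obtain A0 :: "('p \<Rightarrow> ereal) set" and prec0 \<eta>0 where
    n0': "directed_preorder A0 prec0" "\<forall>i\<in>A0. \<eta>0 i \<in> F"
     "\<forall>i\<in>A0. \<forall>j\<in>A0. prec0 i j \<longrightarrow> (\<forall>p\<in>?X. \<eta>0 j p \<le> \<eta>0 i p)"
     "\<forall>p\<in>?X. ((\<lambda>i. \<eta>0 i p) \<longlongrightarrow> \<phi>0 p) (net_filter A0 prec0)"
    unfolding decreasing_net_limit_def by (elim exE conjE) (rule that)
  note n0 = n0'(1) n0'(2)[rule_format] n0'(3)[rule_format] n0'(4)[rule_format]
  have "decreasing_net_limit ?X F \<phi>1" using \<phi>1 unfolding psh_def by blast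
  then obtain A1 :: "('p \<Rightarrow> ereal) set" and prec1 \<eta>1 where
    n1': "directed_preorder A1 prec1" "\<forall>i\<in>A1. \<eta>1 i \<in> F"
     "\<forall>i\<in>A1. \<forall>j\<in>A1. prec1 i j \<longrightarrow> (\<forall>p\<in>?X. \<eta>1 j p \<le> \<eta>1 i p)"
     "\<forall>p\<in>?X. ((\<lambda>i. \<eta>1 i p) \<longlongrightarrow> \<phi>1 p) (net_filter A1 prec1)"
    unfolding decreasing_net_limit_def by (elim exE conjE) (rule that)
  note n1 = n1'(1) n1'(2)[rule_format] n1'(3)[rule_format] n1'(4)[rule_format]
  define dominates where "dominates = (\<lambda>i j \<epsilon> H. \<forall>G\<in>S. adm (\<eta>0 i) (\<eta>1 j) G \<longrightarrow>
      (\<forall>t\<in>{0..1}. \<forall>x\<in>?X. G t x + ereal \<epsilon> \<le> H t x))"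
  define \<G> where "\<G> = {H \<in> S. \<exists>i\<in>A0. \<exists>j\<in>A1. \<exists>\<epsilon>>0. dominates i j \<epsilon> H}"
  \<comment> \<open>If G is maximal up to \<epsilon>/2, then G + \<epsilon> dominates with gap
    \<epsilon>/2, yet it exceeds an admissible segment by only \<epsilon>.\<close>
  have ex: "\<exists>H\<in>\<G>. \<exists>G\<in>S. adm (\<eta>0 i) (\<eta>1 j) G \<and> (\<forall>t\<in>{0..1}. \<forall>x\<in>?X. H t x \<le> G t x + ereal \<epsilon>)"
    if ij: "i \<in> A0" "j \<in> A1" and "\<epsilon> > 0" for i j \<epsilon>
  proof -
    obtain G where G: "G \<in> S" "adm (\<eta>0 i) (\<eta>1 j) G"
      "\<And>G' t x. G' \<in> S \<Longrightarrow> adm (\<eta>0 i) (\<eta>1 j) G' \<Longrightarrow> t \<in> {0..1} \<Longrightarrow> x \<in> ?X \<Longrightarrow> G' t x \<le> G t x + ereal (\<epsilon>/2)"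
      using maximal_approx[OF n0(2)[OF ij(1)] n1(2)[OF ij(2)] _ env, of "\<epsilon>/2"] \<open>\<epsilon> > 0\<close> by (metis half_gt_zero)
    define H where "H = (\<lambda>t\<in>{0..1}. \<lambda>x\<in>?X. G t x + ereal \<epsilon>)"
    have "dominates i j (\<epsilon>/2) H"
      unfolding dominates_def
    proof (intro ballI impI)
      fix G' t x assume G': "G' \<in> S" "adm (\<eta>0 i) (\<eta>1 j) G'" and tx: "t \<in> {0..1::real}" "x \<in> ?X"
      show "G' t x + ereal (\<epsilon>/2) \<le> H t x"
        using G(3)[OF G' tx] tx unfolding H_def by (cases "G' t x"; cases "G t x") auto
    qed
    moreover have "H \<in> S" unfolding H_def by (rule S_shift[OF G(1)])
    ultimately have "H \<in> \<G>" unfolding \<G>_def using ij \<open>\<epsilon> > 0\<close> half_gt_zero by blast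
    then show ?thesis using G by (intro bexI[of _ H] bexI[of _ G]) (auto simp: H_def)
  qed
  have \<G>S: "\<G> \<subseteq> S" unfolding \<G>_def by blast
  have ne: "A0 \<noteq> {}" "A1 \<noteq> {}" using n0(1) n1(1) unfolding directed_preorder_def by blast+
  then have \<G>ne: "\<G> \<noteq> {}" using ex zero_less_one by blast
  have dir: "\<exists>H\<in>\<G>. \<forall>t\<in>{0..1}. \<forall>x\<in>?X. H t x \<le> H1 t x \<and> H t x \<le> H2 t x"
    if H: "H1 \<in> \<G>" "H2 \<in> \<G>" for H1 H2
  proof -
    obtain i1 j1 \<epsilon>1 where 1: "i1 \<in> A0" "j1 \<in> A1" "\<epsilon>1 > 0" "dominates i1 j1 \<epsilon>1 H1" using H unfolding \<G>_def by blast
    obtain i2 j2 \<epsilon>2 where 2: "i2 \<in> A0" "j2 \<in> A1" "\<epsilon>2 > 0" "dominates i2 j2 \<epsilon>2 H2" using H unfolding \<G>_def by blast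
    obtain i where i: "i \<in> A0" "prec0 i1 i" "prec0 i2 i"
      using n0(1) 1 2 unfolding directed_preorder_def by blast
    obtain j where j: "j \<in> A1" "prec1 j1 j" "prec1 j2 j"
      using n1(1) 1 2 unfolding directed_preorder_def by blast
    \<comment> \<open>A segment admissible for the finer pair (i, j) is admissible for both coarser
      pairs. Hence H \<le> G + \<epsilon> lies below \<open>H1\<close> and \<open>H2\<close>, whose
      gaps are at least \<epsilon>.\<close>
    define \<epsilon> where "\<epsilon> = min \<epsilon>1 \<epsilon>2"
    have "\<epsilon> > 0" using 1 2 unfolding \<epsilon>_def by simp
    then obtain H G where HG: "H \<in> \<G>" "G \<in> S" "adm (\<eta>0 i) (\<eta>1 j) G"
        "\<And>t x. t \<in> {0..1} \<Longrightarrow> x \<in> ?X \<Longrightarrow> H t x \<le> G t x + ereal \<epsilon>"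
      using ex[OF i(1) j(1)] by blast
    have a1: "adm (\<eta>0 i1) (\<eta>1 j1) G" and a2: "adm (\<eta>0 i2) (\<eta>1 j2) G"
      using HG(3) n0(3)[OF 1(1) i(1,2)] n0(3)[OF 2(1) i(1,3)] n1(3)[OF 1(2) j(1,2)] n1(3)[OF 2(2) j(1,3)]
      unfolding adm_def by (meson order_trans)+
    have "H t x \<le> H1 t x \<and> H t x \<le> H2 t x" if tx: "t \<in> {0..1}" "x \<in> ?X" for t x
    proof -
      have "G t x + ereal \<epsilon> \<le> G t x + ereal \<epsilon>1" "G t x + ereal \<epsilon> \<le> G t x + ereal \<epsilon>2"
        unfolding \<epsilon>_def by (auto intro!: add_left_mono)
      moreover have "G t x + ereal \<epsilon>1 \<le> H1 t x" "G t x + ereal \<epsilon>2 \<le> H2 t x"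
        using 1(4) 2(4) a1 a2 HG(2) tx unfolding dominates_def by blast+
      ultimately show ?thesis using HG(4)[OF tx] by (meson order_trans)
    qed
    then show ?thesis using HG(1) by blast
  qed
  define \<Phi> where "\<Phi> = (\<lambda>t\<in>{0..1}. \<lambda>x\<in>?X. INF H\<in>\<G>. H t x)"
  have upper: "\<psi> t x \<le> \<Phi> t x"
    if \<psi>: "pseg \<psi>" "\<forall>x\<in>?X. \<psi> 0 x \<le> \<phi>0 x" "\<forall>x\<in>?X. \<psi> 1 x \<le> \<phi>1 x" and tx: "t \<in> {0..1}" "x \<in> ?X" for \<psi> t x
  proof -
    \<comment> \<open>The gap of \<open>H\<close> absorbs exactly the error \<epsilon> made when
      \<open>\<psi>\<close> is replaced by an admissible Fubini-Study segment.\<close>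
    have "\<psi> t x \<le> H t x" if H: "H \<in> \<G>" for H
    proof -
      obtain i j \<epsilon> where h: "i \<in> A0" "j \<in> A1" "\<epsilon> > 0" "dominates i j \<epsilon> H" using H unfolding \<G>_def by blast
      have "\<phi>0 y \<le> \<eta>0 i y" if "y \<in> ?X" for y
        by (rule decreasing_net_lower_bound[OF n0(1) _ n0(4) h(1)]) (use n0(3) that in auto)
      moreover have "\<phi>1 y \<le> \<eta>1 j y" if "y \<in> ?X" for y
        by (rule decreasing_net_lower_bound[OF n1(1) _ n1(4) h(2)]) (use n1(3) that in auto)
      ultimately have "\<exists>G\<in>S. adm (\<eta>0 i) (\<eta>1 j) G \<and>
          (\<forall>t\<in>{0..1}. \<forall>x\<in>?X. \<psi> t x \<le> G t x + ereal \<epsilon>)"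
        using \<psi>(2,3) order_trans
        by (intro pseg_endpoints_approx[OF \<psi>(1) n0(2)[OF h(1)] n1(2)[OF h(2)] _ _ h(3)]) blast+
      then obtain G where G: "G \<in> S" "adm (\<eta>0 i) (\<eta>1 j) G" "\<psi> t x \<le> G t x + ereal \<epsilon>"
        using tx by blast
      have "G t x + ereal \<epsilon> \<le> H t x" using h(4) tx G(1,2) unfolding dominates_def by blast
      then show ?thesis using G(3) by (rule order_trans[rotated])
    qed
    then show ?thesis unfolding \<Phi>_def using tx by (auto intro: INF_greatest)
  qed
  have \<Phi>\<xi>: "\<xi> t x \<le> \<Phi> t x" if "t \<in> {0..1}" "x \<in> ?X" for t x
    using upper[OF \<xi>(1)] \<xi>(2,3) that by simp
  have "\<Phi> t \<in> psh" if t: "t \<in> {0..1}" for t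
  proof -
    have "decreasing_net_limit ?X F (\<Phi> t)"
    proof (rule decreasing_net_limit_INF[of "(\<lambda>H. H t) ` \<G>"])
      show "(\<lambda>H. H t) ` \<G> \<subseteq> F" using \<G>S S_slice t by blast
      show "(\<lambda>H. H t) ` \<G> \<noteq> {}" using \<G>ne by blast
      show "\<exists>g\<in>(\<lambda>H. H t) ` \<G>. \<forall>p\<in>?X. g p \<le> g1 p \<and> g p \<le> g2 p"
        if "g1 \<in> (\<lambda>H. H t) ` \<G>" "g2 \<in> (\<lambda>H. H t) ` \<G>" for g1 g2
        using that dir t by fastforce
      show "\<Phi> t p = (INF g\<in>(\<lambda>H. H t) ` \<G>. g p)" if "p \<in> ?X" for p
        using t that unfolding \<Phi>_def by (simp add: image_image)
    qed
    moreover have "\<xi> t \<in> psh" using \<xi>(1) t unfolding pseg_def by blast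
    then obtain x where x: "x \<in> ?X" "\<xi> t x \<noteq> -\<infinity>" unfolding psh_def by blast
    then have "\<Phi> t x \<noteq> -\<infinity>" using \<Phi>\<xi>[OF t x(1)] by auto
    moreover have "\<Phi> t \<in> extensional ?X" using t by (simp add: \<Phi>_def)
    ultimately show ?thesis unfolding psh_def using x(1) by blast
  qed
  moreover have "decreasing_net_limit ({0..1} \<times> ?X) ((\<lambda>\<psi> (t, x). \<psi> t x) ` S) (\<lambda>(t, x). \<Phi> t x)"
  proof (rule decreasing_net_limit_INF[of "(\<lambda>\<psi> (t, x). \<psi> t x) ` \<G>"])
    show "(\<lambda>\<psi> (t, x). \<psi> t x) ` \<G> \<subseteq> (\<lambda>\<psi> (t, x). \<psi> t x) ` S" using \<G>S by blast
    show "(\<lambda>\<psi> (t, x). \<psi> t x) ` \<G> \<noteq> {}" using \<G>ne by blast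
    show "\<exists>g\<in>(\<lambda>\<psi> (t, x). \<psi> t x) ` \<G>. \<forall>p\<in>{0..1} \<times> ?X. g p \<le> g1 p \<and> g p \<le> g2 p"
      if g: "g1 \<in> (\<lambda>\<psi> (t, x). \<psi> t x) ` \<G>" "g2 \<in> (\<lambda>\<psi> (t, x). \<psi> t x) ` \<G>" for g1 g2
    proof -
      obtain H1 H2 where h: "H1 \<in> \<G>" "H2 \<in> \<G>" "g1 = (\<lambda>(t, x). H1 t x)" "g2 = (\<lambda>(t, x). H2 t x)"
        using g by blast
      obtain H where "H \<in> \<G>" "\<forall>t\<in>{0..1}. \<forall>x\<in>?X. H t x \<le> H1 t x \<and> H t x \<le> H2 t x"
        using dir[OF h(1,2)] by blast
      then show ?thesis unfolding h(3,4) by (intro bexI[of _ "\<lambda>(t, x). H t x"]) auto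
    qed
    show "(case p of (t, x) \<Rightarrow> \<Phi> t x) = (INF g\<in>(\<lambda>\<psi> (t, x). \<psi> t x) ` \<G>. g p)"
      if "p \<in> {0..1} \<times> ?X" for p
      using that unfolding \<Phi>_def by (auto simp: image_image)
  qed
  ultimately have \<Phi>pseg: "pseg \<Phi>"
    unfolding pseg_def by (intro conjI PiE_I) (auto simp only: \<Phi>_def restrict_def if_False)
  have end0: "\<Phi> 0 x \<le> \<phi>0 x" if x: "x \<in> ?X" for x
  proof (rule dense_ge)
    fix c assume c: "\<phi>0 x < c"
    obtain i where i: "i \<in> A0" "\<eta>0 i x < c"
      using decreasing_net_less[OF n0(1), of \<eta>0 x, OF n0(4)[OF x] c] by blast
    \<comment> \<open>Any j will do, since only the bound at t = 0 is at stake.\<close>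
    obtain j where j: "j \<in> A1" using ne by blast
    obtain r where r: "\<eta>0 i x = ereal r" using F_real[OF n0(2)[OF i(1)] x] .
    obtain \<epsilon> where \<epsilon>: "\<epsilon> > 0" "ereal (r + \<epsilon>) \<le> c"
    proof -
      \<comment> \<open>As c may be \<infinity>, a real number strictly in between provides
        \<epsilon>.\<close>
      obtain z where "ereal r < ereal z" "ereal z < c" using ereal_dense2 i(2) unfolding r by blast
      then show thesis using that[of "z - r"] by simp
    qed
    obtain H G where HG: "H \<in> \<G>" "adm (\<eta>0 i) (\<eta>1 j) G"
        "\<forall>t\<in>{0..1}. \<forall>x\<in>?X. H t x \<le> G t x + ereal \<epsilon>"
      using ex[OF i(1) j \<epsilon>(1)] by blast
    have "H 0 x \<le> G 0 x + ereal \<epsilon>" using HG(3) x by simp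
    note h = HG(1,2) this
    have "\<Phi> 0 x \<le> H 0 x" unfolding \<Phi>_def using x h(1) by (auto intro: INF_lower)
    also note h(3)
    also have "G 0 x + ereal \<epsilon> \<le> ereal r + ereal \<epsilon>"
      using h(2) x unfolding adm_def r[symmetric] by (intro add_right_mono) auto
    finally show "\<Phi> 0 x \<le> c" using \<epsilon>(2) by simp
  qed
  have end1: "\<Phi> 1 x \<le> \<phi>1 x" if x: "x \<in> ?X" for x
  proof (rule dense_ge)
    fix c assume c: "\<phi>1 x < c"
    obtain j where j: "j \<in> A1" "\<eta>1 j x < c"
      using decreasing_net_less[OF n1(1), of \<eta>1 x, OF n1(4)[OF x] c] by blast
    obtain i where i: "i \<in> A0" using ne by blast
    obtain r where r: "\<eta>1 j x = ereal r" using F_real[OF n1(2)[OF j(1)] x] .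
    obtain \<epsilon> where \<epsilon>: "\<epsilon> > 0" "ereal (r + \<epsilon>) \<le> c"
    proof -
      obtain z where "ereal r < ereal z" "ereal z < c" using ereal_dense2 j(2) unfolding r by blast
      then show thesis using that[of "z - r"] by simp
    qed
    obtain H G where HG: "H \<in> \<G>" "adm (\<eta>0 i) (\<eta>1 j) G"
        "\<forall>t\<in>{0..1}. \<forall>x\<in>?X. H t x \<le> G t x + ereal \<epsilon>"
      using ex[OF i j(1) \<epsilon>(1)] by blast
    have "H 1 x \<le> G 1 x + ereal \<epsilon>" using HG(3) x by simp
    note h = HG(1,2) this
    have "\<Phi> 1 x \<le> H 1 x" unfolding \<Phi>_def using x h(1) by (auto intro: INF_lower)
    also note h(3)
    also have "G 1 x + ereal \<epsilon> \<le> ereal r + ereal \<epsilon>"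
      using h(2) x unfolding adm_def r[symmetric] by (intro add_right_mono) auto
    finally show "\<Phi> 1 x \<le> c" using \<epsilon>(2) by simp
  qed
  have ext: "\<phi> t \<in> extensional ?X" "\<phi> \<in> extensional {0..1}" if "pseg \<phi>" "t \<in> {0..1}" for \<phi> t
    using that unfolding pseg_def psh_def by (auto simp: PiE_def)
  have \<Phi>0: "\<Phi> 0 = \<phi>0"
    by (rule extensionalityI[of _ ?X])
       (use ext[OF \<Phi>pseg, of 0] ext[OF \<xi>(1), of 0] \<xi>(2) end0 \<Phi>\<xi>[of 0] in \<open>auto intro: antisym\<close>)
  have \<Phi>1: "\<Phi> 1 = \<phi>1"
    by (rule extensionalityI[of _ ?X])
       (use ext[OF \<Phi>pseg, of 1] ext[OF \<xi>(1), of 1] \<xi>(3) end1 \<Phi>\<xi>[of 1] in \<open>auto intro: antisym\<close>)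
  show ?thesis
  proof (rule ex1I[of _ \<Phi>], intro conjI)
    fix \<phi>
    assume a: "(pseg \<phi> \<and> \<phi> 0 = \<phi>0 \<and> \<phi> 1 = \<phi>1) \<and>
      (\<forall>\<psi>. pseg \<psi> \<and> (\<forall>x\<in>?X. \<psi> 0 x \<le> \<phi>0 x) \<and> (\<forall>x\<in>?X. \<psi> 1 x \<le> \<phi>1 x) \<longrightarrow>
        (\<forall>t\<in>{0..1}. \<forall>x\<in>?X. \<psi> t x \<le> \<phi> t x))"
    show "\<phi> = \<Phi>"
    \<comment> \<open>Each of the two maximal segments competes against the other; off the domain
      both are \<open>undefined\<close>.\<close>
    proof (rule extensionalityI[of _ "{0..1}"])
      show "\<phi> \<in> extensional {0..1}" "\<Phi> \<in> extensional {0..1}"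
        using ext(2)[of _ 0] a \<Phi>pseg by auto
      fix t :: real assume t: "t \<in> {0..1}"
      show "\<phi> t = \<Phi> t"
      proof (rule extensionalityI[of _ ?X])
        show "\<phi> t \<in> extensional ?X" "\<Phi> t \<in> extensional ?X" using ext(1)[OF _ t] a \<Phi>pseg by auto
        fix x assume x: "x \<in> ?X"
        have "\<Phi> t x \<le> \<phi> t x" using a \<Phi>pseg \<Phi>0 \<Phi>1 t x by auto
        moreover have "\<phi> t x \<le> \<Phi> t x" using upper[of \<phi>] a t x by auto
        ultimately show "\<phi> t x = \<Phi> t x" by (rule antisym[rotated])
      qed
    qed
  qed (use \<Phi>pseg \<Phi>0 \<Phi>1 upper in auto)
qed

end

section \<open>Homogeneous ideals of the polynomial ring\<close>

text \<open>The carrier is the whole type, so the carrier conditions disappear; closure under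
  negation is multiplication by -1.\<close>

lemma ideal_ring_of_type_iff:
  fixes P :: "'a::comm_ring_1 set"
  shows "ideal P ring_of_type_algebra \<longleftrightarrow>
    0 \<in> P \<and> (\<forall>a\<in>P. \<forall>b\<in>P. a + b \<in> P) \<and> (\<forall>a\<in>P. \<forall>r. r * a \<in> P)" (is "?l \<longleftrightarrow> ?r")
proof
  assume ?l
  then interpret ideal P "ring_of_type_algebra :: 'a ring" .
  show ?r
    using additive_subgroup.zero_closed[OF is_additive_subgroup]
      additive_subgroup.a_closed[OF is_additive_subgroup] I_l_closed
    by (auto simp: ring_of_type_algebra_def)
next
  assume r: ?r
  interpret ring "ring_of_type_algebra :: 'a ring" by (rule ring_from_type_algebra)
  have neg: "\<ominus>\<^bsub>ring_of_type_algebra\<^esub> a = - a" for a :: 'a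
    by (rule minus_equality) (auto simp: ring_of_type_algebra_def)
  show ?l
  proof (rule idealI[OF ring_axioms])
    show "subgroup P (add_monoid (ring_of_type_algebra :: 'a ring))"
    proof (rule group.subgroupI[OF a_group])
      show "inv\<^bsub>add_monoid (ring_of_type_algebra :: 'a ring)\<^esub> a \<in> P" if "a \<in> P" for a
      proof -
        have "(-1) * a \<in> P" using r that by blast
        then show ?thesis using neg[of a] by (simp add: a_inv_def)
      qed
    qed (use r in \<open>auto simp: ring_of_type_algebra_def\<close>)
  qed (use r in \<open>auto simp: ring_of_type_algebra_def mult.commute\<close>)
qed

lemma primeideal_ring_of_type_iff:
  fixes P :: "'a::comm_ring_1 set"
  shows "primeideal P ring_of_type_algebra \<longleftrightarrow>
    ideal P ring_of_type_algebra \<and> 1 \<notin> P \<and> (\<forall>a b. a * b \<in> P \<longrightarrow> a \<in> P \<or> b \<in> P)" (is "?l \<longleftrightarrow> ?r")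
proof
  assume ?l
  then interpret primeideal P "ring_of_type_algebra :: 'a ring" .
  have "P \<noteq> UNIV" using I_notcarr by (auto simp: ring_of_type_algebra_def)
  then have "1 \<notin> P" using is_ideal unfolding ideal_ring_of_type_iff by (metis UNIV_eq_I mult.right_neutral)
  then show ?r using is_ideal I_prime by (auto simp: ring_of_type_algebra_def)
next
  assume r: ?r
  show ?l
    by (rule primeidealI) (use r in \<open>auto simp: ring_of_type_algebra_def intro: cring_from_type_algebra[unfolded ring_of_type_algebra_def]\<close>)
qed

lemma Idl_ring_of_type:
  fixes S :: "'a::comm_ring_1 set"
  shows "ideal (Idl\<^bsub>ring_of_type_algebra\<^esub> S) ring_of_type_algebra" "S \<subseteq> Idl\<^bsub>ring_of_type_algebra\<^esub> S"
    and "ideal J ring_of_type_algebra \<Longrightarrow> S \<subseteq> J \<Longrightarrow> Idl\<^bsub>ring_of_type_algebra\<^esub> S \<subseteq> J"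
proof -
  interpret ring "ring_of_type_algebra :: 'a ring" by (rule ring_from_type_algebra)
  show "ideal (Idl\<^bsub>ring_of_type_algebra\<^esub> S) ring_of_type_algebra" "S \<subseteq> Idl\<^bsub>ring_of_type_algebra\<^esub> S"
    by (rule genideal_ideal genideal_self; simp add: ring_of_type_algebra_def)+
  show "ideal J ring_of_type_algebra \<Longrightarrow> S \<subseteq> J \<Longrightarrow> Idl\<^bsub>ring_of_type_algebra\<^esub> S \<subseteq> J"
    by (rule genideal_minimal)
qed

lemma ideal_sum:
  fixes P :: "'a::comm_ring_1 set"
  assumes "ideal P ring_of_type_algebra" "\<And>x. x \<in> A \<Longrightarrow> f x \<in> P"
  shows "sum f A \<in> P"
proof (cases "finite A")
  case True
  then show ?thesis using assms(2) assms(1)[unfolded ideal_ring_of_type_iff]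
    by (induction A) auto
next
  case False
  then show ?thesis using assms(1)[unfolded ideal_ring_of_type_iff] by simp
qed

lemma ideal_diff:
  fixes P :: "'a::comm_ring_1 set"
  assumes "ideal P ring_of_type_algebra" "a \<in> P" "b \<in> P"
  shows "a - b \<in> P"
  using assms unfolding ideal_ring_of_type_iff
  by (metis add_uminus_conv_diff mult_minus1)

section \<open>Grading by total degree and homogeneous components\<close>

definition mdeg :: "('n::finite \<Rightarrow>\<^sub>0 nat) \<Rightarrow> nat" where
  "mdeg m = (\<Sum>i\<in>UNIV. Poly_Mapping.lookup m i)"

lemma mdeg_simps [simp]:
  "mdeg 0 = 0" "mdeg (m + m') = mdeg m + mdeg m'" "mdeg (Poly_Mapping.single i k) = k"
proof -
  have "(\<Sum>j\<in>UNIV. k when i = j) = k"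
    by (simp add: when_def)
  then show "mdeg (Poly_Mapping.single i k) = k" by (simp add: mdeg_def lookup_single)
qed (simp_all add: mdeg_def lookup_add sum.distrib)

lemma forms_iff: "p \<in> forms d \<longleftrightarrow> (\<forall>m. Poly_Mapping.lookup p m \<noteq> 0 \<longrightarrow> mdeg m = d)"
  by (auto simp: forms_def mdeg_def in_keys_iff)

lemma forms_zero: "0 \<in> forms d"
  by (simp add: forms_iff)

lemma forms_one: "1 \<in> forms 0"
  by (auto simp: forms_iff lookup_one when_def split: if_splits)

lemma forms_single: "Poly_Mapping.single m c \<in> forms (mdeg m)"
  by (auto simp: forms_iff lookup_single when_def split: if_splits)

lemma forms_add: "p \<in> forms d \<Longrightarrow> q \<in> forms d \<Longrightarrow> p + q \<in> forms d"
  by (auto simp: forms_iff lookup_add) (metis add.left_neutral)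

lemma forms_uminus: "p \<in> forms d \<Longrightarrow> - p \<in> forms d"
  by (auto simp: forms_iff)

lemma forms_diff: "p \<in> forms d \<Longrightarrow> q \<in> forms d \<Longrightarrow> p - q \<in> forms d"
  using forms_add[OF _ forms_uminus] by fastforce

lemma forms_sum: "(\<And>x. x \<in> A \<Longrightarrow> f x \<in> forms d) \<Longrightarrow> sum f A \<in> forms d"
  by (induction A rule: infinite_finite_induct) (auto intro: forms_add forms_zero)

lemma forms_mult:
  assumes "p \<in> forms d" "q \<in> forms e"
  shows "p * q \<in> forms (d + e)"
  unfolding forms_iff
proof (intro allI impI)
  fix m assume "Poly_Mapping.lookup (p * q) m \<noteq> 0"
  then have "m \<in> Poly_Mapping.keys (p * q)" by (simp add: in_keys_iff)
  then obtain a b where "m = a + b" "a \<in> Poly_Mapping.keys p" "b \<in> Poly_Mapping.keys q"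
    using keys_mult[of p q] by blast
  then show "mdeg m = d + e" using assms by (auto simp: forms_iff in_keys_iff)
qed

lemma forms_power: "p \<in> forms d \<Longrightarrow> p ^ n \<in> forms (n * d)"
  by (induction n) (auto intro: forms_mult forms_one)

lemma forms_degree_unique: "p \<in> forms d \<Longrightarrow> p \<in> forms e \<Longrightarrow> p \<noteq> 0 \<Longrightarrow> d = e"
  unfolding forms_iff by (metis lookup_zero poly_mapping_eqI)

definition hcomp :: "nat \<Rightarrow> ('n::finite, 'k::field) mpol \<Rightarrow> ('n, 'k) mpol" where
  "hcomp d p = (\<Sum>m\<in>{m \<in> Poly_Mapping.keys p. mdeg m = d}. Poly_Mapping.single m (Poly_Mapping.lookup p m))"

lemma lookup_hcomp: "Poly_Mapping.lookup (hcomp d p) m = (if mdeg m = d then Poly_Mapping.lookup p m else 0)"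
proof -
  have "Poly_Mapping.lookup (hcomp d p) m =
      (\<Sum>m'\<in>{m \<in> Poly_Mapping.keys p. mdeg m = d}. if m' = m then Poly_Mapping.lookup p m else 0)"
    unfolding hcomp_def lookup_sum lookup_single when_def by (intro sum.cong) auto
  also have "\<dots> = (if mdeg m = d then Poly_Mapping.lookup p m else 0)"
    by (subst sum.delta) (auto simp: in_keys_iff)
  finally show ?thesis .
qed

lemma hcomp_forms: "hcomp d p \<in> forms d"
  by (auto simp: forms_iff lookup_hcomp)

lemma hcomp_zero [simp]: "hcomp d 0 = 0"
  by (rule poly_mapping_eqI) (simp add: lookup_hcomp)

lemma hcomp_add: "hcomp d (p + q) = hcomp d p + hcomp d q"
  by (rule poly_mapping_eqI) (simp add: lookup_hcomp lookup_add)

lemma hcomp_sum: "hcomp d (sum f A) = (\<Sum>x\<in>A. hcomp d (f x))"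
  by (induction A rule: infinite_finite_induct) (auto simp: hcomp_add)

lemma hcomp_of_form: "p \<in> forms e \<Longrightarrow> hcomp d p = (if d = e then p else 0)"
  by (rule poly_mapping_eqI) (auto simp: lookup_hcomp forms_iff)

text \<open>A crude upper bound for the degree. A sum, unlike a maximum, also makes sense for the
  zero polynomial, which has no monomials.\<close>

definition mbound :: "('n::finite, 'k::field) mpol \<Rightarrow> nat" where
  "mbound p = (\<Sum>m\<in>Poly_Mapping.keys p. mdeg m)"

lemma sum_hcomp:
  assumes "mbound p \<le> D"
  shows "(\<Sum>d\<le>D. hcomp d p) = p"
proof (rule poly_mapping_eqI)
  fix m
  have "mdeg m \<le> D" if "m \<in> Poly_Mapping.keys p"
    using assms member_le_sum[OF that, of mdeg] by (simp add: mbound_def)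
  then show "Poly_Mapping.lookup (\<Sum>d\<le>D. hcomp d p) m = Poly_Mapping.lookup p m"
    by (auto simp: lookup_sum lookup_hcomp in_keys_iff)
qed

lemma hcomp_eq_0: "mbound p < d \<Longrightarrow> hcomp d p = 0"
proof (rule poly_mapping_eqI)
  fix m assume d: "mbound p < d"
  have "mdeg m \<le> mbound p" if "m \<in> Poly_Mapping.keys p"
    using member_le_sum[OF that, of mdeg] by (simp add: mbound_def)
  then show "Poly_Mapping.lookup (hcomp d p) m = Poly_Mapping.lookup 0 m"
    using d by (cases "m \<in> Poly_Mapping.keys p") (auto simp: lookup_hcomp in_keys_iff)
qed

lemma hcomp_mult:
  "hcomp d (p * q) =
     (\<Sum>i\<le>mbound p. \<Sum>j\<le>mbound q. if d = i + j then hcomp i p * hcomp j q else 0)"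
proof -
  have "p * q = (\<Sum>i\<le>mbound p. hcomp i p) * (\<Sum>j\<le>mbound q. hcomp j q)"
    by (simp add: sum_hcomp)
  also have "\<dots> = (\<Sum>i\<le>mbound p. \<Sum>j\<le>mbound q. hcomp i p * hcomp j q)"
    by (simp add: sum_product)
  finally show ?thesis
    by (simp add: hcomp_sum hcomp_of_form[OF forms_mult[OF hcomp_forms hcomp_forms]])
qed

text \<open>The polynomials with all components in \<open>P\<close> form an ideal that contains the
  homogeneous generators, hence all of \<open>P\<close>. Conversely each p is the sum of its
  components.\<close>

lemma homogeneous_ideal_iff:
  "homogeneous_ideal P \<longleftrightarrow> ideal P ring_of_type_algebra \<and> (\<forall>p\<in>P. \<forall>d. hcomp d p \<in> P)"
    (is "?l \<longleftrightarrow> ?r")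
proof
  assume l: ?l
  then have P: "ideal P ring_of_type_algebra" "P = Idl\<^bsub>ring_of_type_algebra\<^esub> (P \<inter> (\<Union>d. forms d))"
    unfolding homogeneous_ideal_def by auto
  let ?J = "{p. \<forall>d. hcomp d p \<in> P}"
  have "ideal ?J ring_of_type_algebra"
    unfolding ideal_ring_of_type_iff
  proof (intro conjI ballI allI)
    show "0 \<in> ?J" using P(1) by (auto simp: ideal_ring_of_type_iff)
    show "a + b \<in> ?J" if "a \<in> ?J" "b \<in> ?J" for a b
      using that P(1) by (auto simp: ideal_ring_of_type_iff hcomp_add)
    show "r * a \<in> ?J" if "a \<in> ?J" for a r
      using that P(1) by (auto simp: hcomp_mult ideal_ring_of_type_iff intro!: ideal_sum[OF P(1)])
  qed
  moreover have "P \<inter> (\<Union>d. forms d) \<subseteq> ?J"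
    using P(1) by (auto simp: hcomp_of_form ideal_ring_of_type_iff)
  ultimately have "P \<subseteq> ?J" using Idl_ring_of_type(3) P(2) by metis
  then show ?r using P(1) by blast
next
  assume r: ?r
  have "P \<subseteq> Idl\<^bsub>ring_of_type_algebra\<^esub> (P \<inter> (\<Union>d. forms d))" (is "_ \<subseteq> ?J")
  proof
    fix p assume "p \<in> P"
    then have "(\<Sum>d\<le>mbound p. hcomp d p) \<in> ?J"
      using r Idl_ring_of_type(2)[of "P \<inter> (\<Union>d. forms d)"]
      by (intro ideal_sum[OF Idl_ring_of_type(1)] subsetD[OF Idl_ring_of_type(2)])
         (auto intro: hcomp_forms)
    then show "p \<in> ?J" by (simp add: sum_hcomp)
  qed
  moreover have "?J \<subseteq> P" using r by (intro Idl_ring_of_type(3)) auto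
  ultimately show ?l using r unfolding homogeneous_ideal_def by blast
qed

definition X_var :: "'n::finite \<Rightarrow> ('n, 'k::field) mpol" where
  "X_var i = Poly_Mapping.single (Poly_Mapping.single i 1) 1"

lemma X_var_forms: "X_var i \<in> forms 1"
  using forms_single[of "Poly_Mapping.single i 1" 1] by (simp add: X_var_def)

text \<open>Every monomial of positive degree is divisible by a variable, so an ideal with all the
  variables contains the irrelevant ideal. The variable found here selects a standard affine chart
  around the point.\<close>

lemma not_in_homogeneous_prime:
  assumes "\<not> (\<Union>d\<in>{1..}. forms d) \<subseteq> P" "ideal P ring_of_type_algebra"
  shows "\<exists>i. X_var i \<notin> (P :: ('n::finite, 'k::field) mpol set)"
proof (rule ccontr)
  assume "\<not> ?thesis"
  then have X: "X_var i \<in> P" for i by blast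
  have "p \<in> P" if "p \<in> forms d" "d \<ge> 1" for p d
  proof -
    have mon: "Poly_Mapping.single m (Poly_Mapping.lookup p m) \<in> P" if "m \<in> Poly_Mapping.keys p" for m
    proof -
      have "mdeg m \<ge> 1" using that \<open>p \<in> forms d\<close> \<open>d \<ge> 1\<close> by (auto simp: forms_iff in_keys_iff)
      then obtain i where i: "Poly_Mapping.lookup m i \<noteq> 0" unfolding mdeg_def by fastforce
      have "m = (m - Poly_Mapping.single i 1) + Poly_Mapping.single i 1"
        by (rule poly_mapping_eqI) (use i in \<open>auto simp: lookup_add lookup_minus lookup_single when_def\<close>)
      then have "Poly_Mapping.single m (Poly_Mapping.lookup p m) =
        Poly_Mapping.single (m - Poly_Mapping.single i 1) (Poly_Mapping.lookup p m) *
        X_var i"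
        by (simp add: mult_single X_var_def)
      then show ?thesis using X[of i] assms(2) by (simp add: ideal_ring_of_type_iff)
    qed
    have "(\<Sum>e\<le>mbound p. hcomp e p) \<in> P"
      unfolding hcomp_def by (intro ideal_sum[OF assms(2)]) (use mon in auto)
    then show ?thesis by (simp add: sum_hcomp)
  qed
  then show False using assms(1) by auto
qed

section \<open>Local rings and residue fields\<close>

locale scheme_point =
  fixes I :: "('n::finite, 'k::field) mpol set" and P :: "('n, 'k) point"
  assumes ideal_I: "ideal I ring_of_type_algebra" and P: "P \<in> Proj I"
begin

lemma I_closed: "0 \<in> I" "a \<in> I \<Longrightarrow> b \<in> I \<Longrightarrow> a + b \<in> I" "a \<in> I \<Longrightarrow> r * a \<in> I"
  using ideal_I unfolding ideal_ring_of_type_iff by auto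

lemma ideal_P: "ideal P ring_of_type_algebra"
  using P unfolding Proj_def homogeneous_ideal_def by blast

lemma P_closed: "0 \<in> P" "a \<in> P \<Longrightarrow> b \<in> P \<Longrightarrow> a + b \<in> P" "a \<in> P \<Longrightarrow> r * a \<in> P" "a \<in> P \<Longrightarrow> a * r \<in> P"
  using ideal_P unfolding ideal_ring_of_type_iff by (auto simp: mult.commute)

lemma P_prime: "a * b \<in> P \<longleftrightarrow> a \<in> P \<or> b \<in> P" "1 \<notin> P"
  using P P_closed unfolding Proj_def primeideal_ring_of_type_iff by auto

lemma I_sub_P: "I \<subseteq> P"
  using P unfolding Proj_def by blast

lemma frac_pairsE:
  assumes "(a, f) \<in> frac_pairs P"
  obtains d where "a \<in> forms d" "f \<in> forms d" "f \<notin> P"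
  using assms unfolding frac_pairs_def by blast

lemma frac_pairsI: "a \<in> forms d \<Longrightarrow> f \<in> forms d \<Longrightarrow> f \<notin> P \<Longrightarrow> (a, f) \<in> frac_pairs P"
  unfolding frac_pairs_def by blast

lemma frac_pairs_mult:
  assumes "(a, f) \<in> frac_pairs P" "(b, g) \<in> frac_pairs P"
  shows "(a * b, f * g) \<in> frac_pairs P"
proof -
  obtain d where d: "a \<in> forms d" "f \<in> forms d" "f \<notin> P" using frac_pairsE[OF assms(1)] .
  obtain e where e: "b \<in> forms e" "g \<in> forms e" "g \<notin> P" using frac_pairsE[OF assms(2)] .
  show ?thesis
    by (rule frac_pairsI[OF forms_mult[OF d(1) e(1)] forms_mult[OF d(2) e(2)]]) (simp add: P_prime d e)
qed

lemma frac_pairs_add: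
  assumes "(a, f) \<in> frac_pairs P" "(b, g) \<in> frac_pairs P"
  shows "(a * g + b * f, f * g) \<in> frac_pairs P"
proof -
  obtain d where d: "a \<in> forms d" "f \<in> forms d" "f \<notin> P" using frac_pairsE[OF assms(1)] .
  obtain e where e: "b \<in> forms e" "g \<in> forms e" "g \<notin> P" using frac_pairsE[OF assms(2)] .
  have "b * f \<in> forms (d + e)" using forms_mult[OF e(1) d(2)] by (simp add: add.commute)
  then show ?thesis
    by (intro frac_pairsI[OF forms_add[OF forms_mult[OF d(1) e(2)]] forms_mult[OF d(2) e(2)]])
       (simp_all add: P_prime d e)
qed

lemma frac_pairs_const: "c \<in> forms 0 \<Longrightarrow> (c, 1) \<in> frac_pairs P"
  by (rule frac_pairsI[OF _ forms_one P_prime(2)])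

lemma frac_pairs_uminus: "(a, f) \<in> frac_pairs P \<Longrightarrow> (- a, f) \<in> frac_pairs P"
  by (elim frac_pairsE) (intro frac_pairsI forms_uminus)

text \<open>Equality of fractions in the localisation, as a relation on arbitrary pairs; the
  multiplier \<open>h\<close> allows for zero divisors modulo \<open>I\<close>.\<close>

definition frac_eq where
  "frac_eq x y \<longleftrightarrow> (\<exists>d. \<exists>h\<in>forms d. h \<notin> P \<and> h * (fst x * snd y - fst y * snd x) \<in> I)"

lemma fraction_alt: "fraction I P a f = {y \<in> frac_pairs P. frac_eq (a, f) y}"
  unfolding fraction_def frac_eq_def by fastforce

lemma frac_eqI: "a * g = b * f \<Longrightarrow> frac_eq (a, f) (b, g)"
  unfolding frac_eq_def
  by (intro exI[of _ 0] bexI[of _ 1]) (auto simp: forms_one P_prime(2) I_closed(1))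

lemma frac_eq_sym: "frac_eq x y \<Longrightarrow> frac_eq y x"
  unfolding frac_eq_def
proof (elim exE bexE conjE)
  fix h d assume h: "h \<in> forms d" "h \<notin> P" "h * (fst x * snd y - fst y * snd x) \<in> I"
  have "(-1) * (h * (fst x * snd y - fst y * snd x)) \<in> I" using I_closed(3) h(3) .
  then have "h * (fst y * snd x - fst x * snd y) \<in> I" by (simp add: algebra_simps)
  then show "\<exists>d. \<exists>h\<in>forms d. h \<notin> P \<and> h * (fst y * snd x - fst x * snd y) \<in> I" using h by blast
qed

lemma frac_eq_trans:
  assumes "(b, g) \<in> frac_pairs P" "frac_eq (a, f) (b, g)" "frac_eq (b, g) (c, e)"
  shows "frac_eq (a, f) (c, e)"
proof -
  obtain h d where h: "h \<in> forms d" "h \<notin> P" "h * (a * g - b * f) \<in> I"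
    using assms(2) unfolding frac_eq_def by auto
  obtain k d' where k: "k \<in> forms d'" "k \<notin> P" "k * (b * e - c * g) \<in> I"
    using assms(3) unfolding frac_eq_def by auto
  \<comment> \<open>The coefficients are chosen to cancel the terms with b, leaving a e - c f times
    h k g, which serves as the new multiplier.\<close>
  have "(k * e) * (h * (a * g - b * f)) + (h * f) * (k * (b * e - c * g)) \<in> I"
    using I_closed h k by blast
  moreover have "(k * e) * (h * (a * g - b * f)) + (h * f) * (k * (b * e - c * g)) = (h * k * g) * (a * e - c * f)"
    by (simp add: algebra_simps)
  moreover obtain d'' where "g \<in> forms d''" "g \<notin> P" using frac_pairsE[OF assms(1)] .
  then have "h * k * g \<in> forms (d + d' + d'')" "h * k * g \<notin> P"
    using h k P_prime by (auto intro!: forms_mult)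
  ultimately show ?thesis unfolding frac_eq_def by auto
qed

lemma fraction_eq_iff:
  assumes "(a, f) \<in> frac_pairs P" "(b, g) \<in> frac_pairs P"
  shows "fraction I P a f = fraction I P b g \<longleftrightarrow> frac_eq (a, f) (b, g)"
proof
  assume "fraction I P a f = fraction I P b g"
  moreover have "(b, g) \<in> fraction I P b g" unfolding fraction_alt using assms frac_eqI by auto
  ultimately show "frac_eq (a, f) (b, g)" unfolding fraction_alt by blast
next
  assume e: "frac_eq (a, f) (b, g)"
  have "frac_eq (a, f) (c, h) \<longleftrightarrow> frac_eq (b, g) (c, h)" for c h
    using frac_eq_trans[OF assms(2) e] frac_eq_trans[OF assms(1) frac_eq_sym[OF e]] by blast
  then show "fraction I P a f = fraction I P b g" unfolding fraction_alt by auto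
qed

lemma fraction_self: "(a, f) \<in> frac_pairs P \<Longrightarrow> (a, f) \<in> fraction I P a f"
  unfolding fraction_alt using frac_eqI by auto

lemma fraction_eqI:
  assumes "(a, f) \<in> frac_pairs P" "(b, g) \<in> frac_pairs P" "a * g = b * f"
  shows "fraction I P a f = fraction I P b g"
  using assms fraction_eq_iff frac_eqI by blast

abbreviation "R \<equiv> local_ring I P"

lemma R_carrier: "carrier R = {fraction I P a f | a f. (a, f) \<in> frac_pairs P}"
  by (simp add: local_ring_def)

lemma R_zero: "\<zero>\<^bsub>R\<^esub> = fraction I P 0 1" and R_one: "\<one>\<^bsub>R\<^esub> = fraction I P 1 1"
  by (simp_all add: local_ring_def)

text \<open>Multiplication is a union over all pairs of representatives. Independence of the
  representatives makes all the united classes equal, so the union collapses to one of them.\<close>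

lemma R_mult:
  assumes "(a, f) \<in> frac_pairs P" "(b, g) \<in> frac_pairs P"
  shows "fraction I P a f \<otimes>\<^bsub>R\<^esub> fraction I P b g = fraction I P (a * b) (f * g)"
proof -
  have "fraction I P (a' * b') (f' * g') = fraction I P (a * b) (f * g)"
    if "(a', f') \<in> fraction I P a f" "(b', g') \<in> fraction I P b g" for a' f' b' g'
  proof -
    have fp: "(a', f') \<in> frac_pairs P" "(b', g') \<in> frac_pairs P"
      and e: "frac_eq (a, f) (a', f')" "frac_eq (b, g) (b', g')"
      using that unfolding fraction_alt by auto
    obtain h d where h: "h \<in> forms d" "h \<notin> P" "h * (a * f' - a' * f) \<in> I"
      using e(1) unfolding frac_eq_def by auto
    obtain k d' where k: "k \<in> forms d'" "k \<notin> P" "k * (b * g' - b' * g) \<in> I"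
      using e(2) unfolding frac_eq_def by auto
    \<comment> \<open>The usual telescoping, changing one factor at a time: a b f' g' - a' b' f g =
      b g' (a f' - a' f) + a' f (b g' - b' g).\<close>
    have "(k * b * g') * (h * (a * f' - a' * f)) + (h * a' * f) * (k * (b * g' - b' * g)) \<in> I"
      using I_closed h k by blast
    moreover have "(k * b * g') * (h * (a * f' - a' * f)) + (h * a' * f) * (k * (b * g' - b' * g)) =
      (h * k) * ((a * b) * (f' * g') - (a' * b') * (f * g))" by (simp add: algebra_simps)
    moreover have "h * k \<in> forms (d + d')" "h * k \<notin> P" using h k P_prime by (auto intro!: forms_mult)
    ultimately have "frac_eq (a * b, f * g) (a' * b', f' * g')" unfolding frac_eq_def by auto
    then show ?thesis using fraction_eq_iff frac_pairs_mult assms fp by metis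
  qed
  then have "(\<Union>(a', f')\<in>fraction I P a f. \<Union>(b', g')\<in>fraction I P b g. fraction I P (a' * b') (f' * g')) =
     (\<Union>x\<in>fraction I P a f. \<Union>y\<in>fraction I P b g. fraction I P (a * b) (f * g))"
    by (intro SUP_cong refl) auto
  also have "\<dots> = fraction I P (a * b) (f * g)"
    using fraction_self[OF assms(1)] fraction_self[OF assms(2)] by auto
  finally show ?thesis by (simp add: local_ring_def)
qed

lemma R_add:
  assumes "(a, f) \<in> frac_pairs P" "(b, g) \<in> frac_pairs P"
  shows "fraction I P a f \<oplus>\<^bsub>R\<^esub> fraction I P b g = fraction I P (a * g + b * f) (f * g)"
proof -
  have "fraction I P (a' * g' + b' * f') (f' * g') = fraction I P (a * g + b * f) (f * g)"
    if "(a', f') \<in> fraction I P a f" "(b', g') \<in> fraction I P b g" for a' f' b' g'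
  proof -
    have fp: "(a', f') \<in> frac_pairs P" "(b', g') \<in> frac_pairs P"
      and e: "frac_eq (a, f) (a', f')" "frac_eq (b, g) (b', g')"
      using that unfolding fraction_alt by auto
    obtain h d where h: "h \<in> forms d" "h \<notin> P" "h * (a * f' - a' * f) \<in> I"
      using e(1) unfolding frac_eq_def by auto
    obtain k d' where k: "k \<in> forms d'" "k \<notin> P" "k * (b * g' - b' * g) \<in> I"
      using e(2) unfolding frac_eq_def by auto
    have "(k * g * g') * (h * (a * f' - a' * f)) + (h * f * f') * (k * (b * g' - b' * g)) \<in> I"
      using I_closed h k by blast
    moreover have "(k * g * g') * (h * (a * f' - a' * f)) + (h * f * f') * (k * (b * g' - b' * g)) =
      (h * k) * ((a * g + b * f) * (f' * g') - (a' * g' + b' * f') * (f * g))" by (simp add: algebra_simps)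
    moreover have "h * k \<in> forms (d + d')" "h * k \<notin> P" using h k P_prime by (auto intro!: forms_mult)
    ultimately have "frac_eq (a * g + b * f, f * g) (a' * g' + b' * f', f' * g')" unfolding frac_eq_def by auto
    then show ?thesis using fraction_eq_iff frac_pairs_add assms fp by metis
  qed
  then have "(\<Union>(a', f')\<in>fraction I P a f. \<Union>(b', g')\<in>fraction I P b g. fraction I P (a' * g' + b' * f') (f' * g')) =
     (\<Union>x\<in>fraction I P a f. \<Union>y\<in>fraction I P b g. fraction I P (a * g + b * f) (f * g))"
    by (intro SUP_cong refl) auto
  also have "\<dots> = fraction I P (a * g + b * f) (f * g)"
    using fraction_self[OF assms(1)] fraction_self[OF assms(2)] by auto
  finally show ?thesis by (simp add: local_ring_def)
qed

lemma R_carrierE: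
  assumes "x \<in> carrier R"
  obtains a f where "(a, f) \<in> frac_pairs P" "x = fraction I P a f"
  using assms unfolding R_carrier by blast

lemma R_carrierI: "(a, f) \<in> frac_pairs P \<Longrightarrow> fraction I P a f \<in> carrier R"
  unfolding R_carrier by blast

lemmas const_pairs = frac_pairs_const[OF forms_zero] frac_pairs_const[OF forms_one]

sublocale ring R
proof (rule ringI)
  show "abelian_group R"
  proof (rule abelian_groupI)
    show "x \<oplus>\<^bsub>R\<^esub> y \<in> carrier R" if "x \<in> carrier R" "y \<in> carrier R" for x y
      using that by (auto elim!: R_carrierE simp: R_add intro!: R_carrierI frac_pairs_add)
    show "\<zero>\<^bsub>R\<^esub> \<in> carrier R" unfolding R_zero by (rule R_carrierI[OF const_pairs(1)])
    show "x \<oplus>\<^bsub>R\<^esub> y \<oplus>\<^bsub>R\<^esub> z = x \<oplus>\<^bsub>R\<^esub> (y \<oplus>\<^bsub>R\<^esub> z)"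
      if "x \<in> carrier R" "y \<in> carrier R" "z \<in> carrier R" for x y z
      using that
      by (elim R_carrierE) (simp add: R_add frac_pairs_add, intro fraction_eqI frac_pairs_add;
         simp add: algebra_simps)
    show "x \<oplus>\<^bsub>R\<^esub> y = y \<oplus>\<^bsub>R\<^esub> x" if "x \<in> carrier R" "y \<in> carrier R" for x y
      using that by (auto elim!: R_carrierE simp: R_add algebra_simps)
    show "\<zero>\<^bsub>R\<^esub> \<oplus>\<^bsub>R\<^esub> x = x" if "x \<in> carrier R" for x
      using that unfolding R_zero by (auto elim!: R_carrierE simp: R_add const_pairs)
    show "\<exists>y\<in>carrier R. y \<oplus>\<^bsub>R\<^esub> x = \<zero>\<^bsub>R\<^esub>" if carr: "x \<in> carrier R" for x
    proof -
      obtain a f where x: "(a, f) \<in> frac_pairs P" "x = fraction I P a f" using R_carrierE[OF carr] .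
      have "fraction I P (- a) f \<oplus>\<^bsub>R\<^esub> x = \<zero>\<^bsub>R\<^esub>"
        unfolding x(2) R_add[OF frac_pairs_uminus[OF x(1)] x(1)] R_zero
        by (rule fraction_eqI[OF frac_pairs_add[OF frac_pairs_uminus[OF x(1)] x(1)] const_pairs(1)]) simp
      then show ?thesis using R_carrierI[OF frac_pairs_uminus[OF x(1)]] by blast
    qed
  qed
  show "Group.monoid R"
  proof (rule monoidI)
    show "x \<otimes>\<^bsub>R\<^esub> y \<in> carrier R" if "x \<in> carrier R" "y \<in> carrier R" for x y
      using that by (auto elim!: R_carrierE simp: R_mult intro!: R_carrierI frac_pairs_mult)
    show "\<one>\<^bsub>R\<^esub> \<in> carrier R" unfolding R_one by (rule R_carrierI[OF const_pairs(2)])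
    show "x \<otimes>\<^bsub>R\<^esub> y \<otimes>\<^bsub>R\<^esub> z = x \<otimes>\<^bsub>R\<^esub> (y \<otimes>\<^bsub>R\<^esub> z)"
      if "x \<in> carrier R" "y \<in> carrier R" "z \<in> carrier R" for x y z
      using that by (auto elim!: R_carrierE simp: R_mult frac_pairs_mult mult.assoc)
    show "\<one>\<^bsub>R\<^esub> \<otimes>\<^bsub>R\<^esub> x = x" "x \<otimes>\<^bsub>R\<^esub> \<one>\<^bsub>R\<^esub> = x" if "x \<in> carrier R" for x
      using that unfolding R_one by (auto elim!: R_carrierE simp: R_mult const_pairs)
  qed
  show "(x \<oplus>\<^bsub>R\<^esub> y) \<otimes>\<^bsub>R\<^esub> z = x \<otimes>\<^bsub>R\<^esub> z \<oplus>\<^bsub>R\<^esub> y \<otimes>\<^bsub>R\<^esub> z"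
    "z \<otimes>\<^bsub>R\<^esub> (x \<oplus>\<^bsub>R\<^esub> y) = z \<otimes>\<^bsub>R\<^esub> x \<oplus>\<^bsub>R\<^esub> z \<otimes>\<^bsub>R\<^esub> y"
    if "x \<in> carrier R" "y \<in> carrier R" "z \<in> carrier R" for x y z
    using that
    by (elim R_carrierE; simp add: R_add R_mult frac_pairs_add frac_pairs_mult,
        intro fraction_eqI frac_pairs_add frac_pairs_mult; simp add: algebra_simps)+
qed

text \<open>Two numerators of one fraction are related modulo \<open>I \<subseteq> P\<close> up to
  factors outside \<open>P\<close>; primality then makes membership in \<open>P\<close> independent
  of the representative.\<close>

lemma fraction_in_max_ideal:
  assumes "(a, f) \<in> frac_pairs P"
  shows "fraction I P a f \<in> max_ideal I P \<longleftrightarrow> a \<in> P"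
proof
  assume "fraction I P a f \<in> max_ideal I P"
  then obtain b g where b: "(b, g) \<in> frac_pairs P" "b \<in> P" "fraction I P a f = fraction I P b g"
    unfolding max_ideal_def by blast
  then have "frac_eq (a, f) (b, g)" using fraction_eq_iff assms by blast
  then obtain h where h: "h \<notin> P" "h * (a * g - b * f) \<in> P"
    using I_sub_P unfolding frac_eq_def by auto
  then have "a * g - b * f \<in> P" using P_prime by blast
  then have "(a * g - b * f) + b * f \<in> P" using P_closed b by blast
  then show "a \<in> P" using P_prime b unfolding frac_pairs_def by auto
qed (use assms in \<open>auto simp: max_ideal_def\<close>)

lemma uminus_fraction:
  assumes "(a, f) \<in> frac_pairs P"
  shows "\<ominus>\<^bsub>R\<^esub> fraction I P a f = fraction I P (- a) f"
proof (rule minus_equality)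
  show "fraction I P (- a) f \<oplus>\<^bsub>R\<^esub> fraction I P a f = \<zero>\<^bsub>R\<^esub>"
    unfolding R_add[OF frac_pairs_uminus[OF assms] assms] R_zero
    by (rule fraction_eqI[OF frac_pairs_add[OF frac_pairs_uminus[OF assms] assms] const_pairs(1)]) simp
qed (use assms frac_pairs_uminus R_carrierI in auto)

lemma max_idealE:
  assumes "x \<in> max_ideal I P"
  obtains a f where "(a, f) \<in> frac_pairs P" "x = fraction I P a f" "a \<in> P"
  using assms unfolding max_ideal_def by blast

sublocale M: ideal "max_ideal I P" R
proof (rule idealI[OF ring_axioms])
  show "subgroup (max_ideal I P) (add_monoid R)"
  proof (rule group.subgroupI[OF a_group])
    show "max_ideal I P \<subseteq> carrier (add_monoid R)"
      by (auto elim!: max_idealE intro: R_carrierI)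
    show "max_ideal I P \<noteq> {}"
      using fraction_in_max_ideal[OF const_pairs(1)] P_closed(1) by blast
    show "inv\<^bsub>add_monoid R\<^esub> a \<in> max_ideal I P" if "a \<in> max_ideal I P" for a
      using that unfolding a_inv_def[symmetric]
      by (auto elim!: max_idealE simp: uminus_fraction fraction_in_max_ideal frac_pairs_uminus)
         (metis P_closed(3) mult_minus1)
    show "a \<otimes>\<^bsub>add_monoid R\<^esub> b \<in> max_ideal I P" if "a \<in> max_ideal I P" "b \<in> max_ideal I P" for a b
      using that
      by (auto elim!: max_idealE simp: R_add fraction_in_max_ideal frac_pairs_add intro!: P_closed)
  qed
  show "x \<otimes>\<^bsub>R\<^esub> a \<in> max_ideal I P" "a \<otimes>\<^bsub>R\<^esub> x \<in> max_ideal I P"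
    if "a \<in> max_ideal I P" "x \<in> carrier R" for a x
    using that
    by (auto elim!: max_idealE R_carrierE simp: R_mult fraction_in_max_ideal frac_pairs_mult intro: P_closed)
qed

sublocale cring R
proof (intro cring.intro ring_axioms comm_monoid.intro comm_monoid_axioms.intro monoid_axioms)
  show "x \<otimes>\<^bsub>R\<^esub> y = y \<otimes>\<^bsub>R\<^esub> x" if "x \<in> carrier R" "y \<in> carrier R" for x y
    using that by (auto elim!: R_carrierE simp: R_mult mult.commute)
qed

lemma frac_pairs_power: "(a, f) \<in> frac_pairs P \<Longrightarrow> (a ^ n, f ^ n) \<in> frac_pairs P"
  by (induction n) (auto intro: frac_pairs_mult const_pairs)

lemma R_pow:
  assumes "(a, f) \<in> frac_pairs P"
  shows "fraction I P a f [^]\<^bsub>R\<^esub> (n::nat) = fraction I P (a ^ n) (f ^ n)"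
proof (induction n)
  case 0
  then show ?case by (simp add: R_one)
next
  case (Suc n)
  then show ?case using R_mult[OF frac_pairs_power[OF assms] assms] by (simp add: mult.commute)
qed

lemma pow_not_in_max_ideal:
  assumes "x \<in> carrier R" "x \<notin> max_ideal I P"
  shows "x [^]\<^bsub>R\<^esub> (n::nat) \<notin> max_ideal I P"
proof -
  obtain a f where af: "(a, f) \<in> frac_pairs P" "x = fraction I P a f" using R_carrierE[OF assms(1)] .
  have "a \<notin> P" using fraction_in_max_ideal[OF af(1)] assms(2) af(2) by blast
  then have "a ^ n \<notin> P" by (induction n) (auto simp: P_prime)
  then show ?thesis unfolding af(2) R_pow[OF af(1)] fraction_in_max_ideal[OF frac_pairs_power[OF af(1)]] .
qed

section \<open>The residue field described by fractions\<close>

definition cls where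
  "cls a f = residue_class I P (fraction I P a f)"

lemma residue_class_carrier:
  "x \<in> carrier R \<Longrightarrow> residue_class I P x \<in> carrier (residue_field I P)"
  using M.rcos_ring_hom unfolding residue_class_def residue_field_def ring_hom_def by auto

lemma residue_class_hom:
  assumes "x \<in> carrier R" "y \<in> carrier R"
  shows "residue_class I P (x \<otimes>\<^bsub>R\<^esub> y) = residue_class I P x \<otimes>\<^bsub>residue_field I P\<^esub> residue_class I P y"
    "residue_class I P (x \<oplus>\<^bsub>R\<^esub> y) = residue_class I P x \<oplus>\<^bsub>residue_field I P\<^esub> residue_class I P y"
  using assms M.rcos_ring_hom unfolding residue_class_def residue_field_def ring_hom_def by auto

lemma cls_mult:
  assumes "(a, f) \<in> frac_pairs P" "(b, g) \<in> frac_pairs P"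
  shows "cls a f \<otimes>\<^bsub>residue_field I P\<^esub> cls b g = cls (a * b) (f * g)"
  unfolding cls_def using residue_class_hom(1)[OF R_carrierI R_carrierI] assms R_mult by metis

lemma cls_add:
  assumes "(a, f) \<in> frac_pairs P" "(b, g) \<in> frac_pairs P"
  shows "cls a f \<oplus>\<^bsub>residue_field I P\<^esub> cls b g = cls (a * g + b * f) (f * g)"
  unfolding cls_def using residue_class_hom(2)[OF R_carrierI R_carrierI] assms R_add by metis

lemma residue_carrier: "carrier (residue_field I P) = {cls a f | a f. (a, f) \<in> frac_pairs P}"
  unfolding residue_field_def FactRing_simps(1) cls_def residue_class_def A_RCOSETS_def'
  by (auto simp: R_carrier)

text \<open>The difference of the fractions is (a g - b f) / (f g), and equality of classes means
  that its numerator is in \<open>P\<close>. The multiplier of \<open>frac_eq\<close> has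
  disappeared because \<open>P\<close> is prime.\<close>

lemma cls_eq_iff:
  assumes x: "(a, f) \<in> frac_pairs P" and y: "(b, g) \<in> frac_pairs P"
  shows "cls a f = cls b g \<longleftrightarrow> a * g - b * f \<in> P"
proof -
  have "cls a f = cls b g \<longleftrightarrow> fraction I P a f \<in> max_ideal I P +>\<^bsub>R\<^esub> fraction I P b g"
    unfolding cls_def residue_class_def
    using M.a_rcos_self[OF R_carrierI[OF x]] a_repr_independence[OF _ R_carrierI[OF y] M.a_subgroup] by metis
  also have "\<dots> \<longleftrightarrow> (\<exists>i\<in>max_ideal I P. fraction I P a f = i \<oplus>\<^bsub>R\<^esub> fraction I P b g)"
    unfolding a_r_coset_def' by auto
  also have "\<dots> \<longleftrightarrow> a * g - b * f \<in> P"
  proof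
    assume "\<exists>i\<in>max_ideal I P. fraction I P a f = i \<oplus>\<^bsub>R\<^esub> fraction I P b g"
    then obtain c h where c: "(c, h) \<in> frac_pairs P" "c \<in> P"
        "fraction I P a f = fraction I P (c * g + b * h) (h * g)"
      using R_add y by (metis max_idealE)
    then have "frac_eq (a, f) (c * g + b * h, h * g)"
      using fraction_eq_iff x frac_pairs_add[OF c(1) y] by blast
    then obtain k where k: "k \<notin> P" "k * (a * (h * g) - (c * g + b * h) * f) \<in> P"
      using I_sub_P unfolding frac_eq_def by auto
    then have "a * (h * g) - (c * g + b * h) * f \<in> P" using P_prime by blast
    then have "(a * (h * g) - (c * g + b * h) * f) + c * (g * f) \<in> P" using P_closed c(2) by blast
    moreover have "(a * (h * g) - (c * g + b * h) * f) + c * (g * f) = h * (a * g - b * f)"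
      by (simp add: algebra_simps)
    ultimately show "a * g - b * f \<in> P" using P_prime c(1) unfolding frac_pairs_def by auto
  next
    assume e: "a * g - b * f \<in> P"
    have fp: "(a * g - b * f, f * g) \<in> frac_pairs P"
      using frac_pairs_add[OF x frac_pairs_uminus[OF y]] by simp
    have "fraction I P a f = fraction I P (a * g - b * f) (f * g) \<oplus>\<^bsub>R\<^esub> fraction I P b g"
      unfolding R_add[OF fp y]
      by (rule fraction_eqI[OF x frac_pairs_add[OF fp y]]) (simp add: algebra_simps)
    then show "\<exists>i\<in>max_ideal I P. fraction I P a f = i \<oplus>\<^bsub>R\<^esub> fraction I P b g"
      using fraction_in_max_ideal[OF fp] e by blast
  qed
  finally show ?thesis .
qed

lemma cls_eq_zero_iff:
  assumes "(a, f) \<in> frac_pairs P"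
  shows "cls a f = \<zero>\<^bsub>residue_field I P\<^esub> \<longleftrightarrow> a \<in> P"
proof -
  have "\<zero>\<^bsub>residue_field I P\<^esub> = max_ideal I P"
    by (simp add: residue_field_def FactRing_def)
  also have "\<dots> = cls 0 1"
    unfolding cls_def residue_class_def R_zero[symmetric]
    using a_coset_add_zero[OF M.a_subset] by simp
  finally show ?thesis using cls_eq_iff[OF assms const_pairs(1)] by simp
qed

end

section \<open>Compactness of the analytification\<close>

lemma single_zero_forms: "Poly_Mapping.single 0 c \<in> forms 0"
  using forms_single[of 0 c] by simp

text \<open>A point of the analytification with \<open>\<bar>x\<^sub>j\<bar> \<le> \<bar>x\<^sub>i\<bar>\<close> for all \<open>j\<close> amounts to the seminorm
  \<open>f \<mapsto> \<bar>f / x\<^sub>i\<^sup>d\<bar>\<close> on the forms \<open>f\<close> of degree \<open>d\<close>. The values on the other polynomials are junk; they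
  are only confined to a compact interval.\<close>

definition form_seminorms ::
    "('k::field \<Rightarrow> real) \<Rightarrow> ('n::finite, 'k) mpol set \<Rightarrow> 'n \<Rightarrow> (('n, 'k) mpol \<Rightarrow> real) set" where
  "form_seminorms v I i =
     (\<Pi> f\<in>UNIV. {0..\<Sum>m\<in>Poly_Mapping.keys f. v (Poly_Mapping.lookup f m)}) \<inter>
     {N. \<forall>f\<in>\<Union>(range forms). \<forall>g\<in>\<Union>(range forms). N (f * g) = N f * N g} \<inter>
     {N. \<forall>d\<in>UNIV. \<forall>f\<in>forms d. \<forall>g\<in>forms d. N (f + g) \<le> max (N f) (N g)} \<inter>
     {N. \<forall>c\<in>UNIV. N (Poly_Mapping.single 0 c) = v c} \<inter>
     {N. \<forall>f\<in>I \<inter> \<Union>(range forms). N f = 0} \<inter>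
     {N. N (X_var i) = 1}"

lemma closed_Collect_Ball: "(\<And>p. p \<in> A \<Longrightarrow> closed {x. Q p x}) \<Longrightarrow> closed {x. \<forall>p\<in>A. Q p x}"
  by (simp add: Collect_ball_eq closed_INT)

lemma compact_form_seminorms:
  fixes v :: "'k::field \<Rightarrow> real" and I :: "('n::finite, 'k) mpol set"
  shows "compact (form_seminorms v I i)"
proof -
  have ev: "continuous_on UNIV (\<lambda>N :: ('n, 'k) mpol \<Rightarrow> real. N f)" for f
    by (rule continuous_on_product_coordinates)
  have "compactin (product_topology (\<lambda>_. euclidean) UNIV)
      (\<Pi>\<^sub>E f\<in>(UNIV :: ('n, 'k) mpol set). {0..\<Sum>m\<in>Poly_Mapping.keys f. v (Poly_Mapping.lookup f m)})"
    by (subst compactin_PiE) auto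
  then have "compact (\<Pi> f\<in>(UNIV :: ('n, 'k) mpol set). {0..\<Sum>m\<in>Poly_Mapping.keys f. v (Poly_Mapping.lookup f m)})"
    unfolding euclidean_product_topology by (simp add: PiE_UNIV_domain)
  moreover have "closed {N :: ('n, 'k) mpol \<Rightarrow> real. \<forall>f\<in>\<Union>(range forms). \<forall>g\<in>\<Union>(range forms). N (f * g) = N f * N g}"
    by (intro closed_Collect_Ball closed_Collect_eq continuous_intros ev)
  moreover have "closed {N :: ('n, 'k) mpol \<Rightarrow> real. \<forall>d\<in>UNIV. \<forall>f\<in>forms d. \<forall>g\<in>forms d. N (f + g) \<le> max (N f) (N g)}"
    by (intro closed_Collect_Ball closed_Collect_le continuous_intros ev)
  moreover have "closed {N :: ('n, 'k) mpol \<Rightarrow> real. \<forall>c\<in>UNIV. N (Poly_Mapping.single 0 c) = v c}"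
    by (intro closed_Collect_Ball closed_Collect_eq continuous_intros ev)
  moreover have "closed {N :: ('n, 'k) mpol \<Rightarrow> real. \<forall>f\<in>I \<inter> \<Union>(range forms). N f = 0}"
    by (intro closed_Collect_Ball closed_Collect_eq continuous_intros ev)
  moreover have "closed {N :: ('n, 'k) mpol \<Rightarrow> real. N (X_var i) = 1}"
    by (intro closed_Collect_eq continuous_intros ev)
  ultimately show ?thesis unfolding form_seminorms_def by (intro compact_Int_closed)
qed

text \<open>The kernel of the seminorm, read off from homogeneous components because the values of
  \<open>N\<close> off the forms are meaningless. It becomes the underlying scheme point.\<close>

definition null_ideal :: "(('n::finite, 'k::field) mpol \<Rightarrow> real) \<Rightarrow> ('n, 'k) mpol set" where
  "null_ideal N = {p. \<forall>d. N (hcomp d p) = 0}"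

text \<open>The absolute value N a / N f on the residue field. The choice of a representative is
  harmless by \<open>ratio_eq\<close>, and the restriction matches the extensional absolute values
  in \<open>analytification\<close>.\<close>

definition seminorm_value where
  "seminorm_value I N = (\<lambda>A\<in>carrier (residue_field I (null_ideal N)).
     SOME r. \<exists>a f. (a, f) \<in> frac_pairs (null_ideal N) \<and>
       A = residue_class I (null_ideal N) (fraction I (null_ideal N) a f) \<and> r = N a / N f)"

definition seminorm_point ::
    "('n::finite, 'k::field) mpol set \<Rightarrow> (('n, 'k) mpol \<Rightarrow> real) \<Rightarrow> ('n, 'k) an_point" where
  "seminorm_point I N = (null_ideal N, seminorm_value I N)"

section \<open>Seminorms on forms give points of the analytification\<close>

locale valued =
  fixes v :: "'k::field \<Rightarrow> real" and I :: "('n::finite, 'k) mpol set"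
  assumes na: "na_absolute_value ring_of_type_algebra v" and hom: "homogeneous_ideal I"
begin

lemma v_nonneg: "0 \<le> v x" and v_zero_iff: "v x = 0 \<longleftrightarrow> x = 0"
  and v_mult: "v (x * y) = v x * v y" and v_add: "v (x + y) \<le> max (v x) (v y)"
  using na unfolding na_absolute_value_def by (auto simp: ring_of_type_algebra_def)

lemma v_one: "v 1 = 1"
  using v_mult[of 1 1] v_zero_iff[of 1] by simp

lemma v_uminus_one: "v (- 1) = 1"
proof -
  have "v (-1) * v (-1) = 1" using v_mult[of "-1" "-1"] v_one by simp
  then show ?thesis using v_nonneg[of "-1"] by (metis abs_of_nonneg abs_square_eq_1 power2_eq_square)
qed

lemma ideal_I: "ideal I ring_of_type_algebra"
  using hom unfolding homogeneous_ideal_def by blast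

end

locale form_seminorm = valued v I
  for v :: "'k::field \<Rightarrow> real" and I :: "('n::finite, 'k) mpol set" +
  fixes N :: "('n, 'k) mpol \<Rightarrow> real" and i :: 'n
  assumes N_in: "N \<in> form_seminorms v I i"
begin

lemma N_nonneg: "0 \<le> N f"
  using N_in unfolding form_seminorms_def by auto

lemma N_mult: "f \<in> forms d \<Longrightarrow> g \<in> forms e \<Longrightarrow> N (f * g) = N f * N g"
  using N_in unfolding form_seminorms_def by blast

lemma N_add: "f \<in> forms d \<Longrightarrow> g \<in> forms d \<Longrightarrow> N (f + g) \<le> max (N f) (N g)"
  using N_in unfolding form_seminorms_def by blast

lemma N_const: "N (Poly_Mapping.single 0 c) = v c"
  using N_in unfolding form_seminorms_def by blast

lemma N_I: "f \<in> I \<Longrightarrow> f \<in> forms d \<Longrightarrow> N f = 0"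
  using N_in unfolding form_seminorms_def by blast

lemma N_X: "N (X_var i) = 1"
  using N_in unfolding form_seminorms_def by blast

lemma N_0: "N 0 = 0" and N_1: "N 1 = 1"
  using N_const[of 0] N_const[of 1] v_zero_iff v_one by simp_all

lemma N_uminus: "f \<in> forms d \<Longrightarrow> N (- f) = N f"
proof -
  assume f: "f \<in> forms d"
  have "- f = Poly_Mapping.single 0 (-1) * f"
    by (simp add: single_uminus)
  then show ?thesis using N_mult[OF single_zero_forms f] N_const v_uminus_one by simp
qed

lemma null_ideal_form: "f \<in> forms d \<Longrightarrow> f \<in> null_ideal N \<longleftrightarrow> N f = 0"
  unfolding null_ideal_def by (auto simp: hcomp_of_form N_0)

lemma N_add_zero: "f \<in> forms d \<Longrightarrow> g \<in> forms d \<Longrightarrow> N f = 0 \<Longrightarrow> N g = 0 \<Longrightarrow> N (f + g) = 0"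
  using N_add[of f d g] N_nonneg[of "f + g"] by simp

lemma N_sum_zero:
  "(\<And>x. x \<in> A \<Longrightarrow> f x \<in> forms d \<and> N (f x) = 0) \<Longrightarrow> N (sum f A) = 0"
  by (induction A rule: infinite_finite_induct) (auto simp: N_0 intro!: N_add_zero forms_sum)

lemma ideal_null: "ideal (null_ideal N) ring_of_type_algebra"
  unfolding ideal_ring_of_type_iff
proof (intro conjI ballI allI)
  show "0 \<in> null_ideal N" by (simp add: null_ideal_def N_0)
  show "a + b \<in> null_ideal N" if "a \<in> null_ideal N" "b \<in> null_ideal N" for a b
    using that by (auto simp: null_ideal_def hcomp_add intro: N_add_zero hcomp_forms)
  show "r * a \<in> null_ideal N" if "a \<in> null_ideal N" for a r
    unfolding null_ideal_def mem_Collect_eq hcomp_mult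
  proof (intro allI N_sum_zero conjI)
    fix d x y
    show "(if d = x + y then hcomp x r * hcomp y a else 0) \<in> forms d"
      by (auto intro: forms_mult hcomp_forms forms_zero)
    show "N (if d = x + y then hcomp x r * hcomp y a else 0) = 0"
      using that N_mult[OF hcomp_forms hcomp_forms] by (auto simp: null_ideal_def N_0)
    then show "(\<Sum>j\<le>mbound a. if d = x + j then hcomp x r * hcomp j a else 0) \<in> forms d"
      by (intro forms_sum) (auto intro: forms_mult hcomp_forms forms_zero)
  qed
qed

lemma homogeneous_null: "homogeneous_ideal (null_ideal N)"
  unfolding homogeneous_ideal_iff
proof (intro conjI ideal_null)
  show "\<forall>p\<in>null_ideal N. \<forall>d. hcomp d p \<in> null_ideal N"
    by (auto simp: null_ideal_def hcomp_of_form[OF hcomp_forms] N_0)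
qed

lemma hcomp_null_iff: "hcomp d p \<in> null_ideal N \<longleftrightarrow> N (hcomp d p) = 0"
  by (rule null_ideal_form[OF hcomp_forms])

text \<open>Multiplicativity is available for forms only. Take the lowest components of p and q
  outside the kernel, in degrees d and e. In the component of p q of degree d + e, every other term
  has a factor of lower degree, hence in the kernel; so the product of these two forms would also
  lie in the kernel.\<close>

lemma null_prime:
  assumes pq: "p * q \<in> null_ideal N"
  shows "p \<in> null_ideal N \<or> q \<in> null_ideal N"
proof (rule ccontr)
  assume "\<not> ?thesis"
  then have ex: "\<exists>d. hcomp d p \<notin> null_ideal N" "\<exists>d. hcomp d q \<notin> null_ideal N"
    unfolding hcomp_null_iff by (auto simp: null_ideal_def)
  define d where "d = (LEAST d. hcomp d p \<notin> null_ideal N)"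
  define e where "e = (LEAST d. hcomp d q \<notin> null_ideal N)"
  have d: "hcomp d p \<notin> null_ideal N" "\<And>j. j < d \<Longrightarrow> hcomp j p \<in> null_ideal N"
    unfolding d_def using LeastI_ex[OF ex(1)] not_less_Least by auto
  have e: "hcomp e q \<notin> null_ideal N" "\<And>j. j < e \<Longrightarrow> hcomp j q \<in> null_ideal N"
    unfolding e_def using LeastI_ex[OF ex(2)] not_less_Least by auto
  have z: "0 \<in> null_ideal N" using ideal_null unfolding ideal_ring_of_type_iff by blast
  have db: "d \<le> mbound p" "e \<le> mbound q"
    using d(1) e(1) hcomp_eq_0[of p d] hcomp_eq_0[of q e] z by (metis not_le)+
  let ?t = "\<lambda>(k, l). if d + e = k + l then hcomp k p * hcomp l q else 0"
  let ?S = "{..mbound p} \<times> {..mbound q}"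
  have "(\<Sum>x\<in>?S. ?t x) = hcomp (d + e) (p * q)"
    by (simp add: hcomp_mult sum.cartesian_product)
  also have "\<dots> \<in> null_ideal N" using pq unfolding hcomp_null_iff by (simp add: null_ideal_def)
  finally have "(\<Sum>x\<in>?S. ?t x) \<in> null_ideal N" .
  moreover have "(\<Sum>x\<in>?S. ?t x) = ?t (d, e) + (\<Sum>x\<in>?S - {(d, e)}. ?t x)"
    using db by (intro sum.remove) auto
  moreover have "(\<Sum>x\<in>?S - {(d, e)}. ?t x) \<in> null_ideal N"
  proof (rule ideal_sum[OF ideal_null])
    fix x assume "x \<in> ?S - {(d, e)}"
    then obtain k l where x: "x = (k, l)" "(k, l) \<noteq> (d, e)" by (cases x) auto
    show "?t x \<in> null_ideal N"
    proof (cases "d + e = k + l")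
      case True
      then have "k < d \<or> l < e" using x(2) by auto
      then have "hcomp k p \<in> null_ideal N \<or> hcomp l q \<in> null_ideal N" using d(2) e(2) by blast
      then have "hcomp k p * hcomp l q \<in> null_ideal N"
        using ideal_null unfolding ideal_ring_of_type_iff by (metis mult.commute)
      then show ?thesis using True x(1) by simp
    qed (use z x in auto)
  qed
  ultimately have "?t (d, e) \<in> null_ideal N"
    using ideal_diff[OF ideal_null] by (metis (no_types, lifting) add_diff_cancel_right')
  then have "N (hcomp d p * hcomp e q) = 0"
    using null_ideal_form[OF forms_mult[OF hcomp_forms hcomp_forms]] by simp
  then show False
    using N_mult[OF hcomp_forms hcomp_forms] d(1) e(1) unfolding hcomp_null_iff by simp
qed

text \<open>The normalisation N (x_i) = 1 keeps \<open>X_var i\<close> outside the kernel, so the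
  irrelevant ideal is not contained in it.\<close>

lemma null_Proj: "null_ideal N \<in> Proj I"
  unfolding Proj_def
proof (intro CollectI conjI)
  show "primeideal (null_ideal N) ring_of_type_algebra"
    unfolding primeideal_ring_of_type_iff
    using ideal_null null_prime null_ideal_form[OF forms_one] N_1 by auto
  show "homogeneous_ideal (null_ideal N)" by (rule homogeneous_null)
  show "I \<subseteq> null_ideal N"
    using hom unfolding homogeneous_ideal_iff null_ideal_def by (auto intro: N_I hcomp_forms)
  show "\<not> (\<Union>d\<in>{1..}. forms d) \<subseteq> null_ideal N"
    using X_var_forms[of i] null_ideal_form[OF X_var_forms, of i] N_X by auto
qed

sublocale scheme_point I "null_ideal N"
  by (rule scheme_point.intro[OF ideal_I null_Proj])

lemma frac_pairs_N: "(a, f) \<in> frac_pairs (null_ideal N) \<Longrightarrow> N f > 0"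
  using null_ideal_form N_nonneg[of f] unfolding frac_pairs_def by (force simp: less_le)

text \<open>Equal classes mean N (a g - b f) = 0. The ultrametric inequality, used in both
  directions, then gives N (a g) = N (b f).\<close>

lemma ratio_eq:
  assumes "(a, f) \<in> frac_pairs (null_ideal N)" "(b, g) \<in> frac_pairs (null_ideal N)" "cls a f = cls b g"
  shows "N a / N f = N b / N g"
proof -
  obtain d where d: "a \<in> forms d" "f \<in> forms d" using frac_pairsE[OF assms(1)] by blast
  obtain e where e: "b \<in> forms e" "g \<in> forms e" using frac_pairsE[OF assms(2)] by blast
  have fo: "a * g \<in> forms (d + e)" "b * f \<in> forms (d + e)"
    using forms_mult[OF d(1) e(2)] forms_mult[OF e(1) d(2)] by (simp_all add: add.commute)
  have "a * g - b * f \<in> null_ideal N" using cls_eq_iff[OF assms(1,2)] assms(3) by blast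
  then have z: "N (a * g - b * f) = 0" using null_ideal_form[OF forms_diff[OF fo]] by blast
  then have z': "N (b * f - a * g) = 0" using N_uminus[OF forms_diff[OF fo]] by simp
  have "N (a * g) \<le> N (b * f)"
    using N_add[OF fo(2) forms_diff[OF fo]] z N_nonneg[of "b * f"] by simp
  moreover have "N (b * f) \<le> N (a * g)"
    using N_add[OF fo(1) forms_diff[OF fo(2,1)]] z' N_nonneg[of "a * g"] by simp
  ultimately have "N a * N g = N b * N f"
    using N_mult[OF d(1) e(2)] N_mult[OF e(1) d(2)] by simp
  then show ?thesis using frac_pairs_N[OF assms(1)] frac_pairs_N[OF assms(2)]
    by (simp add: field_simps)
qed

lemma seminorm_value_cls:
  assumes "(a, f) \<in> frac_pairs (null_ideal N)"
  shows "seminorm_value I N (cls a f) = N a / N f"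
proof -
  have carr: "cls a f \<in> carrier (residue_field I (null_ideal N))"
    unfolding residue_carrier using assms by blast
  let ?Q = "\<lambda>r. \<exists>b g. (b, g) \<in> frac_pairs (null_ideal N) \<and> cls a f = cls b g \<and> r = N b / N g"
  have "?Q (SOME r. ?Q r)" by (rule someI[of ?Q "N a / N f"]) (use assms in blast)
  then have "(SOME r. ?Q r) = N a / N f" using ratio_eq[OF assms] by auto
  then show ?thesis using carr unfolding seminorm_value_def cls_def by simp
qed

lemma seminorm_point_in: "seminorm_point I N \<in> analytification v I"
proof -
  let ?P = "null_ideal N" and ?w = "seminorm_value I N"
  have 1: "0 \<le> ?w (cls a f) \<and> (?w (cls a f) = 0 \<longleftrightarrow> cls a f = \<zero>\<^bsub>residue_field I ?P\<^esub>)"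
    if af: "(a, f) \<in> frac_pairs ?P" for a f
  proof (intro conjI)
      show "0 \<le> ?w (cls a f)" unfolding seminorm_value_cls[OF af] using N_nonneg by simp
      obtain d where "a \<in> forms d" using frac_pairsE[OF af] by blast
      then show "?w (cls a f) = 0 \<longleftrightarrow> cls a f = \<zero>\<^bsub>residue_field I ?P\<^esub>"
        unfolding seminorm_value_cls[OF af] cls_eq_zero_iff[OF af]
        using null_ideal_form frac_pairs_N[OF af] by auto
  qed
  have 2: "?w (cls a f \<otimes>\<^bsub>residue_field I ?P\<^esub> cls b g) = ?w (cls a f) * ?w (cls b g) \<and>
        ?w (cls a f \<oplus>\<^bsub>residue_field I ?P\<^esub> cls b g) \<le> max (?w (cls a f)) (?w (cls b g))"
    if af: "(a, f) \<in> frac_pairs ?P" and bg: "(b, g) \<in> frac_pairs ?P" for a f b g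
  proof -
    obtain d where d: "a \<in> forms d" "f \<in> forms d" using frac_pairsE[OF af] by blast
    obtain e where e: "b \<in> forms e" "g \<in> forms e" using frac_pairsE[OF bg] by blast
    have pos: "N f > 0" "N g > 0" using frac_pairs_N af bg by auto
    have "N (a * g + b * f) \<le> max (N (a * g)) (N (b * f))"
      by (rule N_add[OF forms_mult[OF d(1) e(2)]])
         (use forms_mult[OF e(1) d(2)] in \<open>simp add: add.commute\<close>)
    also have "\<dots> = max (N a * N g) (N b * N f)"
      using N_mult[OF d(1) e(2)] N_mult[OF e(1) d(2)] by simp
    finally have "N (a * g + b * f) / (N f * N g) \<le> max (N a * N g) (N b * N f) / (N f * N g)"
      using pos by (intro divide_right_mono) auto
    also have "\<dots> = max (N a / N f) (N b / N g)"
      using pos by (auto simp: max_def field_simps)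
    finally have "N (a * g + b * f) / N (f * g) \<le> max (N a / N f) (N b / N g)"
      using N_mult[OF d(2) e(2)] by simp
    then show ?thesis
      unfolding cls_mult[OF af bg] cls_add[OF af bg] seminorm_value_cls[OF af]
        seminorm_value_cls[OF bg] seminorm_value_cls[OF frac_pairs_mult[OF af bg]]
        seminorm_value_cls[OF frac_pairs_add[OF af bg]]
      using N_mult[OF d(1) e(1)] N_mult[OF d(2) e(2)] by simp
  qed
  have "na_absolute_value (residue_field I ?P) ?w"
    unfolding na_absolute_value_def
  proof (rule conjI; intro ballI)
    fix A assume A: "A \<in> carrier (residue_field I ?P)"
    obtain a f where af: "(a, f) \<in> frac_pairs ?P" "A = cls a f"
      using A unfolding residue_carrier by blast
    show "0 \<le> ?w A \<and> (?w A = 0 \<longleftrightarrow> A = \<zero>\<^bsub>residue_field I ?P\<^esub>)"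
      unfolding af(2) by (rule 1[OF af(1)])
    fix B assume B: "B \<in> carrier (residue_field I ?P)"
    obtain b g where bg: "(b, g) \<in> frac_pairs ?P" "B = cls b g"
      using B unfolding residue_carrier by blast
    show "?w (A \<otimes>\<^bsub>residue_field I ?P\<^esub> B) = ?w A * ?w B \<and>
        ?w (A \<oplus>\<^bsub>residue_field I ?P\<^esub> B) \<le> max (?w A) (?w B)"
      unfolding af(2) bg(2) by (rule 2[OF af(1) bg(1)])
  qed
  moreover have "?w (residue_class I ?P (fraction I ?P (Poly_Mapping.single 0 c) 1)) = v c" for c
    using seminorm_value_cls[OF frac_pairs_const[OF single_zero_forms], of c] N_const N_1
    unfolding cls_def by simp
  ultimately show ?thesis
    unfolding analytification_def seminorm_point_def using null_Proj
    by (auto simp: seminorm_value_def)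
qed

end

section \<open>Points of the analytification give seminorms on forms\<close>

context valued
begin

context
  fixes P w
  assumes Pw: "(P, w) \<in> analytification v I"
begin

interpretation scheme_point I P
  using Pw by (intro scheme_point.intro ideal_I) (auto simp: analytification_def)

definition val where
  "val a f = w (cls a f)"

lemma w_na: "na_absolute_value (residue_field I P) w"
  and w_const: "w (cls (Poly_Mapping.single 0 c) 1) = v c"
  and w_ext: "w \<in> extensional (carrier (residue_field I P))"
  using Pw unfolding analytification_def cls_def by auto

lemma cls_carrier: "(a, f) \<in> frac_pairs P \<Longrightarrow> cls a f \<in> carrier (residue_field I P)"
  unfolding residue_carrier by blast

lemmas w_zero = w_na[unfolded na_absolute_value_def, THEN conjunct1, rule_format, OF cls_carrier]
lemmas w_ops = w_na[unfolded na_absolute_value_def, THEN conjunct2, rule_format, OF cls_carrier cls_carrier]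

lemma val_nonneg: "(a, f) \<in> frac_pairs P \<Longrightarrow> 0 \<le> val a f"
  using w_zero[of a f] unfolding val_def by simp

lemma val_zero_iff: "(a, f) \<in> frac_pairs P \<Longrightarrow> val a f = 0 \<longleftrightarrow> a \<in> P"
  using w_zero[of a f] cls_eq_zero_iff[of a f] unfolding val_def by simp

lemma val_mult:
  "(a, f) \<in> frac_pairs P \<Longrightarrow> (b, g) \<in> frac_pairs P \<Longrightarrow> val (a * b) (f * g) = val a f * val b g"
  using w_ops[of a f b g] cls_mult[of a f b g] unfolding val_def by simp

lemma val_add:
  "(a, f) \<in> frac_pairs P \<Longrightarrow> (b, g) \<in> frac_pairs P \<Longrightarrow>
     val (a * g + b * f) (f * g) \<le> max (val a f) (val b g)"
  using w_ops[of a f b g] cls_add[of a f b g] unfolding val_def by simp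

lemma val_cong:
  assumes "(a, f) \<in> frac_pairs P" "(b, g) \<in> frac_pairs P" "a * g = b * f"
  shows "val a f = val b g"
proof -
  have "cls a f = cls b g" unfolding cls_eq_iff[OF assms(1,2)] assms(3) by (simp add: P_closed)
  then show ?thesis unfolding val_def by simp
qed

lemma val_const: "val (Poly_Mapping.single 0 c) 1 = v c"
  unfolding val_def by (rule w_const)

lemma val_self: "(f, f) \<in> frac_pairs P \<Longrightarrow> val f f = 1"
  using val_cong[of f f "Poly_Mapping.single 0 1" 1] val_const[of 1] v_one const_pairs(2) by simp

text \<open>Dividing by one variable \<open>X_var k\<close> outside \<open>P\<close> makes the
  variables comparable; the index i maximises |x_j / x_k|. This places each point in one of finitely
  many compact pieces.\<close>

lemma exists_maximal_variable:
  "\<exists>i. X_var i \<notin> P \<and> (\<forall>j. val (X_var j) (X_var i) \<le> 1)"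
proof -
  obtain k where k: "X_var k \<notin> P"
    using not_in_homogeneous_prime[OF _ ideal_P] P unfolding Proj_def by blast
  have fp: "X_var i \<notin> P \<Longrightarrow> (X_var j, X_var i) \<in> frac_pairs P" for i j :: 'n
    by (rule frac_pairsI[OF X_var_forms X_var_forms])
  define M where "M = Max (range (\<lambda>j. val (X_var j) (X_var k)))"
  have M: "val (X_var j) (X_var k) \<le> M" for j unfolding M_def by (rule Max_ge) auto
  have "M \<in> range (\<lambda>j. val (X_var j) (X_var k))" unfolding M_def by (rule Max_in) auto
  then obtain i where i: "M = val (X_var i) (X_var k)" by blast
  \<comment> \<open>The variable \<open>X_var k\<close> itself contributes the value 1. Hence the
    maximiser does not vanish at the point and may be used as a denominator.\<close>
  have "M \<ge> 1" using M[of k] val_self[OF fp[OF k]] by simp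
  then have iP: "X_var i \<notin> P" using val_zero_iff[OF fp[OF k], of i] i by auto
  have "val (X_var j) (X_var i) \<le> 1" for j
  proof -
    have "val (X_var j) (X_var i) * M = val (X_var j * X_var i) (X_var i * X_var k)"
      unfolding i by (rule val_mult[symmetric, OF fp[OF iP] fp[OF k]])
    also have "\<dots> = val (X_var j) (X_var k)"
      by (rule val_cong[OF frac_pairs_mult[OF fp[OF iP] fp[OF k]] fp[OF k]]) (simp add: mult_ac)
    finally have "val (X_var j) (X_var i) * M \<le> 1 * M" using M[of j] by simp
    from mult_right_le_imp_le[OF this] show ?thesis using \<open>M \<ge> 1\<close> by simp
  qed
  then show ?thesis using iP by blast
qed

context
  fixes i :: 'n
  assumes iP: "X_var i \<notin> P" and le1: "\<And>j. val (X_var j) (X_var i) \<le> 1"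
begin

text \<open>The seminorm f \<mapsto> |f / x_i^d|. The degree is ambiguous only for f = 0, where
  every choice gives 0; the value 0 off the forms stays within the interval prescribed by
  \<open>form_seminorms\<close>.\<close>

definition pnorm where
  "pnorm f = (if f \<in> \<Union>(range forms) then val f (X_var i ^ (SOME d. f \<in> forms d)) else 0)"

lemma power_form: "X_var i ^ d \<in> forms d"
  using forms_power[OF X_var_forms, of i d] by simp

lemma power_not_P: "X_var i ^ d \<notin> P"
  by (induction d) (auto simp: P_prime iP)

lemma frac_pairs_X: "f \<in> forms d \<Longrightarrow> (f, X_var i ^ d) \<in> frac_pairs P"
  by (rule frac_pairsI[OF _ power_form power_not_P])

lemma pnorm_eq: "f \<in> forms d \<Longrightarrow> pnorm f = val f (X_var i ^ d)"
proof -
  assume f: "f \<in> forms d"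
  define e where "e = (SOME d. f \<in> forms d)"
  have e: "f \<in> forms e" unfolding e_def by (rule someI[of "\<lambda>d. f \<in> forms d", OF f])
  have "pnorm f = val f (X_var i ^ e)" using f unfolding pnorm_def e_def by auto
  also have "\<dots> = val f (X_var i ^ d)"
  proof (cases "f = 0")
    case True
    then show ?thesis using val_zero_iff frac_pairs_X[OF e] frac_pairs_X[OF f] P_closed(1) by metis
  next
    case False
    then show ?thesis using forms_degree_unique[OF e f] by simp
  qed
  finally show ?thesis .
qed

lemma pnorm_mult: "f \<in> forms d \<Longrightarrow> g \<in> forms e \<Longrightarrow> pnorm (f * g) = pnorm f * pnorm g"
  using pnorm_eq[OF forms_mult] pnorm_eq val_mult[OF frac_pairs_X frac_pairs_X] by (simp add: power_add)

lemma pnorm_add: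
  assumes "f \<in> forms d" "g \<in> forms d"
  shows "pnorm (f + g) \<le> max (pnorm f) (pnorm g)"
proof -
  have "pnorm (f + g) = val (f * X_var i ^ d + g * X_var i ^ d) (X_var i ^ d * X_var i ^ d)"
    unfolding pnorm_eq[OF forms_add[OF assms]]
    by (rule val_cong[OF frac_pairs_X[OF forms_add[OF assms]] frac_pairs_add[OF frac_pairs_X frac_pairs_X]])
       (use assms in \<open>auto simp: algebra_simps\<close>)
  then show ?thesis using val_add[OF frac_pairs_X[OF assms(1)] frac_pairs_X[OF assms(2)]] pnorm_eq assms by simp
qed

lemma pnorm_const: "pnorm (Poly_Mapping.single 0 c) = v c"
  using pnorm_eq[OF single_zero_forms] val_const by simp

lemma pnorm_zero_iff: "f \<in> forms d \<Longrightarrow> pnorm f = 0 \<longleftrightarrow> f \<in> P"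
  using pnorm_eq val_zero_iff[OF frac_pairs_X] by simp

lemma pnorm_nonneg: "0 \<le> pnorm f"
proof (cases "f \<in> \<Union>(range forms)")
  case True
  then obtain d where "f \<in> forms d" by blast
  then show ?thesis using pnorm_eq val_nonneg[OF frac_pairs_X] by simp
qed (simp add: pnorm_def)

text \<open>A variable is split off at each degree, and each contributes |x_j / x_i| \<le> 1. This
  is where the maximality of |x_i| is used.\<close>

lemma pnorm_monomial: "pnorm (Poly_Mapping.single m 1) \<le> 1"
proof (induction "mdeg m" arbitrary: m)
  case 0
  have "Poly_Mapping.lookup m i = 0" for i
    using 0 by (simp add: mdeg_def)
  then have "m = 0" by (intro poly_mapping_eqI) simp
  then show ?case using pnorm_const[of 1] v_one by simp
next
  case (Suc d)
  then obtain j where j: "Poly_Mapping.lookup m j \<noteq> 0" unfolding mdeg_def by fastforce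
  define m' where "m' = m - Poly_Mapping.single j 1"
  have m: "m = Poly_Mapping.single j 1 + m'"
    unfolding m'_def
    by (rule poly_mapping_eqI) (use j in \<open>auto simp: lookup_add lookup_minus lookup_single when_def\<close>)
  then have "mdeg m = 1 + mdeg m'" by simp
  then have "pnorm (Poly_Mapping.single m' 1) \<le> 1" using Suc by simp
  moreover have "Poly_Mapping.single m (1::'k) = X_var j * Poly_Mapping.single m' 1"
    unfolding m by (simp add: mult_single X_var_def)
  then have "pnorm (Poly_Mapping.single m 1) = pnorm (X_var j) * pnorm (Poly_Mapping.single m' 1)"
    using pnorm_mult[OF X_var_forms forms_single] by metis
  moreover have "pnorm (X_var j) \<le> 1" using pnorm_eq[OF X_var_forms, of j] le1[of j] by simp
  ultimately show ?case using pnorm_nonneg by (metis mult_le_one)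
qed

lemma pnorm_bound: "pnorm f \<le> (\<Sum>m\<in>Poly_Mapping.keys f. v (Poly_Mapping.lookup f m))"
proof (cases "f \<in> \<Union>(range forms)")
  case True
  then obtain d where d: "f \<in> forms d" by blast
  let ?t = "\<lambda>m. Poly_Mapping.single m (Poly_Mapping.lookup f m)"
  have t: "?t m \<in> forms d" if "m \<in> Poly_Mapping.keys f" for m
    using forms_single[of m] d that by (auto simp: forms_iff in_keys_iff)
  have tv: "pnorm (?t m) \<le> v (Poly_Mapping.lookup f m)" for m
  proof -
    have "?t m = Poly_Mapping.single 0 (Poly_Mapping.lookup f m) * Poly_Mapping.single m 1"
      by (simp add: mult_single)
    then have "pnorm (?t m) = v (Poly_Mapping.lookup f m) * pnorm (Poly_Mapping.single m 1)"
      using pnorm_mult[OF single_zero_forms forms_single] pnorm_const by metis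
    then show ?thesis using pnorm_monomial[of m] v_nonneg by (simp add: mult_left_le)
  qed
  have "pnorm (\<Sum>m\<in>S. ?t m) \<le> (\<Sum>m\<in>S. v (Poly_Mapping.lookup f m))"
    if "finite S" "S \<subseteq> Poly_Mapping.keys f" for S
    using that
  proof (induction S)
    case empty
    then show ?case using pnorm_const[of 0] v_zero_iff[of 0] by simp
  next
    case (insert m S)
    have "pnorm (?t m + (\<Sum>m\<in>S. ?t m)) \<le> max (pnorm (?t m)) (pnorm (\<Sum>m\<in>S. ?t m))"
      by (rule pnorm_add) (use insert t in \<open>auto intro!: forms_sum\<close>)
    also have "\<dots> \<le> pnorm (?t m) + pnorm (\<Sum>m\<in>S. ?t m)" using pnorm_nonneg by simp
    also have "\<dots> \<le> v (Poly_Mapping.lookup f m) + (\<Sum>m\<in>S. v (Poly_Mapping.lookup f m))"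
      using tv insert by (intro add_mono) auto
    finally show ?case using insert by simp
  qed
  from this[of "Poly_Mapping.keys f"] have "pnorm (\<Sum>m\<in>Poly_Mapping.keys f. ?t m) \<le> (\<Sum>m\<in>Poly_Mapping.keys f. v (Poly_Mapping.lookup f m))"
    by simp
  moreover have "(\<Sum>m\<in>Poly_Mapping.keys f. ?t m) = hcomp d f"
  proof -
    have "{m \<in> Poly_Mapping.keys f. mdeg m = d} = Poly_Mapping.keys f"
      using d unfolding forms_iff by (metis (mono_tags, lifting) Collect_cong Collect_mem_eq in_keys_iff)
    then show ?thesis unfolding hcomp_def by simp
  qed
  ultimately show ?thesis using hcomp_of_form[OF d, of d] by simp
next
  case False
  then have "pnorm f = 0" by (simp add: pnorm_def)
  then show ?thesis by (simp add: sum_nonneg v_nonneg)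
qed

lemma pnorm_in: "pnorm \<in> form_seminorms v I i"
proof -
  have "pnorm (X_var i) = 1"
    using pnorm_eq[OF X_var_forms, of i] val_self[of "X_var i"] frac_pairs_X[OF X_var_forms] by simp
  moreover have "pnorm f = 0" if "f \<in> I" "f \<in> forms d" for f d
    using pnorm_zero_iff[OF that(2)] I_sub_P that(1) by blast
  ultimately show ?thesis
    unfolding form_seminorms_def
    using pnorm_bound pnorm_nonneg pnorm_mult pnorm_add pnorm_const by (auto 0 3)
qed

lemma null_pnorm: "null_ideal pnorm = P"
proof -
  have "homogeneous_ideal P" using P unfolding Proj_def by blast
  then have "hcomp d p \<in> P" if "p \<in> P" for p d using that unfolding homogeneous_ideal_iff by blast
  moreover have "p \<in> P" if "\<forall>d. hcomp d p \<in> P" for p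
    using ideal_sum[OF ideal_P, of "{..mbound p}" "\<lambda>d. hcomp d p"] that sum_hcomp[of p "mbound p"] by simp
  ultimately show ?thesis
    unfolding null_ideal_def using pnorm_zero_iff[OF hcomp_forms] by blast
qed

text \<open>Both a and f are divided by the same power of x_i, which cancels in
  \<open>pnorm a / pnorm f\<close>. So the original absolute value is recovered, and the
  parametrisation by seminorms is surjective.\<close>

lemma seminorm_point_pnorm: "seminorm_point I pnorm = (P, w)"
proof -
  interpret fs: form_seminorm v I pnorm i
    by unfold_locales (rule pnorm_in)
  have "seminorm_value I pnorm = w"
  proof (rule extensionalityI[OF _ w_ext])
    show "seminorm_value I pnorm \<in> extensional (carrier (residue_field I P))"
      unfolding seminorm_value_def null_pnorm by simp
    fix A assume "A \<in> carrier (residue_field I P)"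
    then obtain a f where af: "(a, f) \<in> frac_pairs P" "A = cls a f" unfolding residue_carrier by blast
    obtain d where d: "a \<in> forms d" "f \<in> forms d" "f \<notin> P" using frac_pairsE[OF af(1)] .
    have "seminorm_value I pnorm A = pnorm a / pnorm f"
      using fs.seminorm_value_cls[of a f] af unfolding fs.cls_def cls_def null_pnorm by simp
    also have "pnorm a = val (a * f) (f * X_var i ^ d)"
      unfolding pnorm_eq[OF d(1)]
      by (rule val_cong[OF frac_pairs_X[OF d(1)] frac_pairs_mult[OF af(1) frac_pairs_X[OF d(2)]]]) (simp add: mult_ac)
    also have "\<dots> = val a f * pnorm f"
      using val_mult[OF af(1) frac_pairs_X[OF d(2)]] pnorm_eq[OF d(2)] by simp
    finally show "seminorm_value I pnorm A = w A"
      using pnorm_zero_iff[OF d(2)] d(3) unfolding val_def af(2) by simp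
  qed
  then show ?thesis unfolding seminorm_point_def null_pnorm by simp
qed

end

lemma exists_form_seminorm: "\<exists>i. \<exists>N\<in>form_seminorms v I i. (P, w) = seminorm_point I N"
  using exists_maximal_variable pnorm_in seminorm_point_pnorm by metis

end

section \<open>Continuity of the parametrisation and compactness\<close>

lemma form_seminormI: "N \<in> form_seminorms v I i \<Longrightarrow> form_seminorm v I N i"
  using valued_axioms by (simp add: form_seminorm_def form_seminorm_axioms_def)

lemma analytification_eq: "analytification v I = (\<Union>i. seminorm_point I ` form_seminorms v I i)"
  using exists_form_seminorm form_seminorm.seminorm_point_in[OF form_seminormI] by fastforce

text \<open>The constant form 1 lies in no prime, so its basic open set is all of
  \<open>Proj I\<close>.\<close>

lemma topspace_zariski: "topspace (zariski I) = Proj I"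
proof -
  let ?B = "{{P \<in> Proj I. f \<notin> P} |f. f \<in> (\<Union>d. forms d)}"
  have "P \<in> {P \<in> Proj I. 1 \<notin> P}" if "P \<in> Proj I" for P
    using scheme_point.P_prime(2)[OF scheme_point.intro[OF ideal_I that]] that by simp
  moreover have "{P \<in> Proj I. 1 \<notin> P} \<in> ?B"
    by (rule CollectI, rule exI[of _ 1]) (use forms_one in auto)
  ultimately have "Proj I \<subseteq> \<Union>?B" by (meson UnionI subsetI)
  moreover have "\<Union>?B \<subseteq> Proj I" by auto
  ultimately show ?thesis unfolding zariski_def topology_generated_by_topspace by simp
qed

lemma topspace_an_top: "topspace (an_top v I) = analytification v I"
proof -
  have "openin (zariski I) (Proj I)" using openin_topspace topspace_zariski by metis
  then have "openin (an_top v I) {x \<in> analytification v I. fst x \<in> Proj I}"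
    unfolding an_top_def by (intro topology_generated_by_Basis UnI1 CollectI exI[of _ "Proj I"] conjI refl)
  then have "{x \<in> analytification v I. fst x \<in> Proj I} \<subseteq> topspace (an_top v I)"
    by (rule openin_subset)
  moreover have "{x \<in> analytification v I. fst x \<in> Proj I} = analytification v I"
    unfolding analytification_def by auto
  ultimately show ?thesis unfolding an_top_def topology_generated_by_topspace by auto
qed

text \<open>The preimage of the basic open set of a form f is the locus N f \<noteq> 0, open in the
  product topology.\<close>

lemma continuous_map_null_ideal:
  "continuous_map (top_of_set (form_seminorms v I i)) (zariski I) null_ideal"
  unfolding zariski_def
proof (rule continuous_on_generated_topo)
  let ?K = "form_seminorms v I i"
  show "null_ideal ` topspace (top_of_set ?K) \<subseteq> \<Union>{{P \<in> Proj I. f \<notin> P} |f. f \<in> (\<Union>d. forms d)}"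
    using topspace_zariski form_seminorm.null_Proj[OF form_seminormI]
    unfolding zariski_def topology_generated_by_topspace by auto
  fix U assume "U \<in> {{P \<in> Proj I. f \<notin> P} |f. f \<in> (\<Union>d. forms d)}"
  then obtain f d where f: "f \<in> forms d" "U = {P \<in> Proj I. f \<notin> P}" by blast
  have "null_ideal -` U \<inter> topspace (top_of_set ?K) = ?K \<inter> {N. N f \<noteq> 0}"
    using f form_seminorm.null_Proj[OF form_seminormI] form_seminorm.null_ideal_form[OF form_seminormI]
    by auto
  moreover have "open {N :: ('n, 'k) mpol \<Rightarrow> real. N f \<noteq> 0}"
    by (intro open_Collect_neq continuous_on_product_coordinates continuous_intros)
  ultimately show "openin (top_of_set ?K) (null_ideal -` U \<inter> topspace (top_of_set ?K))"
    by (simp add: openin_open_Int)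
qed

lemma openin_preimage_zariski:
  assumes "openin (zariski I) U"
  shows "openin (top_of_set (form_seminorms v I i)) {N \<in> form_seminorms v I i. null_ideal N \<in> U}"
  using openin_continuous_map_preimage[OF continuous_map_null_ideal assms] by simp

text \<open>Locally a regular function is a fraction a / g, and its absolute value at the point of N
  is N a / N g, a continuous function of N where N g \<noteq> 0.\<close>

lemma continuous_map_seminorm_point:
  "continuous_map (top_of_set (form_seminorms v I i)) (an_top v I) (seminorm_point I)"
  unfolding an_top_def
proof (rule continuous_on_generated_topo)
  let ?K = "form_seminorms v I i"
  let ?A = "analytification v I"
  let ?B = "{{x \<in> ?A. fst x \<in> U} |U. openin (zariski I) U} \<union>
      {{x \<in> ?A. fst x \<in> U \<and> abs_at I f x \<in> W} |U f W.
        openin (zariski I) U \<and> f \<in> carrier (regular_functions I U) \<and> open W}"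
  have in_A: "seminorm_point I N \<in> ?A" if "N \<in> ?K" for N
    using analytification_eq that by blast
  have "\<Union>?B = ?A" using topspace_an_top unfolding an_top_def topology_generated_by_topspace .
  then show "seminorm_point I ` topspace (top_of_set ?K) \<subseteq> \<Union>?B" using in_A by auto
  fix S assume "S \<in> ?B"
  then consider U where "openin (zariski I) U" "S = {x \<in> ?A. fst x \<in> U}"
    | U f W where "openin (zariski I) U" "f \<in> carrier (regular_functions I U)" "open W"
        "S = {x \<in> ?A. fst x \<in> U \<and> abs_at I f x \<in> W}"
    by blast
  then show "openin (top_of_set ?K) (seminorm_point I -` S \<inter> topspace (top_of_set ?K))"
  proof cases
    case 1
    have "seminorm_point I -` S \<inter> topspace (top_of_set ?K) = {N \<in> ?K. null_ideal N \<in> U}"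
      using in_A unfolding 1 by (auto simp: seminorm_point_def)
    then show ?thesis using openin_preimage_zariski[OF 1(1)] by simp
  next
    case 2
    show ?thesis
    \<comment> \<open>The representation by a single fraction exists only locally, so openness is
      checked around one seminorm \<open>N0\<close>.\<close>
    proof (subst openin_subopen, intro ballI)
      fix N0 assume N0: "N0 \<in> seminorm_point I -` S \<inter> topspace (top_of_set ?K)"
      then have N0K: "N0 \<in> ?K" and N0U: "null_ideal N0 \<in> U"
        unfolding 2 by (auto simp: seminorm_point_def)
      obtain V a g where V: "openin (zariski I) V" "null_ideal N0 \<in> V" "V \<subseteq> U"
          "\<And>Q. Q \<in> V \<Longrightarrow> (a, g) \<in> frac_pairs Q \<and> f Q = fraction I Q a g"
      proof -
        have "\<exists>V a g. openin (zariski I) V \<and> null_ideal N0 \<in> V \<and> V \<subseteq> U \<and>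
            (\<forall>Q\<in>V. (a, g) \<in> frac_pairs Q \<and> f Q = fraction I Q a g)"
          using 2(2) N0U unfolding regular_functions_def by simp
        then show thesis using that by blast
      qed
      let ?O = "{N \<in> ?K. null_ideal N \<in> V}"
      have O: "openin (top_of_set ?K) ?O" by (rule openin_preimage_zariski[OF V(1)])
      have val: "abs_at I f (seminorm_point I N) = N a / N g" if "N \<in> ?O" for N
      proof -
        interpret form_seminorm v I N i using that by (intro form_seminormI) auto
        show ?thesis using seminorm_value_cls[of a g] V(4)[of "null_ideal N"] that
          unfolding abs_at_def seminorm_point_def cls_def by simp
      qed
      have pos: "N g \<noteq> 0" if "N \<in> ?O" for N
      proof -
        interpret form_seminorm v I N i using that by (intro form_seminormI) auto
        show ?thesis using frac_pairs_N[of a g] V(4)[of "null_ideal N"] that by auto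
      qed
      have "continuous_on ?O (\<lambda>N. N a / N g)"
        using pos
        by (intro continuous_intros continuous_on_subset[OF continuous_on_product_coordinates]) auto
      then have "openin (top_of_set ?O) (?O \<inter> (\<lambda>N. N a / N g) -` W)"
        using 2(3) continuous_openin_preimage_gen by blast
      then have "openin (top_of_set ?K) (?O \<inter> (\<lambda>N. N a / N g) -` W)"
        using O openin_trans by blast
      moreover have "N0 \<in> ?O \<inter> (\<lambda>N. N a / N g) -` W"
        using N0 N0K V(2) val[of N0] unfolding 2 by auto
      moreover have "?O \<inter> (\<lambda>N. N a / N g) -` W \<subseteq> seminorm_point I -` S \<inter> topspace (top_of_set ?K)"
        using in_A val V(3) unfolding 2 by (auto simp: seminorm_point_def)
      ultimately show "\<exists>T. openin (top_of_set ?K) T \<and> N0 \<in> T \<and>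
          T \<subseteq> seminorm_point I -` S \<inter> topspace (top_of_set ?K)" by blast
    qed
  qed
qed

theorem compact_analytification: "compact_space (an_top v I)"
proof -
  have "compactin (an_top v I) (seminorm_point I ` form_seminorms v I i)" for i
    by (rule image_compactin[OF _ continuous_map_seminorm_point[of i]])
       (simp add: compactin_subtopology compact_form_seminorms)
  then have "compactin (an_top v I) (\<Union>i. seminorm_point I ` form_seminorms v I i)"
    by (intro compactin_Union) auto
  then show ?thesis unfolding compact_space_def topspace_an_top analytification_eq .
qed

end

section \<open>Absolute values of germs at points of the analytification\<close>

lemma regular_function_local:
  assumes "f \<in> carrier (regular_functions I U)" "P \<in> U"
  shows "\<exists>V a g. openin (zariski I) V \<and> P \<in> V \<and> V \<subseteq> U \<and>
    (\<forall>Q\<in>V. (a, g) \<in> frac_pairs Q \<and> f Q = fraction I Q a g)"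
  using assms by (simp add: regular_functions_def)

lemma regular_functionI:
  assumes "f \<in> extensional U"
    and "\<And>P. P \<in> U \<Longrightarrow> \<exists>V a g. openin (zariski I) V \<and> P \<in> V \<and> V \<subseteq> U \<and>
      (\<forall>Q\<in>V. (a, g) \<in> frac_pairs Q \<and> f Q = fraction I Q a g)"
  shows "f \<in> carrier (regular_functions I U)"
  using assms by (simp add: regular_functions_def)

lemma regular_function_value:
  assumes "f \<in> carrier (regular_functions I U)" "P \<in> U"
  shows "f P \<in> carrier (local_ring I P)"
proof -
  obtain V a g where "P \<in> V" "\<forall>Q\<in>V. (a, g) \<in> frac_pairs Q \<and> f Q = fraction I Q a g"
    using regular_function_local[OF assms] by blast
  then have "(a, g) \<in> frac_pairs P" "f P = fraction I P a g" by auto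
  then show ?thesis unfolding local_ring_def by auto
qed

context valued
begin

definition res :: "('n, 'k) an_point \<Rightarrow> ('n, 'k) germ \<Rightarrow> real" where
  "res x A = snd x (residue_class I (fst x) A)"

context
  fixes x
  assumes x: "x \<in> analytification v I"
begin

lemma an_point_Proj: "fst x \<in> Proj I"
  using x unfolding analytification_def by auto

interpretation scheme_point I "fst x"
  by (rule scheme_point.intro[OF ideal_I an_point_Proj])

lemma an_point_na: "na_absolute_value (residue_field I (fst x)) (snd x)"
  using x unfolding analytification_def by auto

lemma res_mult:
  "A \<in> carrier R \<Longrightarrow> B \<in> carrier R \<Longrightarrow> res x (A \<otimes>\<^bsub>R\<^esub> B) = res x A * res x B"
  using an_point_na residue_class_hom[of A B] residue_class_carrier[of A] residue_class_carrier[of B]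
  unfolding res_def na_absolute_value_def by simp

lemma res_nonneg: "A \<in> carrier R \<Longrightarrow> 0 \<le> res x A"
  using an_point_na residue_class_carrier[of A] unfolding res_def na_absolute_value_def by simp

lemma res_zero_iff: 
  assumes "A \<in> carrier R"
  shows "res x A = 0 \<longleftrightarrow> A \<in> max_ideal I (fst x)"
proof -
  obtain a f where af: "(a, f) \<in> frac_pairs (fst x)" "A = fraction I (fst x) a f"
    using R_carrierE[OF assms] .
  have "res x A = 0 \<longleftrightarrow> cls a f = \<zero>\<^bsub>residue_field I (fst x)\<^esub>"
    using an_point_na residue_class_carrier[OF assms]
    unfolding res_def na_absolute_value_def af(2) cls_def by simp
  then show ?thesis using cls_eq_zero_iff[OF af(1)] fraction_in_max_ideal[OF af(1)] af(2) by simp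
qed

lemma res_one: "res x \<one>\<^bsub>R\<^esub> = 1"
proof -
  have 1: "\<one>\<^bsub>R\<^esub> \<notin> max_ideal I (fst x)"
    unfolding R_one fraction_in_max_ideal[OF const_pairs(2)] by (rule P_prime(2))
  have "res x \<one>\<^bsub>R\<^esub> * res x \<one>\<^bsub>R\<^esub> = res x \<one>\<^bsub>R\<^esub>" using res_mult[of "\<one>\<^bsub>R\<^esub>" "\<one>\<^bsub>R\<^esub>"] by simp
  then show ?thesis using res_zero_iff[of "\<one>\<^bsub>R\<^esub>"] 1 by simp
qed

lemma res_pow: "A \<in> carrier R \<Longrightarrow> res x (A [^]\<^bsub>R\<^esub> (n::nat)) = res x A ^ n"
  by (induction n) (auto simp: res_one res_mult mult.commute)

end

end

section \<open>Sections and their powers\<close>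

text \<open>The tensor power of a section, taken coordinatewise. It brings sections of kL and k'L
  into the common bundle (k k')L, which is how maxima of Fubini-Study metrics are formed.\<close>

definition section_power ::
    "('n::finite, 'k::field) mpol set \<Rightarrow> ('i, 'n, 'k) line_bundle \<Rightarrow> nat \<Rightarrow> ('i \<Rightarrow> ('n, 'k) sect) \<Rightarrow> 'i \<Rightarrow> ('n, 'k) sect" where
  "section_power I L n s = (\<lambda>i\<in>index L. \<lambda>P\<in>chart L i. s i P [^]\<^bsub>local_ring I P\<^esub> n)"

section \<open>Norms of sections of a metrized line bundle\<close>

locale metrized = valued v I
  for v :: "'k::field \<Rightarrow> real" and I :: "('n::finite, 'k) mpol set" +
  fixes L :: "('i, 'n, 'k) line_bundle" and h :: "'i \<Rightarrow> ('n, 'k) an_point \<Rightarrow> real"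
  assumes lb: "line_bundle I L" and ref: "continuous_reference_metric v I L h"
begin

abbreviation "Xan \<equiv> analytification v I"

lemma chart_open: "i \<in> index L \<Longrightarrow> openin (zariski I) (chart L i)"
  and chart_cover: "(\<Union>i\<in>index L. chart L i) = Proj I"
  using lb unfolding line_bundle_def by auto

lemma trans_carrier:
  "i \<in> index L \<Longrightarrow> j \<in> index L \<Longrightarrow> P \<in> chart L i \<inter> chart L j \<Longrightarrow>
     trans L i j P \<in> carrier (local_ring I P)"
  using lb unfolding line_bundle_def Units_def by (intro regular_function_value[of _ _ "chart L i \<inter> chart L j"]) auto

lemma chart_Proj: "i \<in> index L \<Longrightarrow> P \<in> chart L i \<Longrightarrow> P \<in> Proj I"
  using chart_cover by blast

lemma chart_scheme_point: "i \<in> index L \<Longrightarrow> P \<in> chart L i \<Longrightarrow> scheme_point I P"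
  using chart_Proj by (intro scheme_point.intro ideal_I) blast

lemma H0_carrier: "s \<in> H0 I L k \<Longrightarrow> i \<in> index L \<Longrightarrow> s i \<in> carrier (regular_functions I (chart L i))"
  unfolding H0_def PiE_iff by blast

lemma H0_value: "s \<in> H0 I L k \<Longrightarrow> i \<in> index L \<Longrightarrow> P \<in> chart L i \<Longrightarrow> s i P \<in> carrier (local_ring I P)"
  by (rule regular_function_value[OF H0_carrier])

lemma H0_trans:
  "s \<in> H0 I L k \<Longrightarrow> i \<in> index L \<Longrightarrow> j \<in> index L \<Longrightarrow> P \<in> chart L i \<Longrightarrow> P \<in> chart L j \<Longrightarrow>
     s i P = (trans L i j P [^]\<^bsub>local_ring I P\<^esub> k) \<otimes>\<^bsub>local_ring I P\<^esub> s j P"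
  unfolding H0_def by blast

lemma h_cont:
  "i \<in> index L \<Longrightarrow> continuous_map
        (subtopology (an_top v I) {x \<in> Xan. fst x \<in> chart L i}) (top_of_set {0<..}) (h i)"
  using ref unfolding continuous_reference_metric_def by blast

lemma h_pos: "i \<in> index L \<Longrightarrow> x \<in> Xan \<Longrightarrow> fst x \<in> chart L i \<Longrightarrow> h i x > 0"
  using continuous_map_image_subset_topspace[OF h_cont, of i] by (auto simp: topspace_an_top)

lemma h_trans:
  "i \<in> index L \<Longrightarrow> j \<in> index L \<Longrightarrow> x \<in> Xan \<Longrightarrow> fst x \<in> chart L i \<Longrightarrow> fst x \<in> chart L j \<Longrightarrow>
     h j x = res x (trans L i j (fst x)) * h i x"
  using ref unfolding continuous_reference_metric_def abs_at_def res_def by blast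

lemma section_power_H0:
  assumes s: "s \<in> H0 I L k"
  shows "section_power I L n s \<in> H0 I L (k * n)"
proof -
  have carr: "(\<lambda>P\<in>chart L i. s i P [^]\<^bsub>local_ring I P\<^esub> n) \<in> carrier (regular_functions I (chart L i))"
    if i: "i \<in> index L" for i
  proof -
    have "\<exists>V a f. openin (zariski I) V \<and> P \<in> V \<and> V \<subseteq> chart L i \<and>
        (\<forall>Q\<in>V. (a, f) \<in> frac_pairs Q \<and> (\<lambda>P\<in>chart L i. s i P [^]\<^bsub>local_ring I P\<^esub> n) Q = fraction I Q a f)"
      if P: "P \<in> chart L i" for P
    proof -
      obtain V a f where V: "openin (zariski I) V" "P \<in> V" "V \<subseteq> chart L i"
        "\<And>Q. Q \<in> V \<Longrightarrow> (a, f) \<in> frac_pairs Q \<and> s i Q = fraction I Q a f"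
        using regular_function_local[OF H0_carrier[OF s i] P] by blast
      have "(a ^ n, f ^ n) \<in> frac_pairs Q \<and>
          (\<lambda>P\<in>chart L i. s i P [^]\<^bsub>local_ring I P\<^esub> n) Q = fraction I Q (a ^ n) (f ^ n)" if Q: "Q \<in> V" for Q
      proof -
        have QU: "Q \<in> chart L i" using Q V(3) by blast
        interpret scheme_point I Q by (rule chart_scheme_point[OF i QU])
        show ?thesis using V(4)[OF Q] QU R_pow[of a f n] frac_pairs_power[of a f n] by simp
      qed
      then show ?thesis using V(1-3) by blast
    qed
    then show ?thesis by (rule regular_functionI[OF restrict_extensional])
  qed
  have "section_power I L n s i P =
      (trans L i j P [^]\<^bsub>local_ring I P\<^esub> (k * n)) \<otimes>\<^bsub>local_ring I P\<^esub> section_power I L n s j P"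
    if ij: "i \<in> index L" "j \<in> index L" and pc: "P \<in> chart L i" "P \<in> chart L j" for i j P
  proof -
    interpret scheme_point I P by (rule chart_scheme_point[OF ij(1) pc(1)])
    have t: "trans L i j P \<in> carrier R" by (rule trans_carrier[OF ij IntI[OF pc]])
    have "s i P [^]\<^bsub>R\<^esub> n = (trans L i j P [^]\<^bsub>R\<^esub> k \<otimes>\<^bsub>R\<^esub> s j P) [^]\<^bsub>R\<^esub> n"
      by (rule arg_cong[OF H0_trans[OF s ij pc]])
    also have "\<dots> = (trans L i j P [^]\<^bsub>R\<^esub> k) [^]\<^bsub>R\<^esub> n \<otimes>\<^bsub>R\<^esub> s j P [^]\<^bsub>R\<^esub> n"
      using t H0_value[OF s ij(2) pc(2)] by (intro nat_pow_distrib nat_pow_closed)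
    also have "(trans L i j P [^]\<^bsub>R\<^esub> k) [^]\<^bsub>R\<^esub> n = trans L i j P [^]\<^bsub>R\<^esub> (k * n)"
      by (rule nat_pow_pow[OF t])
    finally show ?thesis using ij pc unfolding section_power_def by simp
  qed
  moreover have "section_power I L n s \<in> (\<Pi>\<^sub>E i\<in>index L. carrier (regular_functions I (chart L i)))"
    using carr by (simp add: section_power_def)
  ultimately show ?thesis unfolding H0_def by blast
qed

text \<open>Changing the chart multiplies the coordinate by the k-th power of the transition
  function and the norm of the frame by the inverse of its absolute value; the two changes cancel.
  This removes the arbitrary choice of a chart.\<close>

lemma section_norm_chart:
  assumes s: "s \<in> H0 I L k" and x: "x \<in> Xan" and i: "i \<in> index L" "fst x \<in> chart L i"
  shows "section_norm I L h k s x = res x (s i (fst x)) * h i x ^ k"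
proof -
  interpret scheme_point I "fst x" by (rule chart_scheme_point[OF i])
  define j where "j = (SOME i. i \<in> index L \<and> fst x \<in> chart L i)"
  have j: "j \<in> index L" "fst x \<in> chart L j"
    using someI[of "\<lambda>i. i \<in> index L \<and> fst x \<in> chart L i" i] i unfolding j_def by auto
  have t: "trans L j i (fst x) \<in> carrier R"
    by (rule trans_carrier[OF j(1) i(1) IntI[OF j(2) i(2)]])
  have si: "s i (fst x) \<in> carrier R" using H0_value[OF s i] .
  have "res x (s j (fst x)) = res x (trans L j i (fst x)) ^ k * res x (s i (fst x))"
    unfolding H0_trans[OF s j(1) i(1) j(2) i(2)]
    using res_mult[OF x nat_pow_closed[OF t] si] res_pow[OF x t] by simp
  then have "res x (s j (fst x)) * h j x ^ k = res x (s i (fst x)) * h i x ^ k"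
    unfolding h_trans[OF j(1) i(1) x j(2) i(2)] by (simp add: power_mult_distrib)
  then show ?thesis unfolding section_norm_def Let_def j_def[symmetric] abs_at_def res_def .
qed

lemma exists_chart: "x \<in> Xan \<Longrightarrow> \<exists>i\<in>index L. fst x \<in> chart L i"
  using an_point_Proj chart_cover by blast

lemma section_norm_nonneg:
  assumes "s \<in> H0 I L k" "x \<in> Xan"
  shows "0 \<le> section_norm I L h k s x"
proof -
  obtain i where i: "i \<in> index L" "fst x \<in> chart L i" using exists_chart[OF assms(2)] by blast
  then show ?thesis
    using section_norm_chart[OF assms i] res_nonneg[OF assms(2) H0_value[OF assms(1) i]] h_pos[OF i(1) assms(2) i(2)]
    by simp
qed

lemma section_norm_power:
  assumes "s \<in> H0 I L k" "x \<in> Xan"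
  shows "section_norm I L h (k * n) (section_power I L n s) x = section_norm I L h k s x ^ n"
proof -
  obtain i where i: "i \<in> index L" "fst x \<in> chart L i" using exists_chart[OF assms(2)] by blast
  have "res x (section_power I L n s i (fst x)) = res x (s i (fst x)) ^ n"
    using res_pow[OF assms(2) H0_value[OF assms(1) i]] i unfolding section_power_def by simp
  then show ?thesis
    unfolding section_norm_chart[OF assms i] section_norm_chart[OF section_power_H0[OF assms(1)] assms(2) i]
    by (simp add: power_mult power_mult_distrib)
qed

lemma nonvanishing_locus_power:
  assumes "s \<in> H0 I L k"
  shows "nonvanishing_locus I L s \<subseteq> nonvanishing_locus I L (section_power I L n s)"
proof
  fix P assume "P \<in> nonvanishing_locus I L s"
  then obtain i where i: "i \<in> index L" "P \<in> chart L i" "s i P \<notin> max_ideal I P"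
    unfolding nonvanishing_locus_def by blast
  interpret scheme_point I P by (rule chart_scheme_point[OF i(1,2)])
  have "section_power I L n s i P \<notin> max_ideal I P"
    using pow_not_in_max_ideal[OF H0_value[OF assms i(1,2)] i(3)] i unfolding section_power_def by simp
  then show "P \<in> nonvanishing_locus I L (section_power I L n s)"
    using i unfolding nonvanishing_locus_def by blast
qed

lemma section_norm_pos:
  assumes "s \<in> H0 I L k" "x \<in> Xan" "fst x \<in> nonvanishing_locus I L s"
  shows "0 < section_norm I L h k s x"
proof -
  obtain i where i: "i \<in> index L" "fst x \<in> chart L i" "s i (fst x) \<notin> max_ideal I (fst x)"
    using assms(3) unfolding nonvanishing_locus_def by blast
  have c: "s i (fst x) \<in> carrier (local_ring I (fst x))" using H0_value[OF assms(1) i(1,2)] .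
  have "0 < res x (s i (fst x))"
    using res_nonneg[OF assms(2) c] res_zero_iff[OF assms(2) c] i(3) by linarith
  then show ?thesis using section_norm_chart[OF assms(1,2) i(1,2)] h_pos[OF i(1) assms(2) i(2)] by simp
qed

lemma openin_chart: "i \<in> index L \<Longrightarrow> openin (an_top v I) {x \<in> Xan. fst x \<in> chart L i}"
  unfolding an_top_def
  by (intro topology_generated_by_Basis UnI1 CollectI exI[of _ "chart L i"] conjI refl chart_open)

lemma openin_abs_at:
  assumes "openin (zariski I) U" "f \<in> carrier (regular_functions I U)" "open W"
  shows "openin (an_top v I) {x \<in> Xan. fst x \<in> U \<and> abs_at I f x \<in> W}"
  unfolding an_top_def
  by (rule topology_generated_by_Basis, rule UnI2, rule CollectI, rule exI[of _ U], rule exI[of _ f],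
      rule exI[of _ W]) (use assms in simp)

text \<open>On each chart the norm is a product of continuous functions. As the charts are open and
  cover, preimages of open sets are unions of open sets in the charts.\<close>

lemma continuous_section_norm:
  assumes s: "s \<in> H0 I L k"
  shows "continuous_map (an_top v I) euclideanreal (section_norm I L h k s)"
proof -
  let ?O = "\<lambda>i. {x \<in> Xan. fst x \<in> chart L i}"
  have loc: "continuous_map (subtopology (an_top v I) (?O i)) euclideanreal (\<lambda>x. abs_at I (s i) x * h i x ^ k)"
    if i: "i \<in> index L" for i
  proof -
    have "continuous_map (subtopology (an_top v I) (?O i)) euclideanreal (abs_at I (s i))"
      unfolding continuous_map_def
    proof (intro conjI allI impI)
      fix W :: "real set" assume W: "openin euclideanreal W"
      have "openin (an_top v I) {x \<in> Xan. fst x \<in> chart L i \<and> abs_at I (s i) x \<in> W}"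
        by (rule openin_abs_at[OF chart_open[OF i] H0_carrier[OF s i]]) (use W in simp)
      moreover have "{x \<in> topspace (subtopology (an_top v I) (?O i)). abs_at I (s i) x \<in> W} =
          {x \<in> Xan. fst x \<in> chart L i \<and> abs_at I (s i) x \<in> W} \<inter> ?O i"
        by (auto simp: topspace_an_top)
      ultimately show "openin (subtopology (an_top v I) (?O i))
          {x \<in> topspace (subtopology (an_top v I) (?O i)). abs_at I (s i) x \<in> W}"
        unfolding openin_subtopology by blast
    qed auto
    moreover have "continuous_map (subtopology (an_top v I) (?O i)) euclideanreal (h i)"
      using h_cont[OF i] by (simp add: continuous_map_in_subtopology)
    ultimately show ?thesis by (intro continuous_intros)
  qed
  show ?thesis
    unfolding continuous_map_def
  proof (intro conjI allI impI)
    fix W :: "real set" assume W: "openin euclideanreal W"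
    have "openin (an_top v I) {x \<in> ?O i. abs_at I (s i) x * h i x ^ k \<in> W}" if i: "i \<in> index L" for i
    proof -
      have "topspace (subtopology (an_top v I) (?O i)) = ?O i" by (auto simp: topspace_an_top)
      from openin_continuous_map_preimage[OF loc[OF i] W, unfolded this] show ?thesis
        by (rule openin_trans_full[OF _ openin_chart[OF i]])
    qed
    then have "openin (an_top v I) (\<Union>i\<in>index L. {x \<in> ?O i. abs_at I (s i) x * h i x ^ k \<in> W})"
      by (intro openin_Union) auto
    moreover have "(\<Union>i\<in>index L. {x \<in> ?O i. abs_at I (s i) x * h i x ^ k \<in> W}) =
        {x \<in> topspace (an_top v I). section_norm I L h k s x \<in> W}"
    proof (intro equalityI subsetI)
      fix x assume "x \<in> (\<Union>i\<in>index L. {x \<in> ?O i. abs_at I (s i) x * h i x ^ k \<in> W})"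
      then obtain i where "i \<in> index L" "x \<in> Xan" "fst x \<in> chart L i" "abs_at I (s i) x * h i x ^ k \<in> W" by blast
      then show "x \<in> {x \<in> topspace (an_top v I). section_norm I L h k s x \<in> W}"
        using section_norm_chart[OF s] by (simp add: topspace_an_top abs_at_def res_def)
    next
      fix x assume "x \<in> {x \<in> topspace (an_top v I). section_norm I L h k s x \<in> W}"
      then have x: "x \<in> Xan" "section_norm I L h k s x \<in> W" by (auto simp: topspace_an_top)
      obtain i where i: "i \<in> index L" "fst x \<in> chart L i" using exists_chart[OF x(1)] by blast
      then have "abs_at I (s i) x * h i x ^ k \<in> W"
        using section_norm_chart[OF s x(1) i] x(2) by (simp add: abs_at_def res_def)
      then show "x \<in> (\<Union>i\<in>index L. {x \<in> ?O i. abs_at I (s i) x * h i x ^ k \<in> W})" using i x(1) by blast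
    qed
    ultimately show "openin (an_top v I) {x \<in> topspace (an_top v I). section_norm I L h k s x \<in> W}" by simp
  qed auto
qed

end

section \<open>Fubini-Study metrics\<close>

lemma mono_Max_image:
  fixes y :: "'a \<Rightarrow> ereal"
  assumes "finite A" "A \<noteq> {}" "mono f"
  shows "f (MAX j\<in>A. y j) = (MAX j\<in>A. f (y j))"
  using mono_Max_commute[OF assms(3), of "y ` A"] assms by (simp add: image_image)

lemma mono_ereal_mult: "0 \<le> c \<Longrightarrow> mono (\<lambda>y :: ereal. ereal c * y)"
  by (intro monoI ereal_mult_left_mono) auto

lemma mono_ereal_add: "mono (\<lambda>y :: ereal. y + c)"
  by (intro monoI add_right_mono)

text \<open>The value of \<open>FS\<close> at one point as a function of the numbers r j =
  |s_j|.\<close>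

definition FSv :: "nat \<Rightarrow> nat \<Rightarrow> (nat \<Rightarrow> real) \<Rightarrow> (nat \<Rightarrow> real) \<Rightarrow> ereal" where
  "FSv k m r a = ereal (1 / real k) * (MAX j\<in>{..<m}. log_ereal (r j) + ereal (a j))"

lemma FSv_shift:
  assumes "k \<ge> 1" "m > 0"
  shows "FSv k m r a + ereal c = FSv k m r (\<lambda>j. a j + real k * c)"
proof -
  have ne: "finite {..<m}" "{..<m} \<noteq> {}" using assms(2) by auto
  have e: "ereal (1 / real k) * y + ereal c = ereal (1 / real k) * (y + ereal (real k * c))" for y
  proof (cases y)
    case (real q)
    have "1 / real k * q + c = 1 / real k * (q + real k * c)"
      using assms(1) by (simp add: distrib_left)
    then show ?thesis unfolding real by simp
  qed (use assms(1) in auto)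
  have "(MAX j\<in>{..<m}. log_ereal (r j) + ereal (a j)) + ereal (real k * c) =
      (MAX j\<in>{..<m}. log_ereal (r j) + ereal (a j) + ereal (real k * c))"
    by (rule mono_Max_image[OF ne mono_ereal_add])
  then show ?thesis unfolding FSv_def e by (simp add: add.assoc)
qed

lemma log_ereal_power:
  assumes "r \<ge> 0" "n \<ge> 1"
  shows "log_ereal (r ^ n) + ereal (real n * a) = ereal (real n) * (log_ereal r + ereal a)"
  using assms by (auto simp: log_ereal_def ln_realpow algebra_simps)

lemma Max_lessThan_add:
  fixes y :: "nat \<Rightarrow> ereal"
  assumes "m > 0" "m' > 0"
  shows "(MAX j\<in>{..<m + m'}. if j < m then y j else y' (j - m)) = max (MAX j\<in>{..<m}. y j) (MAX j\<in>{..<m'}. y' j)"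
proof -
  have "{..<m + m'} = {..<m} \<union> (+) m ` {..<m'}"
  proof (intro equalityI subsetI)
    fix j assume "j \<in> {..<m + m'}"
    then show "j \<in> {..<m} \<union> (+) m ` {..<m'}"
      by (cases "j < m") (auto intro!: image_eqI[of _ _ "j - m"])
  qed auto
  moreover have "(\<lambda>j. if j < m then y j else y' (j - m)) ` ({..<m} \<union> (+) m ` {..<m'}) = y ` {..<m} \<union> y' ` {..<m'}"
    unfolding image_Un image_image by auto
  moreover have "Max (y ` {..<m} \<union> y' ` {..<m'}) = max (MAX j\<in>{..<m}. y j) (MAX j\<in>{..<m'}. y' j)"
    by (rule Max_Un) (use assms in auto)
  ultimately show ?thesis by presburger
qed

text \<open>Replacing each s_j by its power of exponent k' multiplies logarithms by k', so scaling
  the weights alike and dividing by k k' changes nothing. Over the common denominator the two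
  families are concatenated.\<close>

lemma FSv_max:
  assumes k: "k \<ge> 1" "k' \<ge> 1" and m: "m > 0" "m' > 0"
    and r: "\<And>j. j < m \<Longrightarrow> r j \<ge> 0" "\<And>j. j < m' \<Longrightarrow> r' j \<ge> 0"
  shows "max (FSv k m r a) (FSv k' m' r' a') =
    FSv (k * k') (m + m') (\<lambda>j. if j < m then r j ^ k' else r' (j - m) ^ k)
      (\<lambda>j. if j < m then real k' * a j else real k * a' (j - m))"
proof -
  define y where "y = (\<lambda>j. log_ereal (r j) + ereal (a j))"
  define y' where "y' = (\<lambda>j. log_ereal (r' j) + ereal (a' j))"
  have ne: "finite {..<m}" "{..<m} \<noteq> {}" "finite {..<m'}" "{..<m'} \<noteq> {}" using m by auto
  let ?c = "ereal (1 / real (k * k'))"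
  have "(MAX j\<in>{..<m + m'}. log_ereal (if j < m then r j ^ k' else r' (j - m) ^ k) +
      ereal (if j < m then real k' * a j else real k * a' (j - m))) =
    (MAX j\<in>{..<m + m'}. if j < m then ereal (real k') * y j else ereal (real k) * y' (j - m))"
    using log_ereal_power r k unfolding y_def y'_def
    by (intro arg_cong[of _ _ Max] image_cong refl) auto
  also have "\<dots> = max (MAX j\<in>{..<m}. ereal (real k') * y j) (MAX j\<in>{..<m'}. ereal (real k) * y' j)"
    by (rule Max_lessThan_add[OF m])
  also have "\<dots> = max (ereal (real k') * (MAX j\<in>{..<m}. y j)) (ereal (real k) * (MAX j\<in>{..<m'}. y' j))"
    using mono_Max_image[OF ne(1,2) mono_ereal_mult, of "real k'" y]
      mono_Max_image[OF ne(3,4) mono_ereal_mult, of "real k" y'] by simp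
  finally have "FSv (k * k') (m + m') (\<lambda>j. if j < m then r j ^ k' else r' (j - m) ^ k)
      (\<lambda>j. if j < m then real k' * a j else real k * a' (j - m)) =
      ?c * max (ereal (real k') * (MAX j\<in>{..<m}. y j)) (ereal (real k) * (MAX j\<in>{..<m'}. y' j))"
    unfolding FSv_def by simp
  also have "\<dots> = max (?c * (ereal (real k') * (MAX j\<in>{..<m}. y j))) (?c * (ereal (real k) * (MAX j\<in>{..<m'}. y' j)))"
    using monoD[OF mono_ereal_mult, of "1 / real (k * k')"] by (simp add: max_of_mono mono_ereal_mult)
  also have "?c * (ereal (real k') * (MAX j\<in>{..<m}. y j)) = FSv k m r a"
    unfolding FSv_def y_def mult.assoc[symmetric] times_ereal.simps using k by simp
  also have "?c * (ereal (real k) * (MAX j\<in>{..<m'}. y' j)) = FSv k' m' r' a'"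
    unfolding FSv_def y'_def mult.assoc[symmetric] times_ereal.simps using k by simp
  finally show ?thesis by simp
qed

text \<open>Individual logarithms may be -\<infinity>, which obstructs real arithmetic. Taking the
  maximum before the logarithm gives a positive real, and continuity becomes visible.\<close>

lemma FSv_real:
  assumes m: "m > 0" and r: "\<And>j. j < m \<Longrightarrow> r j \<ge> 0" and pos: "\<exists>j<m. r j > 0"
  shows "0 < (MAX j\<in>{..<m}. r j * exp (a j))"
    "FSv k m r a = ereal (1 / real k * ln (MAX j\<in>{..<m}. r j * exp (a j)))"
proof -
  have ne: "finite {..<m}" "{..<m} \<noteq> {}" using m by auto
  obtain j where "j < m" "r j > 0" using pos by blast
  then have "0 < r j * exp (a j)" "r j * exp (a j) \<le> (MAX j\<in>{..<m}. r j * exp (a j))"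
    by (auto intro!: Max_ge)
  then show p: "0 < (MAX j\<in>{..<m}. r j * exp (a j))" by linarith
  \<comment> \<open>Truncation at 0 keeps \<open>log_ereal\<close> away from negative arguments; the
    values to which it is applied are nonnegative, so nothing changes there.\<close>
  have mono: "mono (\<lambda>r. log_ereal (max 0 r))"
    by (intro monoI) (auto simp: log_ereal_def max_def)
  have "(MAX j\<in>{..<m}. log_ereal (r j) + ereal (a j)) = (MAX j\<in>{..<m}. log_ereal (max 0 (r j * exp (a j))))"
  proof (intro arg_cong[of _ _ Max] image_cong refl)
    fix j assume "j \<in> {..<m}"
    then show "log_ereal (r j) + ereal (a j) = log_ereal (max 0 (r j * exp (a j)))"
      using r[of j] by (auto simp: log_ereal_def ln_mult max_def)
  qed
  also have "\<dots> = log_ereal (max 0 (MAX j\<in>{..<m}. r j * exp (a j)))"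
    using mono_Max_commute[OF mono, of "(\<lambda>j. r j * exp (a j)) ` {..<m}"] ne by (simp add: image_image)
  finally show "FSv k m r a = ereal (1 / real k * ln (MAX j\<in>{..<m}. r j * exp (a j)))"
    unfolding FSv_def using p by (simp add: log_ereal_def)
qed

lemma continuous_map_Max:
  fixes g :: "nat \<Rightarrow> 'p \<Rightarrow> real"
  assumes "m > 0" "\<And>j. j < m \<Longrightarrow> continuous_map T euclideanreal (g j)"
  shows "continuous_map T euclideanreal (\<lambda>x. MAX j\<in>{..<m}. g j x)"
  using assms
proof (induction m)
  case (Suc m)
  show ?case
  proof (cases "m = 0")
    case True
    then show ?thesis using Suc(3)[of 0] by (simp add: lessThan_Suc)
  next
    case False
    then have "(MAX j\<in>{..<Suc m}. g j x) = max (g m x) (MAX j\<in>{..<m}. g j x)" for x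
      unfolding lessThan_Suc image_insert by (intro Max_insert) auto
    moreover have "continuous_map T euclideanreal (\<lambda>x. max (g m x) (MAX j\<in>{..<m}. g j x))"
      using Suc False by (intro continuous_intros) auto
    ultimately show ?thesis by simp
  qed
qed simp

section \<open>Closure properties of Fubini-Study metrics and segments\<close>

context metrized
begin

lemma FS_FSv: "x \<in> Xan \<Longrightarrow> FS v I L h k m s a x = FSv k m (\<lambda>j. section_norm I L h k (s j) x) a"
  unfolding FS_def FSv_def by simp

lemma FS_ext: "FS v I L h k m s a \<in> extensional Xan"
  unfolding FS_def by simp

definition merge_sections :: "nat \<Rightarrow> nat \<Rightarrow> (nat \<Rightarrow> 'i \<Rightarrow> ('n, 'k) sect) \<Rightarrow>
    nat \<Rightarrow> (nat \<Rightarrow> 'i \<Rightarrow> ('n, 'k) sect) \<Rightarrow> nat \<Rightarrow> 'i \<Rightarrow> ('n, 'k) sect" where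
  "merge_sections k m s k' s' =
    (\<lambda>j. if j < m then section_power I L k' (s j) else section_power I L k (s' (j - m)))"

definition merge_weights :: "nat \<Rightarrow> nat \<Rightarrow> (nat \<Rightarrow> real) \<Rightarrow> nat \<Rightarrow> (nat \<Rightarrow> real) \<Rightarrow> nat \<Rightarrow> real" where
  "merge_weights k m a k' a' = (\<lambda>j. if j < m then real k' * a j else real k * a' (j - m))"

lemma merge_sections_H0:
  assumes "\<And>j. j < m \<Longrightarrow> s j \<in> H0 I L k" "\<And>j. j < m' \<Longrightarrow> s' j \<in> H0 I L k'" "j < m + m'"
  shows "merge_sections k m s k' s' j \<in> H0 I L (k * k')"
proof (cases "j < m")
  case True
  then show ?thesis unfolding merge_sections_def using section_power_H0[OF assms(1)] by simp
next
  case False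
  then have "j - m < m'" using assms(3) by linarith
  from section_power_H0[OF assms(2)[OF this], of k] show ?thesis
    using False unfolding merge_sections_def by (simp add: mult.commute)
qed

text \<open>The second family alone guarantees the absence of base points. So the first may be a
  single section with zeros, as in the verification of the axiom \<open>S_piece\<close>.\<close>

lemma merge_sections_bpf:
  assumes "\<And>j. j < m' \<Longrightarrow> s' j \<in> H0 I L k'" "basepoint_free I L m' s'"
  shows "basepoint_free I L (m + m') (merge_sections k m s k' s')"
  unfolding basepoint_free_def
proof
  fix P assume "P \<in> Proj I"
  then obtain j where j: "j < m'" "P \<in> nonvanishing_locus I L (s' j)"
    using assms(2) unfolding basepoint_free_def by blast
  then have "P \<in> nonvanishing_locus I L (merge_sections k m s k' s' (m + j))"
    using nonvanishing_locus_power[OF assms(1)[OF j(1)], of k] unfolding merge_sections_def by auto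
  then show "P \<in> (\<Union>j<m + m'. nonvanishing_locus I L (merge_sections k m s k' s' j))"
    using j(1) by (intro UN_I[of "m + j"]) auto
qed

lemma FS_merge:
  assumes k: "k \<ge> 1" "k' \<ge> 1" and m: "m > 0" "m' > 0"
    and s: "\<And>j. j < m \<Longrightarrow> s j \<in> H0 I L k" "\<And>j. j < m' \<Longrightarrow> s' j \<in> H0 I L k'" and x: "x \<in> Xan"
  shows "max (FS v I L h k m s a x) (FS v I L h k' m' s' a' x) =
     FS v I L h (k * k') (m + m') (merge_sections k m s k' s') (merge_weights k m a k' a') x"
proof -
  have "section_norm I L h (k * k') (merge_sections k m s k' s' j) x =
      (if j < m then section_norm I L h k (s j) x ^ k' else section_norm I L h k' (s' (j - m)) x ^ k)"
    if j: "j < m + m'" for j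
  proof (cases "j < m")
    case True
    then show ?thesis unfolding merge_sections_def using section_norm_power[OF s(1) x] by simp
  next
    case False
    then have "j - m < m'" using j by linarith
    from section_norm_power[OF s(2)[OF this] x, of k] show ?thesis
      using False unfolding merge_sections_def by (simp add: mult.commute)
  qed
  then have "FSv (k * k') (m + m') (\<lambda>j. section_norm I L h (k * k') (merge_sections k m s k' s' j) x) b =
      FSv (k * k') (m + m') (\<lambda>j. if j < m then section_norm I L h k (s j) x ^ k'
        else section_norm I L h k' (s' (j - m)) x ^ k) b" for b
    unfolding FSv_def by (intro arg_cong2[where f = "(*)"] refl arg_cong[of _ _ Max] image_cong) auto
  then show ?thesis
    unfolding FS_FSv[OF x] merge_weights_def
    using FSv_max[OF k m, of "\<lambda>j. section_norm I L h k (s j) x" "\<lambda>j. section_norm I L h k' (s' j) x" a a']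
      section_norm_nonneg[OF s(1) x] section_norm_nonneg[OF s(2) x] by simp
qed

lemma FS_shift:
  assumes "k \<ge> 1" "m > 0" "x \<in> Xan"
  shows "FS v I L h k m s a x + ereal c = FS v I L h k m s (\<lambda>j. a j + real k * c) x"
  unfolding FS_FSv[OF assms(3)] by (rule FSv_shift[OF assms(1,2)])

lemma FS_cont:
  assumes "m > 0" "\<And>j. j < m \<Longrightarrow> s j \<in> H0 I L k" "basepoint_free I L m s"
  shows "finite_continuous (an_top v I) (FS v I L h k m s a)"
proof (rule finite_continuous_real)
  let ?g = "\<lambda>x. MAX j\<in>{..<m}. section_norm I L h k (s j) x * exp (a j)"
  have pos: "\<exists>j<m. section_norm I L h k (s j) x > 0" if x: "x \<in> Xan" for x
  proof -
    obtain j where "j < m" "fst x \<in> nonvanishing_locus I L (s j)"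
      using assms(3) an_point_Proj[OF x] unfolding basepoint_free_def by blast
    then show ?thesis using section_norm_pos[OF assms(2) x] by blast
  qed
  note real = FSv_real[OF assms(1) section_norm_nonneg[OF assms(2)] pos]
  show "FS v I L h k m s a x = ereal (1 / real k * ln (?g x))" if "x \<in> topspace (an_top v I)" for x
    using that real(2)[of x] unfolding topspace_an_top by (simp add: FS_FSv)
  have "continuous_map (an_top v I) euclideanreal ?g"
    using assms by (intro continuous_map_Max continuous_intros continuous_section_norm) auto
  then have "continuous_map (an_top v I) (top_of_set {0<..}) ?g"
    using real(1) by (auto simp: continuous_map_in_subtopology topspace_an_top)
  moreover have "continuous_map (top_of_set {0::real<..}) euclideanreal ln"
    by (auto intro!: continuous_intros)
  ultimately have "continuous_map (an_top v I) euclideanreal (ln \<circ> ?g)"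
    by (rule continuous_map_compose)
  then show "continuous_map (an_top v I) euclideanreal (\<lambda>x. 1 / real k * ln (?g x))"
    unfolding comp_def by (rule continuous_map_real_mult_left)
qed

lemma bpf_nonempty: "basepoint_free I L m s \<Longrightarrow> Proj I \<noteq> {} \<Longrightarrow> m > 0"
  unfolding basepoint_free_def by (cases m) auto

lemma FS_metricsE:
  assumes "f \<in> FS_metrics v I L h" "Proj I \<noteq> {}"
  obtains k m s a where "k \<ge> 1" "m > 0" "\<forall>j<m. s j \<in> H0 I L k" "basepoint_free I L m s"
    "f = FS v I L h k m s a"
proof -
  obtain k m s a where *: "f = FS v I L h k m s a \<and> k \<ge> 1 \<and> (\<forall>j<m. s j \<in> H0 I L k) \<and> basepoint_free I L m s"
    using assms(1) unfolding FS_metrics_def mem_Collect_eq by (elim exE) (rule that)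
  show thesis by (rule that[of k m s a]) (use * bpf_nonempty[of m s] assms(2) in simp_all)
qed

lemma FS_metricsI:
  "k \<ge> 1 \<Longrightarrow> (\<And>j. j < m \<Longrightarrow> s j \<in> H0 I L k) \<Longrightarrow> basepoint_free I L m s \<Longrightarrow>
     FS v I L h k m s a \<in> FS_metrics v I L h"
  unfolding FS_metrics_def by blast

lemma FS_segmentsE:
  assumes "G \<in> FS_segments v I L h" "Proj I \<noteq> {}"
  obtains k m s a b where "k \<ge> 1" "m > 0" "\<forall>j<m. s j \<in> H0 I L k" "basepoint_free I L m s"
    "G = (\<lambda>t\<in>{0..1}. FS v I L h k m s (\<lambda>j. (1 - t) * a j + t * b j))"
proof -
  obtain k m s a b where *: "G = (\<lambda>t\<in>{0..1}. FS v I L h k m s (\<lambda>j. (1 - t) * a j + t * b j)) \<and>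
      k \<ge> 1 \<and> (\<forall>j<m. s j \<in> H0 I L k) \<and> basepoint_free I L m s"
    using assms(1) unfolding FS_segments_def mem_Collect_eq by (elim exE) (rule that)
  show thesis by (rule that[of k m s a b]) (use * bpf_nonempty[of m s] assms(2) in simp_all)
qed

lemma FS_segmentsI:
  assumes "k \<ge> 1" "\<And>j. j < m \<Longrightarrow> s j \<in> H0 I L k" "basepoint_free I L m s"
    "\<And>t x. t \<in> {0..1} \<Longrightarrow> x \<in> Xan \<Longrightarrow> G t x = FS v I L h k m s (\<lambda>j. (1 - t) * a j + t * b j) x"
  shows "(\<lambda>t\<in>{0..1}. \<lambda>x\<in>Xan. G t x) \<in> FS_segments v I L h"
proof -
  have "(\<lambda>x\<in>Xan. G t x) = FS v I L h k m s (\<lambda>j. (1 - t) * a j + t * b j)" if "t \<in> {0..1}" for t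
    by (rule extensionalityI[OF _ FS_ext]) (use assms(4)[OF that] in auto)
  then have "(\<lambda>t\<in>{0..1}. \<lambda>x\<in>Xan. G t x) = (\<lambda>t\<in>{0..1}. FS v I L h k m s (\<lambda>j. (1 - t) * a j + t * b j))"
    by (intro restrict_ext) auto
  then show ?thesis unfolding FS_segments_def using assms(1-3) by blast
qed

lemma FS_eqI: "(\<And>x. x \<in> Xan \<Longrightarrow> g x = FS v I L h k m s a x) \<Longrightarrow> (\<lambda>x\<in>Xan. g x) = FS v I L h k m s a"
  by (rule extensionalityI[OF _ FS_ext]) auto

text \<open>Nonemptiness of \<open>Proj I\<close> forces a basepoint-free family to be nonempty, so
  each \<open>Max\<close> ranges over a nonempty set.\<close>

lemma segment_setting_FS:
  assumes ne: "Proj I \<noteq> {}"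
  shows "segment_setting (an_top v I) (FS_metrics v I L h) (FS_segments v I L h)"
proof (unfold_locales, unfold topspace_an_top)
  let ?F = "FS_metrics v I L h" and ?S = "FS_segments v I L h"
  show "compact_space (an_top v I)" by (rule compact_analytification)
  show "f \<in> extensional Xan" if "f \<in> ?F" for f
    using that FS_ext unfolding FS_metrics_def by blast
  show "finite_continuous (an_top v I) f" if fF: "f \<in> ?F" for f
  proof -
    obtain k m s a where f: "k \<ge> 1" "m > 0" "\<forall>j<m. s j \<in> H0 I L k" "basepoint_free I L m s"
        "f = FS v I L h k m s a" by (rule FS_metricsE[OF fF ne]) (rule that; assumption)
    show ?thesis unfolding f(5) by (rule FS_cont) (use f in auto)
  qed
  show "(\<lambda>x\<in>Xan. max (f x) (g x)) \<in> ?F" if fF: "f \<in> ?F" and gF: "g \<in> ?F" for f g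
  proof -
    obtain k m s a where f: "k \<ge> 1" "m > 0" "\<forall>j<m. s j \<in> H0 I L k" "basepoint_free I L m s"
        "f = FS v I L h k m s a" by (rule FS_metricsE[OF fF ne]) (rule that; assumption)
    obtain k' m' s' a' where g: "k' \<ge> 1" "m' > 0" "\<forall>j<m'. s' j \<in> H0 I L k'" "basepoint_free I L m' s'"
        "g = FS v I L h k' m' s' a'" by (rule FS_metricsE[OF gF ne]) (rule that; assumption)
    have e: "(\<lambda>x\<in>Xan. max (f x) (g x)) =
        FS v I L h (k * k') (m + m') (merge_sections k m s k' s') (merge_weights k m a k' a')"
      unfolding f(5) g(5) by (rule FS_eqI, rule FS_merge) (use f g in auto)
    show ?thesis unfolding e
      by (rule FS_metricsI[OF _ merge_sections_H0 merge_sections_bpf]) (use f g in auto)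
  qed
  show "(\<lambda>x\<in>Xan. f x + ereal c) \<in> ?F" if fF: "f \<in> ?F" for f c
  proof -
    obtain k m s a where f: "k \<ge> 1" "m > 0" "\<forall>j<m. s j \<in> H0 I L k" "basepoint_free I L m s"
        "f = FS v I L h k m s a" by (rule FS_metricsE[OF fF ne]) (rule that; assumption)
    have e: "(\<lambda>x\<in>Xan. f x + ereal c) = FS v I L h k m s (\<lambda>j. a j + real k * c)"
      unfolding f(5) by (rule FS_eqI, rule FS_shift) (use f in auto)
    show ?thesis unfolding e by (rule FS_metricsI) (use f in auto)
  qed
  show "G t \<in> ?F" if GS: "G \<in> ?S" and t: "t \<in> {0..1}" for G t
  proof -
    obtain k m s a b where G: "k \<ge> 1" "m > 0" "\<forall>j<m. s j \<in> H0 I L k" "basepoint_free I L m s"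
      "G = (\<lambda>t\<in>{0..1}. FS v I L h k m s (\<lambda>j. (1 - t) * a j + t * b j))"
      by (rule FS_segmentsE[OF GS ne]) (rule that; assumption)
    have e: "G t = FS v I L h k m s (\<lambda>j. (1 - t) * a j + t * b j)" using t by (simp add: G(5))
    show ?thesis unfolding e by (rule FS_metricsI) (use G in auto)
  qed
  show "(\<lambda>t\<in>{0..1}. \<lambda>x\<in>Xan. f x + ereal (t * \<mu>)) \<in> ?S" if fF: "f \<in> ?F" for f \<mu>
  proof -
    obtain k m s a where f: "k \<ge> 1" "m > 0" "\<forall>j<m. s j \<in> H0 I L k" "basepoint_free I L m s"
        "f = FS v I L h k m s a" by (rule FS_metricsE[OF fF ne]) (rule that; assumption)
    show ?thesis
    \<comment> \<open>The final weights exceed the initial ones by k \<mu>, because the factor 1/k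
      turns this into slope \<mu>.\<close>
    proof (rule FS_segmentsI[of k m s _ a "\<lambda>j. a j + real k * \<mu>"])
      fix t x assume "x \<in> Xan"
      have "(\<lambda>j. a j + real k * (t * \<mu>)) = (\<lambda>j. (1 - t) * a j + t * (a j + real k * \<mu>))"
        by (simp add: algebra_simps)
      then show "f x + ereal (t * \<mu>) = FS v I L h k m s (\<lambda>j. (1 - t) * a j + t * (a j + real k * \<mu>)) x"
        unfolding f(5) using FS_shift[OF f(1,2) \<open>x \<in> Xan\<close>] by metis
    qed (use f in auto)
  qed
  show "(\<lambda>t\<in>{0..1}. \<lambda>x\<in>Xan. max (G t x) (H t x)) \<in> ?S" if GS: "G \<in> ?S" and HS: "H \<in> ?S" for G H
  proof -
    obtain k m s a b where G: "k \<ge> 1" "m > 0" "\<forall>j<m. s j \<in> H0 I L k" "basepoint_free I L m s"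
      "G = (\<lambda>t\<in>{0..1}. FS v I L h k m s (\<lambda>j. (1 - t) * a j + t * b j))"
      by (rule FS_segmentsE[OF GS ne]) (rule that; assumption)
    obtain k' m' s' a' b' where H: "k' \<ge> 1" "m' > 0" "\<forall>j<m'. s' j \<in> H0 I L k'" "basepoint_free I L m' s'"
      "H = (\<lambda>t\<in>{0..1}. FS v I L h k' m' s' (\<lambda>j. (1 - t) * a' j + t * b' j))"
      by (rule FS_segmentsE[OF HS ne]) (rule that; assumption)
    show ?thesis
    proof (rule FS_segmentsI[of "k * k'" "m + m'" "merge_sections k m s k' s'" _
          "merge_weights k m a k' a'" "merge_weights k m b k' b'"])
      fix t :: real and x assume t: "t \<in> {0..1}" and x: "x \<in> Xan"
      have "merge_weights k m (\<lambda>j. (1 - t) * a j + t * b j) k' (\<lambda>j. (1 - t) * a' j + t * b' j) =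
          (\<lambda>j. (1 - t) * merge_weights k m a k' a' j + t * merge_weights k m b k' b' j)"
        unfolding merge_weights_def by (auto simp: algebra_simps)
      then show "max (G t x) (H t x) = FS v I L h (k * k') (m + m') (merge_sections k m s k' s')
          (\<lambda>j. (1 - t) * merge_weights k m a k' a' j + t * merge_weights k m b k' b' j) x"
        using FS_merge[OF G(1) H(1) G(2) H(2) G(3)[rule_format] H(3)[rule_format] x] t unfolding G(5) H(5) by simp
    next
      show "basepoint_free I L (m + m') (merge_sections k m s k' s')"
        by (rule merge_sections_bpf) (use H in auto)
      show "merge_sections k m s k' s' j \<in> H0 I L (k * k')" if "j < m + m'" for j
        by (rule merge_sections_H0[OF _ _ that]) (use G H in auto)
    qed (use G H in auto)
  qed
  show "(\<lambda>t\<in>{0..1}. \<lambda>x\<in>Xan. G t x + ereal c) \<in> ?S" if GS: "G \<in> ?S" for G c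
  proof -
    obtain k m s a b where G: "k \<ge> 1" "m > 0" "\<forall>j<m. s j \<in> H0 I L k" "basepoint_free I L m s"
      "G = (\<lambda>t\<in>{0..1}. FS v I L h k m s (\<lambda>j. (1 - t) * a j + t * b j))"
      by (rule FS_segmentsE[OF GS ne]) (rule that; assumption)
    show ?thesis
    proof (rule FS_segmentsI[of k m s _ "\<lambda>j. a j + real k * c" "\<lambda>j. b j + real k * c"])
      fix t :: real and x assume t: "t \<in> {0..1}" and x: "x \<in> Xan"
      have "(\<lambda>j. (1 - t) * a j + t * b j + real k * c) =
          (\<lambda>j. (1 - t) * (a j + real k * c) + t * (b j + real k * c))"
        by (simp add: algebra_simps)
      then show "G t x + ereal c = FS v I L h k m s (\<lambda>j. (1 - t) * (a j + real k * c) + t * (b j + real k * c)) x"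
        using FS_shift[OF G(1,2) x] t unfolding G(5) by simp
    qed (use G in auto)
  qed
  show "\<exists>u \<mu>. G t x = u x + ereal (t * \<mu>) \<and> (\<forall>s\<in>{0..1}. \<forall>y\<in>Xan. u y + ereal (s * \<mu>) \<le> G s y) \<and>
      (\<forall>f\<in>?F. \<forall>c. (\<lambda>y\<in>Xan. max (u y + ereal c) (f y)) \<in> ?F)"
    if GS: "G \<in> ?S" and t: "t \<in> {0..1}" and x: "x \<in> Xan" for G t x
  proof -
    obtain k m s a b where G: "k \<ge> 1" "m > 0" "\<forall>j<m. s j \<in> H0 I L k" "basepoint_free I L m s"
      "G = (\<lambda>t\<in>{0..1}. FS v I L h k m s (\<lambda>j. (1 - t) * a j + t * b j))"
      by (rule FS_segmentsE[OF GS ne]) (rule that; assumption)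
    let ?y = "\<lambda>t x j. log_ereal (section_norm I L h k (s j) x) + ereal ((1 - t) * a j + t * b j)"
    have fin: "finite {..<m}" "{..<m} \<noteq> {}" using G(2) by auto
    have Gt: "G t x = ereal (1 / real k) * (MAX j\<in>{..<m}. ?y t x j)" if "t \<in> {0..1}" "x \<in> Xan" for t x
      using that by (simp add: G(5) FS_def)
    have "(MAX j\<in>{..<m}. ?y t x j) \<in> ?y t x ` {..<m}" by (rule Max_in) (use fin in auto)
    \<comment> \<open>The piece is the term of an index attaining the maximum at (t, x). Its weight
      moves from a j to b j, hence the slope (b j - a j) / k and the initial value \<open>u\<close>
      given by this one section.\<close>
    then obtain j where j: "j < m" "(MAX j\<in>{..<m}. ?y t x j) = ?y t x j" by auto
    define \<mu> where "\<mu> = (b j - a j) / real k"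
    define u where "u = FS v I L h k 1 (\<lambda>_. s j) (\<lambda>_. a j)"
    have u: "u y + ereal (r * \<mu>) = ereal (1 / real k) * ?y r y j" if y: "y \<in> Xan" for y r
    proof -
      have "real k * (r * \<mu>) = r * (b j - a j)" using G(1) unfolding \<mu>_def by simp
      then have "a j + real k * (r * \<mu>) = (1 - r) * a j + r * b j" by (simp add: algebra_simps)
      then show ?thesis
        unfolding u_def FS_shift[OF G(1) zero_less_one y] using y
        by (simp add: FS_def lessThan_Suc)
    qed
    show ?thesis
    proof (intro exI[of _ u] exI[of _ \<mu>] conjI ballI allI)
      show "G t x = u x + ereal (t * \<mu>)" using Gt[OF t x] u[OF x] j(2) by simp
      show "u y + ereal (r * \<mu>) \<le> G r y" if "r \<in> {0..1}" "y \<in> Xan" for r y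
      proof -
        have "?y r y j \<le> (MAX j\<in>{..<m}. ?y r y j)" by (rule Max_ge) (use j in auto)
        then show ?thesis using Gt[OF that] u[OF that(2)] monoD[OF mono_ereal_mult, of "1 / real k"] by simp
      qed
      fix f c assume fF: "f \<in> ?F"
      obtain k' m' s' a' where f: "k' \<ge> 1" "m' > 0" "\<forall>j<m'. s' j \<in> H0 I L k'" "basepoint_free I L m' s'"
          "f = FS v I L h k' m' s' a'" by (rule FS_metricsE[OF fF assms]) (rule that; assumption)
      have "(\<lambda>y\<in>Xan. max (u y + ereal c) (f y)) =
          FS v I L h (k * k') (1 + m') (merge_sections k 1 (\<lambda>_. s j) k' s') (merge_weights k 1 (\<lambda>_. a j + real k * c) k' a')"
      proof (rule FS_eqI)
        fix y assume y: "y \<in> Xan"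
        show "max (u y + ereal c) (f y) = FS v I L h (k * k') (1 + m') (merge_sections k 1 (\<lambda>_. s j) k' s')
            (merge_weights k 1 (\<lambda>_. a j + real k * c) k' a') y"
          unfolding u_def FS_shift[OF G(1) zero_less_one y] f(5)
          by (rule FS_merge) (use G j f y in auto)
      qed
      moreover have "\<dots> \<in> ?F"
        by (rule FS_metricsI[OF _ merge_sections_H0 merge_sections_bpf]) (use f G j in auto)
      ultimately show "(\<lambda>y\<in>Xan. max (u y + ereal c) (f y)) \<in> ?F" by simp
    qed
  qed
qed

end

section \<open>Transfer from the abstract setting to psh metrics on L\<close>

theorem theoremC:
  fixes v :: "'k::field \<Rightarrow> real"
    and I :: "('n::finite, 'k) mpol set"
    and L :: "('i, 'n, 'k) line_bundle"
    and h :: "'i \<Rightarrow> ('n, 'k) an_point \<Rightarrow> real"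
    and \<phi>0 \<phi>1 :: "('n, 'k) an_point \<Rightarrow> ereal"
  assumes "complete_na_field v"
    and "projective_variety I"
    and "line_bundle I L" and "ample I L"
    and "continuous_reference_metric v I L h"
    and "continuity_of_envelopes v I L h"
    and "\<phi>0 \<in> PSH v I L h" and "\<phi>1 \<in> PSH v I L h"
  shows "(\<nexists>\<phi>. psh_segment_between v I L h \<phi>0 \<phi>1 \<phi>) \<or>
         (\<exists>!\<phi>. maximal_psh_segment_between v I L h \<phi>0 \<phi>1 \<phi>)"
proof -
  interpret metrized v I L h
    by unfold_locales
       (use assms in \<open>auto simp: complete_na_field_def projective_variety_def\<close>)
  \<comment> \<open>A psh metric is different from -\<infinity> somewhere, so the analytification
    has a point.\<close>
  obtain x where "x \<in> Xan" using assms(7) unfolding PSH_def by blast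
  then have ne: "Proj I \<noteq> {}" using an_point_Proj by blast
  interpret seg: segment_setting "an_top v I" "FS_metrics v I L h" "FS_segments v I L h"
    by (rule segment_setting_FS[OF ne])
  have psh: "seg.psh = PSH v I L h"
    unfolding seg.psh_def PSH_def topspace_an_top ..
  have pseg: "seg.pseg = psh_segment v I L h"
    unfolding seg.pseg_def psh_segment_def psh topspace_an_top fun_eq_iff by simp
  have env: "finite_continuous (an_top v I) (seg.env m)"
    if "m \<in> extensional (topspace (an_top v I))" "finite_continuous (an_top v I) m" for m
  proof -
    have "seg.env m = envelope v I L h m"
      unfolding seg.env_def envelope_def metric_le_def psh topspace_an_top ..
    moreover have "continuous_metric v I m"
      using that unfolding continuous_metric_def finite_continuous_def topspace_an_top by simp
    then have "continuous_metric v I (envelope v I L h m)"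
      using assms(6) unfolding continuity_of_envelopes_def by blast
    ultimately show ?thesis
      unfolding continuous_metric_def finite_continuous_def topspace_an_top by simp
  qed
  have "\<exists>!\<phi>. maximal_psh_segment_between v I L h \<phi>0 \<phi>1 \<phi>"
    if "psh_segment_between v I L h \<phi>0 \<phi>1 \<xi>" for \<xi>
    using seg.unique_maximal_segment[OF env, of \<phi>0 \<phi>1 \<xi>] that assms(7,8)
    unfolding psh pseg topspace_an_top maximal_psh_segment_between_def psh_segment_between_def metric_le_def
    by simp
  then show ?thesis by blast
qed

end
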